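(* Let $(X_1,\ldots,X_d)\in M_n(\mathbb{C})^d$ with $\hat{\rho}(X_1,\ldots,X_d)=1$ and let $T=\sum_{i=1}^d\overline{X_i}\otimes X_i$. Let $\Lambda$, $T_\lambda$ ($\lambda\in\Lambda$) and $\hat{T}$ be the objects associated with $T$ as defined in the context. Then: (1) There is an $a\in\mathbb{N}$ such that for every $\lambda\in\Lambda$ there are $A_{\lambda,1},\ldots,A_{\lambda,a}\in M_n(\mathbb{C})$ such that $T_\lambda=\sum_{j=1}^a\overline{A_{\lambda,j}}\otimes A_{\lambda,j}$. (2) There are finitely many $B_k\in M_n(\mathbb{C})$, whose linear span is a nonzero (two-sided) ideal in the algebra generated by $X_1,\ldots,X_d$, such that $\hat{T}=\sum_k\overline{B_k}\otimes B_k$. Moreover, the $A_{\lambda,j}$ are contained in the span of the $B_k$'s.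
   Context: $\overline{A}$ is the entrywise complex conjugate, $\otimes$ the Kronecker product, $\rho$ the spectral radius, and $\hat{\rho}(X_1,\ldots,X_d)=\sqrt{\rho(\sum_i\overline{X_i}\otimes X_i)}$. The degeneracy index of an eigenvalue is the maximum size of its Jordan blocks. The maximal spectrum of $T$ is the set of eigenvalues of $T$ of maximum modulus that have the largest degeneracy index among all eigenvalues of maximum modulus. Assume $\rho(T)=1$. Let $\lambda_1,\ldots,\lambda_{m_T}$ be the distinct elements of the maximal spectrum of $T$, let $\tau=(\lambda_1,\ldots,\lambda_{m_T})\in\mathbb{T}^{m_T}$ (where $\mathbb{T}$ is the unit circle), and let $\Lambda$ be the closure of the subgroup of $\mathbb{T}^{m_T}$ generated by $\tau$. For $\lambda\in\Lambda$, $T_\lambda$ is the limit of $T^{m}/\|T^{m}\|$ along any sequence of positive integers $m\to\infty$ with $\tau^{m}\to\lambda$ (here $\|\cdot\|$ is the operator norm); this limit exists and is independent of the sequence, and $\lambda\mapsto T_\lambda$ is a bijection from $\Lambda$ onto the set of limit points of the sequence $T^m/\|T^m\|$. Define $$\hat{T}=\int_\Lambda T_\lambda\,d\lambda=\lim_{N\to\infty}\frac1N\sum_{m=1}^N\frac{T^m}{\|T^m\|},$$ the integral being with respect to normalized Haar measure on $\Lambda$. *)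

theory Defs
  imports
    "HOL-Algebra.Generated_Groups"
    "HOL-Algebra.Product_Groups"
    "HOL-Probability.Probability"
    "Jordan_Normal_Form.Spectral_Radius"
begin

section \<open>Matrices\<close>

text \<open>Finite sums of \<open>n \<times> n\<close> matrices, entrywise (the type of matrices of arbitrary size
  has no zero, so \<^const>\<open>sum\<close> is not available on it).\<close>

definition mat_sum :: "nat \<Rightarrow> ('i \<Rightarrow> complex mat) \<Rightarrow> 'i set \<Rightarrow> complex mat" where
  "mat_sum n F I = Matrix.mat n n (\<lambda>(i, j). \<Sum>k\<in>I. F k $$ (i, j))"

definition mat_conj :: "complex mat \<Rightarrow> complex mat" where
  "mat_conj A = map_mat cnj A"

definition kronecker :: "complex mat \<Rightarrow> complex mat \<Rightarrow> complex mat" where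
  "kronecker A B = Matrix.mat (dim_row A * dim_row B) (dim_col A * dim_col B)
     (\<lambda>(i, j). A $$ (i div dim_row B, j div dim_col B) * B $$ (i mod dim_row B, j mod dim_col B))"

definition kraus_sum :: "nat \<Rightarrow> nat \<Rightarrow> (nat \<Rightarrow> complex mat) \<Rightarrow> complex mat" where
  "kraus_sum n d X = mat_sum (n * n) (\<lambda>i. kronecker (mat_conj (X i)) (X i)) {..<d}"

definition outer_spectral_radius :: "nat \<Rightarrow> nat \<Rightarrow> (nat \<Rightarrow> complex mat) \<Rightarrow> real" where
  "outer_spectral_radius n d X = sqrt (spectral_radius (kraus_sum n d X))"

definition euclid_norm :: "complex Matrix.vec \<Rightarrow> real" where
  "euclid_norm v = L2_set (\<lambda>i. cmod (vec_index v i)) {..<dim_vec v}"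

definition op_norm :: "complex mat \<Rightarrow> real" where
  "op_norm A = Sup {euclid_norm (A *\<^sub>v v) | v. v \<in> carrier_vec (dim_col A) \<and> euclid_norm v = 1}"

text \<open>Convergence in \<open>M\<^sub>N(\<complex>)\<close>; in finite dimension the norm topology is the entrywise one.\<close>

definition mat_tendsto :: "nat \<Rightarrow> (nat \<Rightarrow> complex mat) \<Rightarrow> complex mat \<Rightarrow> bool" where
  "mat_tendsto N F L \<longleftrightarrow>
     L \<in> carrier_mat N N \<and> (\<forall>i<N. \<forall>j<N. (\<lambda>k. F k $$ (i, j)) \<longlonglongrightarrow> L $$ (i, j))"

definition mat_span :: "nat \<Rightarrow> nat \<Rightarrow> (nat \<Rightarrow> complex mat) \<Rightarrow> complex mat set" where
  "mat_span n b B = {mat_sum n (\<lambda>k. c k \<cdot>\<^sub>m B k) {..<b} | c. True}"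

text \<open>The algebra generated by \<open>S\<close> is the smallest linear subspace of \<open>M\<^sub>n(\<complex>)\<close> that contains \<open>S\<close>
  and is closed under multiplication; the identity is not adjoined.\<close>

inductive_set gen_algebra :: "nat \<Rightarrow> complex mat set \<Rightarrow> complex mat set" for n S where
  gen: "A \<in> S \<Longrightarrow> A \<in> gen_algebra n S"
| zero: "0\<^sub>m n n \<in> gen_algebra n S"
| add: "A \<in> gen_algebra n S \<Longrightarrow> B \<in> gen_algebra n S \<Longrightarrow> A + B \<in> gen_algebra n S"
| smult: "A \<in> gen_algebra n S \<Longrightarrow> c \<cdot>\<^sub>m A \<in> gen_algebra n S"
| mult: "A \<in> gen_algebra n S \<Longrightarrow> B \<in> gen_algebra n S \<Longrightarrow> A * B \<in> gen_algebra n S"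

definition two_sided_ideal :: "nat \<Rightarrow> complex mat set \<Rightarrow> complex mat set \<Rightarrow> bool" where
  "two_sided_ideal n J \<A> \<longleftrightarrow>
     J \<subseteq> \<A> \<and> 0\<^sub>m n n \<in> J \<and>
     (\<forall>A\<in>J. \<forall>B\<in>J. A + B \<in> J) \<and> (\<forall>c. \<forall>A\<in>J. c \<cdot>\<^sub>m A \<in> J) \<and>
     (\<forall>C\<in>\<A>. \<forall>A\<in>J. C * A \<in> J \<and> A * C \<in> J)"


section \<open>The maximal spectrum\<close>

text \<open>The Jordan form is unique up to permutation of the blocks, so the set below is the set of sizes
  of the Jordan blocks of \<open>T\<close> with eigenvalue \<open>z\<close>.\<close>

definition degeneracy_index :: "complex mat \<Rightarrow> complex \<Rightarrow> nat" where
  "degeneracy_index T z = Max {k. \<exists>n_as. jordan_nf T n_as \<and> (k, z) \<in> set n_as}"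

definition maximal_spectrum :: "complex mat \<Rightarrow> complex set" where
  "maximal_spectrum T = {z \<in> spectrum T. cmod z = spectral_radius T \<and>
     (\<forall>w\<in>spectrum T. cmod w = spectral_radius T \<longrightarrow> degeneracy_index T w \<le> degeneracy_index T z)}"


section \<open>The torus and the group \<open>\<Lambda>\<close>\<close>

text \<open>Points of \<open>\<T>\<^sup>m\<close> are the extensional functions from \<open>{..<m}\<close> to the unit circle.\<close>

definition circle_group :: "complex monoid" where
  "circle_group = \<lparr>carrier = sphere 0 1, monoid.mult = (*), one = 1\<rparr>"

definition torus :: "nat \<Rightarrow> (nat \<Rightarrow> complex) monoid" where
  "torus m = product_group {..<m} (\<lambda>_. circle_group)"

definition torus_topology :: "nat \<Rightarrow> (nat \<Rightarrow> complex) topology" where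
  "torus_topology m = product_topology (\<lambda>_. top_of_set (sphere 0 1)) {..<m}"

text \<open>The list \<open>ls\<close> stands for \<open>\<lambda>\<^sub>1, \<dots>, \<lambda>\<^sub>m\<close>.\<close>

definition tau :: "complex list \<Rightarrow> nat \<Rightarrow> complex" where
  "tau ls = (\<lambda>i\<in>{..<length ls}. ls ! i)"

definition Lambda :: "complex list \<Rightarrow> (nat \<Rightarrow> complex) set" where
  "Lambda ls = torus_topology (length ls) closure_of generate (torus (length ls)) {tau ls}"

definition normalized_haar :: "complex list \<Rightarrow> (nat \<Rightarrow> complex) measure \<Rightarrow> bool" where
  "normalized_haar ls \<mu> \<longleftrightarrow>
     space \<mu> = Lambda ls \<and>
     sets \<mu> = sets (sigma (Lambda ls)
                 {U. openin (subtopology (torus_topology (length ls)) (Lambda ls)) U}) \<and>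
     prob_space \<mu> \<and>
     (\<forall>x\<in>Lambda ls. \<forall>E\<in>sets \<mu>.
        emeasure \<mu> ((\<lambda>y. x \<otimes>\<^bsub>torus (length ls)\<^esub> y) ` E) = emeasure \<mu> E)"


section \<open>Limits of the normalized powers\<close>

definition normalized_power :: "complex mat \<Rightarrow> nat \<Rightarrow> complex mat" where
  "normalized_power T m = complex_of_real (1 / op_norm (T ^\<^sub>m m)) \<cdot>\<^sub>m (T ^\<^sub>m m)"

definition T_lim :: "complex mat \<Rightarrow> complex list \<Rightarrow> (nat \<Rightarrow> complex) \<Rightarrow> complex mat" where
  "T_lim T ls l = (THE L. L \<in> carrier_mat (dim_row T) (dim_row T) \<and>
     (\<forall>s::nat \<Rightarrow> nat. (\<forall>k. 0 < s k) \<and> filterlim s at_top sequentially \<and>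
        limitin (torus_topology (length ls))
          (\<lambda>k. tau ls [^]\<^bsub>torus (length ls)\<^esub> s k) l sequentially \<longrightarrow>
        mat_tendsto (dim_row T) (\<lambda>k. normalized_power T (s k)) L))"

definition T_lim_integral ::
    "complex mat \<Rightarrow> complex list \<Rightarrow> (nat \<Rightarrow> complex) measure \<Rightarrow> complex mat" where
  "T_lim_integral T ls \<mu> = Matrix.mat (dim_row T) (dim_row T)
     (\<lambda>(i, j). integral\<^sup>L \<mu> (\<lambda>l. T_lim T ls l $$ (i, j)))"

text \<open>\<open>T_hat\<close> is both the Haar integral of \<open>T_lim\<close> over \<open>\<Lambda>\<close> and the limit of the averages of the
  normalized powers; that a matrix with both properties exists is to be proved. The limit alone
  determines it.\<close>

definition T_hat :: "complex mat \<Rightarrow> complex list \<Rightarrow> complex mat" where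
  "T_hat T ls = (THE M.
     mat_tendsto (dim_row T)
       (\<lambda>N. complex_of_real (1 / real N) \<cdot>\<^sub>m mat_sum (dim_row T) (normalized_power T) {1..N}) M \<and>
     (\<forall>\<mu>. normalized_haar ls \<mu> \<longrightarrow> M = T_lim_integral T ls \<mu>))"

end

theory Submission
  imports Defs "Jordan_Normal_Form.Jordan_Normal_Form_Uniqueness"
begin

text \<open>
  By the Jordan form, \<open>T ^ m\<close> divided by \<open>m choose k\<close> is asymptotic to \<open>\<Sum>\<^sub>i \<lambda>\<^sub>i ^ m P\<^sub>i\<close>, where \<open>k + 1\<close> is
  the largest block size on the unit circle and the right-hand side stays away from \<open>0\<close>. After
  normalization it becomes a Lipschitz function \<open>F\<close> on the torus evaluated along the orbit \<open>\<tau> ^ m\<close>, so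
  \<open>T_lim = F\<close> on \<open>\<Lambda>\<close>. The sequence \<open>F (\<tau> ^ m)\<close> is almost periodic, hence has a mean, uniformly over
  all windows; by translation invariance this mean is the Haar integral, so it is \<open>T_hat\<close>.

  A matrix is of the form \<open>\<Sum> cnj A\<^sub>j \<otimes> A\<^sub>j\<close> iff its Choi reshuffling is positive semidefinite, a closed
  condition that holds for the powers of \<open>T\<close> and thus for \<open>T_lim\<close> and \<open>T_hat\<close>. The span of the \<open>A\<^sub>j\<close>
  is the annihilator of the null vectors of the Choi form. Null vectors of \<open>T_hat\<close> are null
  for every \<open>T_lim\<close>, because the orbit returns to each point of \<open>\<Lambda>\<close> with bounded gaps; they are null
  for \<open>T T_hat = T_hat T\<close>, because the norms of consecutive powers have bounded ratio; and vectors
  annihilating the generated algebra are null for \<open>T_hat\<close>. These inclusions of null spaces are the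
  inclusions of spans that are claimed.
\<close>

section \<open>Duality and positive semidefinite kernels\<close>

text \<open>A mean over time sees only sets of positive density, so a single return of the orbit to
  the vicinity of a point of \<Lambda> would not suffice to pass from a null vector of
  \<open>T_hat\<close> to one of \<open>T_lim\<close>; hence the bounded gaps. Uniformity over
  windows is forced by the Haar integral: a point of \<Lambda> is approximated by some
  \<open>\<tau> ^ m\<close> with no control over \<open>m\<close>, and its translates are then read
  as the window that starts at \<open>m\<close>. The limit function lives on the whole torus. It
  stays away from 0 because of the corner of one Jordan block of maximal size: once the similarity
  is undone, that position carries a single eigenvalue with a coefficient of modulus 1, so nothing
  can cancel. The number \<open>a\<close> is common to all limits because a kernel on
  \<open>n * n\<close> index pairs always decomposes into \<open>n * n\<close> rank-one terms, some
  possibly zero. Spans are never computed: since a sum of squared moduli vanishes only termwise,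
  each inclusion is tested on linear functionals. The ideal is nonzero because the Kraus matrices of
  the nonzero limit at the identity of \<Lambda> lie in it.\<close>

text \<open>Gaussian elimination, one coordinate at a time: either coordinate \<open>a\<close>
  vanishes on all of \<open>S\<close>, or a pivot with value 1 at \<open>a\<close> is subtracted.
  Members of \<open>S\<close> are functions on the whole type of which only the values on
  \<open>I\<close> count, so matrices can be fed in as functions of index pairs.\<close>

lemma double_annihilator:
  fixes S :: "('i \<Rightarrow> complex) set" and C :: "'i \<Rightarrow> complex"
  assumes "finite I"
    and "(\<lambda>_. 0) \<in> S"
    and "\<And>f g. f \<in> S \<Longrightarrow> g \<in> S \<Longrightarrow> (\<lambda>i. f i + g i) \<in> S"
    and "\<And>c f. f \<in> S \<Longrightarrow> (\<lambda>i. c * f i) \<in> S"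
    and "\<And>v. (\<And>f. f \<in> S \<Longrightarrow> (\<Sum>i\<in>I. v i * f i) = 0) \<Longrightarrow> (\<Sum>i\<in>I. v i * C i) = 0"
  shows "\<exists>f\<in>S. \<forall>i\<in>I. f i = C i"
  using assms
proof (induction I arbitrary: S C rule: finite_induct)
  case empty
  then show ?case by blast
next
  case (insert a I S C)
  have upd: "(\<Sum>i\<in>I. (v(a := t)) i * g i) = (\<Sum>i\<in>I. v i * g i)" for v t and g :: "'i \<Rightarrow> complex"
    using insert.hyps(2) by (intro sum.cong) auto
  show ?case
  proof (cases "\<forall>f\<in>S. f a = 0")
    case True
    have "(\<Sum>i\<in>insert a I. ((\<lambda>_. 0)(a := 1)) i * C i) = 0"
      by (rule insert.prems(4), insert True upd[of "\<lambda>_. 0" 1] insert.hyps, auto)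
    then have Ca: "C a = 0"
      using insert.hyps upd[of "\<lambda>_. 0" 1 C] by simp
    have "\<exists>f\<in>S. \<forall>i\<in>I. f i = C i"
    proof (rule insert.IH[OF insert.prems(1-3)])
      fix v assume v: "\<And>f. f \<in> S \<Longrightarrow> (\<Sum>i\<in>I. v i * f i) = 0"
      have "(\<Sum>i\<in>insert a I. v i * C i) = 0"
        by (rule insert.prems(4)) (use True v insert.hyps in auto)
      then show "(\<Sum>i\<in>I. v i * C i) = 0"
        using Ca insert.hyps by simp
    qed
    with True Ca show ?thesis by auto
  next
    case False
    then obtain U0 where U0: "U0 \<in> S" "U0 a \<noteq> 0" by auto
    define U where "U = (\<lambda>i. (1 / U0 a) * U0 i)"
    have U: "U \<in> S" "U a = 1"
      unfolding U_def using U0 by (blast intro: insert.prems(3)) (simp add: U0)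
    define S0 where "S0 = {f \<in> S. f a = 0}"
    define C' where "C' = (\<lambda>i. C i - C a * U i)"
    have "\<exists>f\<in>S0. \<forall>i\<in>I. f i = C' i"
    proof (rule insert.IH)
      show "(\<lambda>_. 0) \<in> S0" using insert.prems(1) by (simp add: S0_def)
      show "\<And>f g. f \<in> S0 \<Longrightarrow> g \<in> S0 \<Longrightarrow> (\<lambda>i. f i + g i) \<in> S0"
        using insert.prems(2) by (simp add: S0_def)
      show "\<And>c f. f \<in> S0 \<Longrightarrow> (\<lambda>i. c * f i) \<in> S0"
        using insert.prems(3) by (simp add: S0_def)
    next
      fix v assume v: "\<And>f. f \<in> S0 \<Longrightarrow> (\<Sum>i\<in>I. v i * f i) = 0"
      \<comment> \<open>The value at \<open>a\<close> makes the extended functional kill the pivot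
        \<open>U\<close>; it then kills all of \<open>S\<close>, since every \<open>f\<close>
        differs from a multiple of \<open>U\<close> by an element of \<open>S0\<close>.\<close>
      define w where "w = v(a := - (\<Sum>i\<in>I. v i * U i))"
      have w: "(\<Sum>i\<in>insert a I. w i * f i) = (\<Sum>i\<in>I. v i * (f i - f a * U i))" for f
      proof -
        have "(\<Sum>i\<in>insert a I. w i * f i) = - (\<Sum>i\<in>I. v i * U i) * f a + (\<Sum>i\<in>I. v i * f i)"
          unfolding w_def using insert.hyps upd by simp
        also have "\<dots> = (\<Sum>i\<in>I. v i * (f i - f a * U i))"
          by (simp add: right_diff_distrib sum_subtractf sum_distrib_left sum_distrib_right ac_simps)
        finally show ?thesis .
      qed
      have "(\<Sum>i\<in>insert a I. w i * C i) = 0"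
      proof (rule insert.prems(4))
        fix f assume f: "f \<in> S"
        have "(\<lambda>i. f i + (- f a) * U i) \<in> S0"
          using insert.prems(2)[OF f insert.prems(3)[OF U(1), of "- f a"]] U(2)
          by (simp add: S0_def)
        from v[OF this] show "(\<Sum>i\<in>insert a I. w i * f i) = 0"
          unfolding w by simp
      qed
      then show "(\<Sum>i\<in>I. v i * C' i) = 0"
        unfolding w C'_def .
    qed
    then obtain f where f: "f \<in> S0" "\<forall>i\<in>I. f i = C' i" by auto
    have "(\<lambda>i. f i + C a * U i) \<in> S"
      using f(1) insert.prems(2)[OF _ insert.prems(3)[OF U(1)]] by (auto simp: S0_def)
    moreover have "\<forall>i\<in>insert a I. f i + C a * U i = C i"
      using f U(2) by (auto simp: C'_def S0_def)
    ultimately show ?thesis by (intro bexI)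
  qed
qed

section \<open>Positive semidefinite kernels\<close>

text \<open>The values of the form have to be real, which is more than a nonnegative real part; over
  the complex numbers this forces the kernel to be Hermitian.\<close>

definition psd_on :: "'i set \<Rightarrow> ('i \<Rightarrow> 'i \<Rightarrow> complex) \<Rightarrow> bool" where
  "psd_on I K \<longleftrightarrow> (\<forall>v. \<exists>r\<ge>0. (\<Sum>a\<in>I. \<Sum>b\<in>I. v a * cnj (v b) * K a b) = complex_of_real r)"

lemma psd_on_diag:
  assumes "finite I" "psd_on I K" "a \<in> I"
  obtains r where "r \<ge> 0" "K a a = complex_of_real r"
proof -
  obtain r where "r \<ge> 0" "(\<Sum>x\<in>I. \<Sum>y\<in>I. (if x = a then 1 else 0) * cnj (if y = a then 1 else 0) * K x y)
      = complex_of_real r"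
    using assms(2) unfolding psd_on_def by meson
  moreover have "(\<Sum>x\<in>I. \<Sum>y\<in>I. (if x = a then 1 else 0) * cnj (if y = a then 1 else 0) * K x y)
      = (\<Sum>x\<in>I. if x = a then K a a else 0)"
  proof (intro sum.cong refl)
    fix x assume "x \<in> I"
    have "(\<Sum>y\<in>I. (if x = a then 1 else 0) * cnj (if y = a then 1 else 0) * K x y)
      = (\<Sum>y\<in>I. if y = a then (if x = a then K a a else 0) else 0)"
      by (intro sum.cong) auto
    also have "\<dots> = (if x = a then K a a else 0)"
      using assms by (simp add: sum.delta)
    finally show "(\<Sum>y\<in>I. (if x = a then 1 else 0) * cnj (if y = a then 1 else 0) * K x y)
      = (if x = a then K a a else 0)" .
  qed
  ultimately show ?thesis
    using that[of r] assms by simp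
qed

lemma psd_on_two:
  assumes "finite I" "psd_on I K" "a \<in> I" "b \<in> I" "a \<noteq> b"
  shows "\<exists>r\<ge>0. s * cnj s * K a a + s * cnj t * K a b + t * cnj s * K b a + t * cnj t * K b b
    = complex_of_real r"
proof -
  define v where "v = (\<lambda>x. if x = a then s else if x = b then t else 0)"
  obtain r where "r \<ge> 0" "(\<Sum>x\<in>I. \<Sum>y\<in>I. v x * cnj (v y) * K x y) = complex_of_real r"
    using assms(2) unfolding psd_on_def by meson
  moreover have "(\<Sum>x\<in>I. \<Sum>y\<in>I. v x * cnj (v y) * K x y)
      = (\<Sum>x\<in>{a,b}. \<Sum>y\<in>{a,b}. v x * cnj (v y) * K x y)"
  proof -
    have "(\<Sum>y\<in>I. v x * cnj (v y) * K x y) = (\<Sum>y\<in>{a,b}. v x * cnj (v y) * K x y)" for x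
      using assms by (intro sum.mono_neutral_right) (auto simp: v_def)
    then have "(\<Sum>x\<in>I. \<Sum>y\<in>I. v x * cnj (v y) * K x y)
      = (\<Sum>x\<in>I. \<Sum>y\<in>{a,b}. v x * cnj (v y) * K x y)" by simp
    also have "\<dots> = (\<Sum>x\<in>{a,b}. \<Sum>y\<in>{a,b}. v x * cnj (v y) * K x y)"
      using assms by (intro sum.mono_neutral_right) (auto simp: v_def)
    finally show ?thesis .
  qed
  ultimately show ?thesis
    using assms(5) by (intro exI[of _ r]) (simp add: v_def algebra_simps)
qed

text \<open>Polarization: the form is real at e_a + e_b and at e_a + i e_b, which relates first the
  imaginary and then the real parts of \<open>K a b\<close> and \<open>K b a\<close>.\<close>

lemma psd_on_hermitian:
  assumes "finite I" "psd_on I K" "a \<in> I" "b \<in> I"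
  shows "K b a = cnj (K a b)"
proof (cases "a = b")
  case True
  then show ?thesis using psd_on_diag[OF assms(1,2,3)] by (metis complex_cnj_complex_of_real)
next
  case False
  obtain p q where p: "K a a = complex_of_real p" and q: "K b b = complex_of_real q"
    using psd_on_diag[OF assms(1,2)] assms(3,4) by metis
  obtain r1 where "K a a + K a b + K b a + K b b = complex_of_real r1"
    using psd_on_two[OF assms False, of 1 1] by auto
  then have "Im (K a b) + Im (K b a) = 0"
    using p q by (auto simp: complex_eq_iff)
  moreover obtain r2 where "K a a - \<i> * K a b + \<i> * K b a + K b b = complex_of_real r2"
    using psd_on_two[OF assms False, of 1 \<i>] by auto
  then have "Re (K a b) - Re (K b a) = 0"
    using p q by (auto simp: complex_eq_iff)
  ultimately show ?thesis by (simp add: complex_eq_iff)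
qed

text \<open>With \<open>K a a = 0\<close> the form at -t cnj(z) e_a + e_b is the affine function
  \<open>- 2 * t * m + q\<close> of the real number \<open>t\<close>, where \<open>m\<close> is the
  squared modulus of \<open>z = K a b\<close>; it can be bounded below only if
  \<open>m = 0\<close>.\<close>

lemma psd_on_zero_diag:
  assumes "finite I" "psd_on I K" "a \<in> I" "b \<in> I" "K a a = 0"
  shows "K a b = 0"
proof (cases "a = b")
  case False
  obtain q where q: "K b b = complex_of_real q"
    using psd_on_diag[OF assms(1,2,4)] by metis
  define z where "z = K a b"
  have z: "K b a = cnj z" using psd_on_hermitian[OF assms(1-4)] by (simp add: z_def)
  define m where "m = (cmod z)\<^sup>2"
  have zz: "z * cnj z = complex_of_real m" unfolding m_def by (simp only: complex_norm_square)
  have "- 2 * t * m + q \<ge> 0" for t :: real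
  proof -
    obtain r where r: "r \<ge> 0" "(- complex_of_real t * cnj z) * z + (- complex_of_real t * z) * cnj z + K b b = complex_of_real r"
      using psd_on_two[OF assms(1-4) False, of "- complex_of_real t * cnj z" 1] assms(5) z
      by (auto simp: z_def)
    have "(- complex_of_real t * cnj z) * z + (- complex_of_real t * z) * cnj z + K b b
        = - 2 * complex_of_real t * (z * cnj z) + complex_of_real q" by (simp add: q algebra_simps)
    also have "\<dots> = complex_of_real (- 2 * t * m + q)" by (simp add: zz)
    finally show ?thesis using r by (metis of_real_eq_iff)
  qed
  \<comment> \<open>For \<open>m \<noteq> 0\<close> this \<open>t\<close> would give the value
    -1.\<close>
  from this[of "(q + 1) / (2 * m)"] have "m = 0"
    by (cases "m = 0") (simp_all add: divide_simps)
  then show ?thesis by (simp add: m_def z_def)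
qed (use assms in simp)

text \<open>Cholesky: subtract the rank-one form of one row and recurse on the Schur complement.\<close>

lemma psd_on_decomposition:
  assumes "finite I" "psd_on I K"
  shows "\<exists>w. \<forall>a\<in>I. \<forall>b\<in>I. K a b = (\<Sum>h<card I. cnj (w h a) * w h b)"
  using assms
proof (induction I arbitrary: K rule: finite_induct)
  case empty
  then show ?case by auto
next
  case (insert x I K)
  have fin: "finite (insert x I)" using insert.hyps by simp
  obtain p where p: "p \<ge> 0" "K x x = complex_of_real p"
    using psd_on_diag[OF fin insert.prems] by blast
  \<comment> \<open>The row at \<open>x\<close>, scaled so that its rank-one form clears row and
    column \<open>x\<close>. For \<open>p = 0\<close> the row is already zero by
    \<open>psd_on_zero_diag\<close>.\<close>
  define u where "u = (\<lambda>b. if p = 0 then 0 else K x b / complex_of_real (sqrt p))"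
  define K' where "K' = (\<lambda>a b. K a b - cnj (u a) * u b)"
  have herm: "\<And>a b. a \<in> insert x I \<Longrightarrow> b \<in> insert x I \<Longrightarrow> K b a = cnj (K a b)"
    using psd_on_hermitian[OF fin insert.prems] by blast
  have sq: "complex_of_real (sqrt p) * complex_of_real (sqrt p) = complex_of_real p"
    using p(1) by (metis of_real_mult real_sqrt_mult_self abs_of_nonneg)
  have Kx: "K' x b = 0" if "b \<in> insert x I" for b
  proof (cases "p = 0")
    case True
    then show ?thesis
      using psd_on_zero_diag[OF fin insert.prems _ that, of x] p(2) by (simp add: K'_def u_def)
  next
    case False
    then show ?thesis
      using p(2) sq by (simp add: K'_def u_def)
  qed
  have psd': "psd_on I K'"
    unfolding psd_on_def
  proof
    fix v
    define s where "s = (\<Sum>a\<in>I. v a * cnj (K x a))"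
    \<comment> \<open>Completing the square: this value at \<open>x\<close> makes the form of
      \<open>K\<close> at \<open>w\<close> equal to the form of the Schur complement
      \<open>K'\<close> at \<open>v\<close>.\<close>
    define w where "w = v(x := (if p = 0 then 0 else - s / complex_of_real p))"
    have wI: "\<And>a. a \<in> I \<Longrightarrow> w a = v a" using insert.hyps by (auto simp: w_def)
    obtain r where r: "r \<ge> 0"
      "(\<Sum>a\<in>insert x I. \<Sum>b\<in>insert x I. w a * cnj (w b) * K a b) = complex_of_real r"
      using insert.prems unfolding psd_on_def by meson
    define Q where "Q = (\<Sum>a\<in>I. \<Sum>b\<in>I. v a * cnj (v b) * K a b)"
    have s': "(\<Sum>b\<in>I. cnj (v b) * K x b) = cnj s" by (simp add: s_def)
    have s'': "(\<Sum>a\<in>I. v a * K a x) = s"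
      unfolding s_def by (intro sum.cong refl) (metis herm insertI1 insertI2)
    have full: "(\<Sum>a\<in>insert x I. \<Sum>b\<in>insert x I. w a * cnj (w b) * K a b)
        = w x * cnj (w x) * K x x + w x * cnj s + cnj (w x) * s + Q"
    proof -
      have "(\<Sum>a\<in>insert x I. \<Sum>b\<in>insert x I. w a * cnj (w b) * K a b)
        = w x * cnj (w x) * K x x + (\<Sum>b\<in>I. w x * cnj (v b) * K x b)
          + (\<Sum>a\<in>I. v a * cnj (w x) * K a x + (\<Sum>b\<in>I. v a * cnj (v b) * K a b))"
        using insert.hyps wI by simp
      also have "\<dots> = w x * cnj (w x) * K x x + w x * (\<Sum>b\<in>I. cnj (v b) * K x b)
          + cnj (w x) * (\<Sum>a\<in>I. v a * K a x) + Q"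
        by (simp add: sum.distrib sum_distrib_left Q_def mult.assoc mult.left_commute)
      finally show ?thesis by (simp add: s' s'')
    qed
    have "(\<Sum>a\<in>I. \<Sum>b\<in>I. v a * cnj (v b) * K' a b) = Q - (\<Sum>a\<in>I. v a * cnj (u a)) * (\<Sum>b\<in>I. cnj (v b) * u b)"
    proof -
      have "(\<Sum>a\<in>I. v a * cnj (u a)) * (\<Sum>b\<in>I. cnj (v b) * u b)
          = (\<Sum>a\<in>I. \<Sum>b\<in>I. v a * cnj (v b) * (cnj (u a) * u b))"
        unfolding sum_product by (intro sum.cong refl) (simp only: ac_simps)
      then show ?thesis
        by (simp add: K'_def Q_def right_diff_distrib sum_subtractf)
    qed
    also have "\<dots> = complex_of_real r"
    proof (cases "p = 0")
      case True
      then have "u = (\<lambda>_. 0)" by (simp add: u_def)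
      then show ?thesis using full r True by (simp add: w_def)
    next
      case False
      have 1: "(\<Sum>a\<in>I. v a * cnj (u a)) = s / complex_of_real (sqrt p)"
        using False by (simp add: u_def s_def sum_divide_distrib)
      have 2: "(\<Sum>b\<in>I. cnj (v b) * u b) = cnj s / complex_of_real (sqrt p)"
        using False by (simp add: u_def s_def sum_divide_distrib)
      have "s / complex_of_real (sqrt p) * (cnj s / complex_of_real (sqrt p)) = s * cnj s / complex_of_real p"
        using sq by simp
      moreover have "w x * cnj (w x) * K x x + w x * cnj s + cnj (w x) * s = - s * cnj s / complex_of_real p"
        using False p(2) by (simp add: w_def)
      ultimately show ?thesis using full r 1 2 by simp
    qed
    finally show "\<exists>r\<ge>0. (\<Sum>a\<in>I. \<Sum>b\<in>I. v a * cnj (v b) * K' a b) = complex_of_real r"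
      using r(1) by blast
  qed
  obtain w where w: "\<forall>a\<in>I. \<forall>b\<in>I. K' a b = (\<Sum>h<card I. cnj (w h a) * w h b)"
    using insert.IH[OF psd'] by blast
  \<comment> \<open>The new vector \<open>u\<close> gets index \<open>card I\<close>; the vectors
    from the induction are unspecified at \<open>x\<close> and are set to 0 there, where row and
    column of \<open>K'\<close> vanish.\<close>
  define w' where "w' = (\<lambda>h a. if h = card I then u a else if a = x then 0 else w h a)"
  have "K a b = (\<Sum>h<card (insert x I). cnj (w' h a) * w' h b)"
    if "a \<in> insert x I" "b \<in> insert x I" for a b
  proof -
    have K'x: "K' a x = 0" if "a \<in> insert x I" for a
    proof -
      have "K' a x = cnj (K' x a)" using herm[of x a] that by (simp add: K'_def)
      then show ?thesis using Kx that by simp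
    qed
    have "(\<Sum>h<card (insert x I). cnj (w' h a) * w' h b)
      = (\<Sum>h<card I. cnj (w' h a) * w' h b) + cnj (u a) * u b"
      using insert.hyps by (simp add: w'_def)
    also have "(\<Sum>h<card I. cnj (w' h a) * w' h b) = K' a b"
    proof (cases "a = x \<or> b = x")
      case True
      then have "(\<Sum>h<card I. cnj (w' h a) * w' h b) = 0"
        by (intro sum.neutral) (auto simp: w'_def)
      then show ?thesis using True Kx K'x that by auto
    next
      case False
      then show ?thesis using that w by (auto simp: w'_def intro!: sum.cong)
    qed
    finally show ?thesis by (simp add: K'_def)
  qed
  then show ?case by blast
qed

section \<open>Means of almost periodic sequences\<close>

text \<open>Bochner's form of almost periodicity: the shifts of \<open>g\<close> are totally bounded in the supremum norm.\<close>

definition almost_periodic :: "(nat \<Rightarrow> complex) \<Rightarrow> bool" where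
  "almost_periodic g \<longleftrightarrow> (\<forall>\<epsilon>>0. \<exists>q. \<forall>m. \<exists>p\<le>q. \<forall>j. cmod (g (m + j) - g (p + j)) \<le> \<epsilon>)"

definition window_mean :: "(nat \<Rightarrow> complex) \<Rightarrow> nat \<Rightarrow> nat \<Rightarrow> complex" where
  "window_mean g N m = (\<Sum>j=1..N. g (m + j)) / of_nat N"

lemma almost_periodic_bounded:
  assumes "almost_periodic g"
  obtains C where "C > 0" "\<And>m. cmod (g m) \<le> C"
proof -
  obtain q where q: "\<And>m. \<exists>p\<le>q. \<forall>j. cmod (g (m + j) - g (p + j)) \<le> 1"
    using assms[unfolded almost_periodic_def, rule_format, of 1] by auto
  define C where "C = (\<Sum>p\<le>q. cmod (g p)) + 1"
  have "cmod (g m) \<le> C" for m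
  proof -
    obtain p where p: "p \<le> q" "cmod (g (m + 0) - g (p + 0)) \<le> 1" using q by blast
    have "cmod (g p) \<le> (\<Sum>p\<le>q. cmod (g p))"
      using p(1) by (intro member_le_sum) auto
    moreover have "cmod (g m) \<le> cmod (g m - g p) + cmod (g p)"
      using norm_triangle_ineq[of "g m - g p" "g p"] by simp
    ultimately show ?thesis using p(2) by (simp add: C_def)
  qed
  moreover have "C > 0" unfolding C_def by (intro add_nonneg_pos sum_nonneg) auto
  ultimately show ?thesis using that by blast
qed

lemma window_mean_diff_le:
  assumes "\<And>j. cmod (g (m + j) - h (p + j)) \<le> \<epsilon>" "N > 0"
  shows "cmod (window_mean g N m - window_mean h N p) \<le> \<epsilon>"
proof -
  have "cmod (\<Sum>j=1..N. g (m + j) - h (p + j)) \<le> (\<Sum>j=1..N. \<epsilon>)"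
    using assms(1) by (intro order.trans[OF norm_sum] sum_mono)
  then have "cmod (\<Sum>j=1..N. g (m + j) - h (p + j)) \<le> real N * \<epsilon>" by simp
  moreover have "window_mean g N m - window_mean h N p = (\<Sum>j=1..N. g (m + j) - h (p + j)) / of_nat N"
    by (simp add: window_mean_def sum_subtractf diff_divide_distrib)
  ultimately show ?thesis
    using assms(2) by (simp add: norm_divide pos_divide_le_eq mult.commute)
qed

text \<open>Moving the window by one exchanges a single summand for another, at a cost of at most
  \<open>2 * C / N\<close>.\<close>

lemma window_mean_shift_le:
  assumes "\<And>m. cmod (g m) \<le> C" "N > 0"
  shows "cmod (window_mean g N p - window_mean g N 0) \<le> 2 * real p * C / real N"
proof (induction p)
  case (Suc p)
  have "(\<Sum>j=1..N. g (Suc p + j)) - (\<Sum>j=1..N. g (p + j)) = g (p + Suc N) - g (p + 1)"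
    by (induction N) (auto simp: algebra_simps)
  then have "window_mean g N (Suc p) - window_mean g N p = (g (p + Suc N) - g (p + 1)) / of_nat N"
    unfolding window_mean_def by (metis diff_divide_distrib)
  moreover have "cmod (g (p + Suc N) - g (p + 1)) \<le> 2 * C"
    using norm_triangle_ineq4[of "g (p + Suc N)" "g (p + 1)"] assms(1)[of "p + Suc N"] assms(1)[of "p + 1"]
    by linarith
  ultimately have "cmod (window_mean g N (Suc p) - window_mean g N p) \<le> 2 * C / real N"
    by (simp add: norm_divide divide_right_mono)
  then have "cmod (window_mean g N (Suc p) - window_mean g N 0) \<le> 2 * C / real N + 2 * real p * C / real N"
    using Suc norm_triangle_ineq[of "window_mean g N (Suc p) - window_mean g N p" "window_mean g N p - window_mean g N 0"]
    by simp
  then show ?case by (simp add: add_divide_distrib algebra_simps)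
qed simp

text \<open>Any start \<open>m\<close> can be replaced by some \<open>p \<le> q\<close> at cost
  \<open>\<epsilon> / 2\<close>, whatever the length; moving that window back to 0 costs at most
  \<open>2 * q * C / N\<close>, which is small for long windows.\<close>

lemma window_mean_uniform:
  assumes "almost_periodic g" "\<epsilon> > 0"
  shows "\<exists>N0>0. \<forall>N\<ge>N0. \<forall>m. cmod (window_mean g N m - window_mean g N 0) \<le> \<epsilon>"
proof -
  obtain C where C: "C > 0" "\<And>m. cmod (g m) \<le> C"
    using almost_periodic_bounded[OF assms(1)] by blast
  obtain q where q: "\<And>m. \<exists>p\<le>q. \<forall>j. cmod (g (m + j) - g (p + j)) \<le> \<epsilon> / 2"
    using assms(1)[unfolded almost_periodic_def, rule_format, of "\<epsilon> / 2"] assms(2) by auto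
  obtain N0 :: nat where N0: "real N0 > 4 * real q * C / \<epsilon>" using reals_Archimedean2 by blast
  have "cmod (window_mean g N m - window_mean g N 0) \<le> \<epsilon>" if "N \<ge> Suc N0" for N m
  proof -
    have N: "N > 0" "real N > 4 * real q * C / \<epsilon>" using N0 that by auto
    obtain p where p: "p \<le> q" "\<And>j. cmod (g (m + j) - g (p + j)) \<le> \<epsilon> / 2" using q by blast
    have "cmod (window_mean g N m - window_mean g N p) \<le> \<epsilon> / 2"
      by (rule window_mean_diff_le) (use p(2) N(1) in auto)
    moreover have "cmod (window_mean g N p - window_mean g N 0) \<le> 2 * real p * C / real N"
      using window_mean_shift_le[OF C(2) N(1)] .
    moreover have "2 * real p * C / real N \<le> 2 * real q * C / real N"
      using p(1) C(1) N(1) by (intro divide_right_mono mult_right_mono) auto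
    moreover have "2 * real q * C / real N \<le> \<epsilon> / 2"
      using N assms(2) by (simp add: field_simps)
    ultimately show ?thesis
      using norm_triangle_ineq[of "window_mean g N m - window_mean g N p" "window_mean g N p - window_mean g N 0"]
      by simp
  qed
  then show ?thesis by blast
qed

text \<open>A window of length \<open>N M\<close> splits into \<open>M\<close> windows of length \<open>N\<close>.\<close>

lemma window_mean_split:
  assumes "\<And>m. cmod (window_mean g N m - window_mean g N 0) \<le> \<epsilon>" "N > 0" "M > 0"
  shows "cmod (window_mean g (N * M) 0 - window_mean g N 0) \<le> \<epsilon>"
proof -
  have sum: "(\<Sum>j=1..N * M. g j) = (\<Sum>k<M. \<Sum>j=1..N. g (N * k + j))"
  proof (induction M)
    case (Suc M)
    have "(\<Sum>j=1..N * Suc M. g j) = (\<Sum>j=1..N * M. g j) + (\<Sum>j=N * M + 1..N * M + N. g j)"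
      by (subst sum.ub_add_nat[symmetric]) (auto simp: algebra_simps)
    also have "(\<Sum>j=N * M + 1..N * M + N. g j) = (\<Sum>j=1..N. g (N * M + j))"
      using sum.shift_bounds_cl_nat_ivl[of g 1 "N * M" N] by (simp add: add.commute)
    finally show ?case using Suc by simp
  qed simp
  have "window_mean g (N * M) 0 - window_mean g N 0
      = (\<Sum>k<M. window_mean g N (N * k) - window_mean g N 0) / of_nat M"
    using assms(2,3) sum
    by (simp add: window_mean_def sum_subtractf diff_divide_distrib sum_divide_distrib[symmetric])
  moreover have "cmod (\<Sum>k<M. window_mean g N (N * k) - window_mean g N 0) \<le> (\<Sum>k<M. \<epsilon>)"
    by (rule sum_norm_le) (rule assms(1))
  ultimately show ?thesis
    using assms(3) by (simp add: norm_divide pos_divide_le_eq mult.commute)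
qed

text \<open>Windows of lengths \<open>M\<close> and \<open>N\<close> are compared through the common
  window of length \<open>N * M\<close>, which gives the Cauchy property. The estimate is kept
  uniform in the start \<open>m\<close> for the sake of the Haar integral.\<close>

lemma almost_periodic_mean:
  assumes "almost_periodic g"
  obtains c where "\<And>\<epsilon>. \<epsilon> > 0 \<Longrightarrow> \<exists>N0>0. \<forall>N\<ge>N0. \<forall>m. cmod (window_mean g N m - c) \<le> \<epsilon>"
proof -
  have "Cauchy (\<lambda>N. window_mean g N 0)"
  proof (rule CauchyI)
    fix e :: real assume e: "e > 0"
    obtain N0 where N0: "N0 > 0" "\<And>N m. N \<ge> N0 \<Longrightarrow> cmod (window_mean g N m - window_mean g N 0) \<le> e / 3"
      using window_mean_uniform[OF assms, of "e / 3"] e by auto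
    have "cmod (window_mean g M 0 - window_mean g N 0) < e" if "M \<ge> N0" "N \<ge> N0" for M N
    proof -
      have 1: "cmod (window_mean g (N * M) 0 - window_mean g N 0) \<le> e / 3"
        using window_mean_split[of g N "e / 3" M] N0 that by auto
      have 2: "cmod (window_mean g (N * M) 0 - window_mean g M 0) \<le> e / 3"
        using window_mean_split[of g M "e / 3" N] N0 that by (auto simp: mult.commute)
      show ?thesis
        using 1 2 e norm_triangle_ineq4[of "window_mean g (N * M) 0 - window_mean g N 0" "window_mean g (N * M) 0 - window_mean g M 0"]
        by simp
    qed
    then show "\<exists>M. \<forall>m\<ge>M. \<forall>n\<ge>M. cmod (window_mean g m 0 - window_mean g n 0) < e" by blast
  qed
  then obtain c where c: "(\<lambda>N. window_mean g N 0) \<longlonglongrightarrow> c"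
    using Cauchy_convergent convergent_def by blast
  show ?thesis
  proof (rule that)
    fix \<epsilon> :: real assume e: "\<epsilon> > 0"
    obtain N0 where N0: "N0 > 0" "\<And>N m. N \<ge> N0 \<Longrightarrow> cmod (window_mean g N m - window_mean g N 0) \<le> \<epsilon> / 2"
      using window_mean_uniform[OF assms, of "\<epsilon> / 2"] e by auto
    obtain N1 where N1: "\<And>N. N \<ge> N1 \<Longrightarrow> cmod (window_mean g N 0 - c) < \<epsilon> / 2"
      using LIMSEQ_D[OF c, of "\<epsilon> / 2"] e by auto
    have "cmod (window_mean g N m - c) \<le> \<epsilon>" if "N \<ge> max N0 N1" for N m
      using N0(2)[of N m] N1[of N] that
        norm_triangle_ineq[of "window_mean g N m - window_mean g N 0" "window_mean g N 0 - c"]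
      by simp
    then show "\<exists>N0>0. \<forall>N\<ge>N0. \<forall>m. cmod (window_mean g N m - c) \<le> \<epsilon>"
      using N0(1) by (intro exI[of _ "max N0 N1"]) auto
  qed
qed

section \<open>Sequences with vanishing Cesaro means\<close>

lemma cesaro_null:
  fixes b :: "nat \<Rightarrow> complex"
  assumes "b \<longlonglongrightarrow> 0"
  shows "(\<lambda>N. (\<Sum>m=1..N. b m) / of_nat N) \<longlonglongrightarrow> 0"
proof (rule LIMSEQ_I)
  fix e :: real assume e: "e > 0"
  obtain M where M: "\<And>m. m \<ge> M \<Longrightarrow> cmod (b m) < e / 2"
    using LIMSEQ_D[OF assms, of "e / 2"] e by auto
  define C where "C = (\<Sum>m=1..M. cmod (b m))"
  have C: "C \<ge> 0" unfolding C_def by (intro sum_nonneg) auto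
  obtain N0 :: nat where N0: "real N0 > 2 * C / e" using reals_Archimedean2 by blast
  have "cmod ((\<Sum>m=1..N. b m) / of_nat N) < e" if "N \<ge> max (Suc M) (Suc N0)" for N
  proof -
    have N: "N \<ge> M" "real N > 0" "real N > 2 * C / e" using that N0 by auto
    have "cmod (\<Sum>m=1..N. b m) \<le> (\<Sum>m=1..N. cmod (b m))" by (rule norm_sum)
    also have "\<dots> \<le> (\<Sum>m=1..N. (if m \<le> M then cmod (b m) else 0) + e / 2)"
      using M e by (intro sum_mono) (auto simp: less_imp_le)
    also have "\<dots> = (\<Sum>m=1..N. (if m \<le> M then cmod (b m) else 0)) + real N * (e / 2)"
      by (simp add: sum.distrib)
    also have "(\<Sum>m=1..N. (if m \<le> M then cmod (b m) else 0)) = C"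
      unfolding C_def using N(1) by (intro sum.mono_neutral_cong_right) auto
    also have "C < real N * (e / 2)"
      using N e by (simp add: field_simps)
    finally show ?thesis
      using N(2) by (simp add: norm_divide field_simps)
  qed
  then show "\<exists>N0. \<forall>N\<ge>N0. norm ((\<Sum>m=1..N. b m) / of_nat N - 0) < e" by auto
qed

text \<open>The factor 2 in the proof absorbs the change of denominator from \<open>Suc N\<close> to
  \<open>N\<close>. With \<open>c = 1\<close> the lemma shifts a sequence; with \<open>c\<close> a
  bound for the ratio of consecutive norms it controls the form of \<open>T * T_hat\<close>.\<close>

lemma cesaro_null_shift:
  fixes a b :: "nat \<Rightarrow> real"
  assumes "\<And>m. 0 \<le> a m" "\<And>m. a m \<le> c * b (Suc m)" "\<And>m. 0 \<le> b m" "c \<ge> 0"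
    and "(\<lambda>N. (\<Sum>m=1..N. b m) / real N) \<longlonglongrightarrow> 0"
  shows "(\<lambda>N. (\<Sum>m=1..N. a m) / real N) \<longlonglongrightarrow> 0"
proof (rule tendsto_sandwich)
  show "\<forall>\<^sub>F N in sequentially. 0 \<le> (\<Sum>m=1..N. a m) / real N"
    using assms(1) by (simp add: sum_nonneg)
  show "\<forall>\<^sub>F N in sequentially. (\<Sum>m=1..N. a m) / real N \<le> 2 * c * ((\<Sum>m=1..Suc N. b m) / real (Suc N))"
  proof (rule eventually_sequentiallyI[of 1])
    fix N :: nat assume N: "N \<ge> 1"
    have "(\<Sum>m=1..N. a m) \<le> c * (\<Sum>m=1..N. b (Suc m))"
      unfolding sum_distrib_left using assms(2) by (intro sum_mono)
    also have "(\<Sum>m=1..N. b (Suc m)) = (\<Sum>m=2..Suc N. b m)"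
      using sum.shift_bounds_cl_Suc_ivl[of b 1 N] by (simp add: numeral_2_eq_2)
    also have "\<dots> \<le> (\<Sum>m=1..Suc N. b m)"
      using assms(3) by (intro sum_mono2) auto
    finally have 1: "(\<Sum>m=1..N. a m) \<le> c * (\<Sum>m=1..Suc N. b m)"
      using assms(4) by (simp add: mult_left_mono)
    define B where "B = c * (\<Sum>m=1..Suc N. b m)"
    have B: "B \<ge> 0" unfolding B_def using assms(3,4) by (intro mult_nonneg_nonneg sum_nonneg) auto
    have "(\<Sum>m=1..N. a m) / real N \<le> B / real N"
      using 1 by (simp add: divide_right_mono B_def)
    also have "\<dots> \<le> 2 * B / real (Suc N)"
      using N B mult_left_mono[of 1 "real N" B] by (simp add: field_simps)
    finally show "(\<Sum>m=1..N. a m) / real N \<le> 2 * c * ((\<Sum>m=1..Suc N. b m) / real (Suc N))"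
      by (simp add: B_def mult.assoc)
  qed
  show "(\<lambda>N. 2 * c * ((\<Sum>m=1..Suc N. b m) / real (Suc N))) \<longlonglongrightarrow> 0"
    using tendsto_mult[OF tendsto_const[of "2 * c"] LIMSEQ_Suc[OF assms(5)]] by simp
qed auto

text \<open>The sum of the shifts of \<open>b\<close> by 0 up to \<open>M + q\<close> still has
  vanishing mean, yet each of its terms is at least \<open>\<eta>\<close>: the first
  \<open>M\<close> shifts bring even small \<open>m\<close> into the range where hits are
  guaranteed.\<close>

lemma cesaro_null_syndetic:
  fixes b :: "nat \<Rightarrow> real"
  assumes nonneg: "\<And>m. 0 \<le> b m"
    and lim: "(\<lambda>N. (\<Sum>m=1..N. b m) / real N) \<longlonglongrightarrow> 0"
    and hits: "\<And>m. m \<ge> M \<Longrightarrow> \<exists>j\<le>q. b (m + j) \<ge> \<eta>"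
  shows "\<eta> \<le> 0"
proof (rule ccontr)
  assume "\<not> \<eta> \<le> 0"
  then have eta: "\<eta> > 0" by simp
  have shift: "(\<lambda>N. (\<Sum>m=1..N. b (m + j)) / real N) \<longlonglongrightarrow> 0" for j
  proof (induction j)
    case (Suc j)
    show ?case
    proof (rule cesaro_null_shift[where c = 1 and b = "\<lambda>m. b (m + j)"])
      show "(\<lambda>N. (\<Sum>m=1..N. b (m + j)) / real N) \<longlonglongrightarrow> 0" by (rule Suc)
    qed (use nonneg in \<open>simp_all\<close>)
  qed (use lim in simp)
  have sums: "(\<lambda>N. \<Sum>j\<le>M + q. (\<Sum>m=1..N. b (m + j)) / real N) \<longlonglongrightarrow> 0"
    using tendsto_sum[of "{..M + q}" "\<lambda>j N. (\<Sum>m=1..N. b (m + j)) / real N" "\<lambda>_. 0"] shift by simp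
  obtain N1 where N1: "\<And>N. N \<ge> N1 \<Longrightarrow> (\<Sum>j\<le>M + q. (\<Sum>m=1..N. b (m + j)) / real N) < \<eta>"
    using order_tendstoD(2)[OF sums eta] unfolding eventually_sequentially by blast
  define N where "N = max 1 N1"
  have N: "N \<ge> 1" "(\<Sum>j\<le>M + q. (\<Sum>m=1..N. b (m + j)) / real N) < \<eta>"
    using N1[of N] by (simp_all add: N_def)
  have "(\<Sum>j\<le>M + q. (\<Sum>m=1..N. b (m + j)) / real N) = (\<Sum>m=1..N. \<Sum>j\<le>M + q. b (m + j)) / real N"
    by (subst sum.swap) (simp add: sum_divide_distrib)
  moreover have "(\<Sum>m=1..N. \<Sum>j\<le>M + q. b (m + j)) \<ge> (\<Sum>m=1..N. \<eta>)"
  proof (rule sum_mono)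
    fix m :: nat
    obtain j where j: "j \<le> q" "b (m + M + j) \<ge> \<eta>" using hits[of "m + M"] by auto
    have "b (m + (M + j)) \<le> (\<Sum>j\<le>M + q. b (m + j))"
      using j(1) nonneg by (intro member_le_sum[of "M + j" "{..M + q}" "\<lambda>j. b (m + j)"]) auto
    then show "\<eta> \<le> (\<Sum>j\<le>M + q. b (m + j))" using j(2) by (simp add: add.assoc)
  qed
  ultimately have "\<eta> \<le> (\<Sum>j\<le>M + q. (\<Sum>m=1..N. b (m + j)) / real N)"
    using N(1) by (simp add: pos_le_divide_eq mult.commute)
  then show False using N(2) by simp
qed

section \<open>The torus, its orbits and Haar measure\<close>

definition torus_set :: "nat \<Rightarrow> (nat \<Rightarrow> complex) set" where
  "torus_set m = {..<m} \<rightarrow>\<^sub>E sphere 0 1"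

lemma torus_set_iff: "x \<in> torus_set m \<longleftrightarrow> x \<in> extensional {..<m} \<and> (\<forall>i<m. cmod (x i) = 1)"
  by (simp add: torus_set_def PiE_iff) blast

lemma torus_setD: "x \<in> torus_set m \<Longrightarrow> i < m \<Longrightarrow> cmod (x i) = 1"
  by (simp add: torus_set_iff)

lemma restrict_in_torus_set [simp]: "(\<lambda>i\<in>{..<m}. x i) \<in> torus_set m \<longleftrightarrow> (\<forall>i<m. cmod (x i) = 1)"
  by (simp add: torus_set_iff)

lemma group_circle_group: "group circle_group"
proof (rule groupI)
  fix x assume "x \<in> carrier circle_group"
  then show "\<exists>y\<in>carrier circle_group. y \<otimes>\<^bsub>circle_group\<^esub> x = \<one>\<^bsub>circle_group\<^esub>"
    by (intro bexI[of _ "inverse x"]) (auto simp: circle_group_def norm_inverse intro!: left_inverse)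
qed (auto simp: circle_group_def norm_mult)

lemma inv_circle_group:
  assumes "cmod x = 1"
  shows "inv\<^bsub>circle_group\<^esub> x = inverse x"
proof (rule group.inv_equality[OF group_circle_group])
  show "inverse x \<otimes>\<^bsub>circle_group\<^esub> x = \<one>\<^bsub>circle_group\<^esub>"
    using assms by (auto simp: circle_group_def intro!: left_inverse)
qed (use assms in \<open>auto simp: circle_group_def norm_inverse\<close>)

lemma torus_simps:
  "carrier (torus m) = torus_set m"
  "x \<otimes>\<^bsub>torus m\<^esub> y = (\<lambda>i\<in>{..<m}. x i * y i)"
  "\<one>\<^bsub>torus m\<^esub> = (\<lambda>i\<in>{..<m}. 1)"
  by (simp_all add: torus_def circle_group_def torus_set_def)

lemma inv_torus:
  assumes "x \<in> torus_set m"
  shows "inv\<^bsub>torus m\<^esub> x = (\<lambda>i\<in>{..<m}. inverse (x i))"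
proof -
  have "inv\<^bsub>torus m\<^esub> x = (\<lambda>i\<in>{..<m}. inv\<^bsub>circle_group\<^esub> x i)"
    unfolding torus_def
  proof (rule inv_product_group[OF _ group_circle_group])
    show "x \<in> (\<Pi>\<^sub>E i\<in>{..<m}. carrier circle_group)"
      using assms by (simp add: circle_group_def torus_set_def)
  qed
  also have "\<dots> = (\<lambda>i\<in>{..<m}. inverse (x i))"
    using assms by (intro restrict_ext inv_circle_group) (simp add: torus_set_iff)
  finally show ?thesis .
qed

lemma topspace_torus: "topspace (torus_topology m) = torus_set m"
  by (simp add: torus_topology_def torus_set_def)

definition torus_ball :: "nat \<Rightarrow> (nat \<Rightarrow> complex) \<Rightarrow> real \<Rightarrow> (nat \<Rightarrow> complex) set" where
  "torus_ball m l \<delta> = {x \<in> torus_set m. \<forall>i<m. cmod (x i - l i) < \<delta>}"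

lemma openin_torus_ball: "openin (torus_topology m) (torus_ball m l \<delta>)"
proof -
  have "torus_ball m l \<delta> = (\<Pi>\<^sub>E i\<in>{..<m}. sphere 0 1 \<inter> ball (l i) \<delta>)"
    by (simp add: torus_ball_def torus_set_iff PiE_iff set_eq_iff dist_norm norm_minus_commute) blast
  moreover have "openin (torus_topology m) (\<Pi>\<^sub>E i\<in>{..<m}. sphere 0 1 \<inter> ball (l i) \<delta>)"
    unfolding torus_topology_def by (subst openin_PiE) (auto intro: openin_open_Int)
  ultimately show ?thesis by simp
qed

text \<open>Refers to the maximum metric, but with a strict bound \<open>\<delta>\<close> on all
  coordinates in place of a maximum, which matches \<open>torus_ball\<close>. Positivity of
  \<open>K\<close> allows radii of the form \<open>\<epsilon> / K\<close>.\<close>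

definition lipschitz_on_torus :: "nat \<Rightarrow> real \<Rightarrow> ((nat \<Rightarrow> complex) \<Rightarrow> complex) \<Rightarrow> bool" where
  "lipschitz_on_torus m K f \<longleftrightarrow> K > 0 \<and>
     (\<forall>x\<in>torus_set m. \<forall>y\<in>torus_set m. \<forall>\<delta>. (\<forall>i<m. cmod (x i - y i) < \<delta>) \<longrightarrow> cmod (f x - f y) \<le> K * \<delta>)"

lemma lipschitz_on_torusD:
  assumes "lipschitz_on_torus m K f" "x \<in> torus_set m" "y \<in> torus_set m"
    "\<And>i. i < m \<Longrightarrow> cmod (x i - y i) < \<delta>"
  shows "cmod (f x - f y) \<le> K * \<delta>"
  using assms unfolding lipschitz_on_torus_def by blast

locale unimodular_list =
  fixes ls :: "complex list"
  assumes unimodular: "\<And>i. i < length ls \<Longrightarrow> cmod (ls ! i) = 1"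
begin

definition orbit :: "nat \<Rightarrow> nat \<Rightarrow> complex" where
  "orbit m = (\<lambda>i\<in>{..<length ls}. ls ! i ^ m)"

lemma orbit_nth [simp]: "i < length ls \<Longrightarrow> orbit m i = ls ! i ^ m"
  by (simp add: orbit_def)

lemma orbit_in_torus [simp]: "orbit m \<in> torus_set (length ls)"
  using unimodular by (simp add: orbit_def norm_power)

lemma tau_pow: "tau ls [^]\<^bsub>torus (length ls)\<^esub> m = orbit m"
  by (induction m) (auto simp: torus_simps orbit_def tau_def fun_eq_iff)

lemma tau_in_torus: "tau ls \<in> torus_set (length ls)"
  using unimodular by (simp add: tau_def)

lemma inverse_tau_in_torus: "(\<lambda>i\<in>{..<length ls}. inverse (tau ls i)) \<in> torus_set (length ls)"
  using torus_setD[OF tau_in_torus] by (simp add: norm_inverse)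

text \<open>Pigeonhole: a grid of squares of side \<open>\<delta> / 2\<close> has finitely many
  cells that meet the unit circle, so the orbit meets finitely many tuples of cells, and
  \<open>q\<close> bounds the times of the first visits.\<close>

lemma orbit_cover:
  assumes "\<delta> > 0"
  shows "\<exists>q. \<forall>m. \<exists>p\<le>q. \<forall>i<length ls. cmod (ls ! i ^ m - ls ! i ^ p) < \<delta>"
proof -
  define K where "K = 2 / \<delta>"
  have K: "K > 0" using assms by (simp add: K_def)
  define cell where "cell = (\<lambda>z. (\<lfloor>Re z * K\<rfloor>, \<lfloor>Im z * K\<rfloor>))"
  define B where "B = {- \<lceil>K\<rceil>..\<lceil>K\<rceil>}"
  have floorB: "\<lfloor>t * K\<rfloor> \<in> B" if "\<bar>t\<bar> \<le> 1" for t :: real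
  proof -
    have "- K \<le> t * K" "t * K \<le> K"
      using that K mult_right_mono[of "-1" t K] mult_right_mono[of t 1 K] by auto
    then have "- \<lceil>K\<rceil> \<le> \<lfloor>t * K\<rfloor>" "\<lfloor>t * K\<rfloor> \<le> \<lceil>K\<rceil>" by linarith+
    then show ?thesis by (simp add: B_def)
  qed
  have cellB: "cell z \<in> B \<times> B" if "cmod z = 1" for z
    using floorB[of "Re z"] floorB[of "Im z"] abs_Re_le_cmod[of z] abs_Im_le_cmod[of z] that
    by (simp add: cell_def)
  have close: "\<bar>s - t\<bar> < \<delta> / 2" if "\<lfloor>s * K\<rfloor> = \<lfloor>t * K\<rfloor>" for s t :: real
  proof -
    have "\<bar>s * K - t * K\<bar> < 1" using that by linarith
    moreover have "\<bar>s * K - t * K\<bar> = \<bar>s - t\<bar> * K"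
      using K by (simp add: abs_mult left_diff_distrib[symmetric])
    ultimately show ?thesis using assms by (simp add: K_def field_simps)
  qed
  have cell_close: "cmod (z - w) < \<delta>" if "cell z = cell w" for z w
    using cmod_le[of "z - w"] close[of "Re z" "Re w"] close[of "Im z" "Im w"] that
    by (auto simp: cell_def)
  define c where "c = (\<lambda>m. \<lambda>i\<in>{..<length ls}. cell (ls ! i ^ m))"
  have "range c \<subseteq> {..<length ls} \<rightarrow>\<^sub>E B \<times> B"
    using cellB unimodular by (simp add: c_def norm_power image_subset_iff PiE_iff del: mem_Sigma_iff)
  moreover have "finite ({..<length ls} \<rightarrow>\<^sub>E B \<times> B)"
    by (intro finite_PiE) (auto simp: B_def)
  ultimately have fin: "finite (range c)" by (rule finite_subset)
  define rep where "rep = (\<lambda>v. LEAST p. c p = v)"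
  define q where "q = Max (rep ` range c)"
  have "\<exists>p\<le>q. \<forall>i<length ls. cmod (ls ! i ^ m - ls ! i ^ p) < \<delta>" for m
  proof (intro exI conjI allI impI)
    show "rep (c m) \<le> q" unfolding q_def using fin by (intro Max_ge) auto
    fix i assume i: "i < length ls"
    have "c (rep (c m)) = c m" unfolding rep_def by (rule LeastI[of _ m]) simp
    then have "cell (ls ! i ^ rep (c m)) = cell (ls ! i ^ m)"
      using i by (auto simp: c_def dest!: fun_cong[of _ _ i])
    then show "cmod (ls ! i ^ m - ls ! i ^ rep (c m)) < \<delta>" using cell_close by metis
  qed
  then show ?thesis by blast
qed

lemma cmod_pow_diff:
  assumes "i < length ls"
  shows "cmod (ls ! i ^ k * z - ls ! i ^ k * w) = cmod (z - w)"
  using unimodular[OF assms] by (simp add: right_diff_distrib[symmetric] norm_mult norm_power)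

text \<open>Multiplication by \<open>\<tau> ^ j\<close> is an isometry, so powers that are close
  stay close under every common shift; \<open>orbit_cover\<close> supplies the finitely many
  representatives.\<close>

lemma almost_periodic_orbit:
  assumes "lipschitz_on_torus (length ls) K f"
  shows "almost_periodic (\<lambda>m. f (orbit m))"
  unfolding almost_periodic_def
proof (intro allI impI)
  fix \<epsilon> :: real assume e: "\<epsilon> > 0"
  have K: "K > 0" using assms by (simp add: lipschitz_on_torus_def)
  obtain q where q: "\<And>m. \<exists>p\<le>q. \<forall>i<length ls. cmod (ls ! i ^ m - ls ! i ^ p) < \<epsilon> / K"
    using orbit_cover[of "\<epsilon> / K"] e K by auto
  have "\<exists>p\<le>q. \<forall>j. cmod (f (orbit (m + j)) - f (orbit (p + j))) \<le> \<epsilon>" for m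
  proof -
    obtain p where p: "p \<le> q" "\<And>i. i < length ls \<Longrightarrow> cmod (ls ! i ^ m - ls ! i ^ p) < \<epsilon> / K"
      using q by blast
    have "cmod (f (orbit (m + j)) - f (orbit (p + j))) \<le> \<epsilon>" for j
    proof -
      have "cmod (f (orbit (m + j)) - f (orbit (p + j))) \<le> K * (\<epsilon> / K)"
      proof (rule lipschitz_on_torusD[OF assms])
        fix i assume i: "i < length ls"
        show "cmod (orbit (m + j) i - orbit (p + j) i) < \<epsilon> / K"
          using i p(2)[OF i] cmod_pow_diff[OF i, of j "ls ! i ^ m" "ls ! i ^ p"]
          by (simp add: power_add mult.commute)
      qed simp_all
      then show ?thesis using K by simp
    qed
    then show ?thesis using p(1) by blast
  qed
  then show "\<exists>q. \<forall>m. \<exists>p\<le>q. \<forall>j. cmod (f (orbit (m + j)) - f (orbit (p + j))) \<le> \<epsilon>" by blast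
qed

text \<open>Exponents must be arbitrarily large and never negative: this is the limit set of the
  positive powers, to which \<open>T_lim\<close> refers, whereas \<Lambda> closes the full cyclic
  group. \<open>Lambda_iff\<close> reconciles the two.\<close>

definition approximable :: "(nat \<Rightarrow> complex) \<Rightarrow> bool" where
  "approximable l \<longleftrightarrow> (\<forall>\<delta>>0. \<forall>M. \<exists>m\<ge>M. \<forall>i<length ls. cmod (ls ! i ^ m - l i) < \<delta>)"

lemma approximableD:
  assumes "approximable l" "\<delta> > 0"
  obtains m where "m \<ge> M" "\<And>i. i < length ls \<Longrightarrow> cmod (ls ! i ^ m - l i) < \<delta>"
  using assms unfolding approximable_def by blast

text \<open>Recurrence: \<open>\<tau> ^ (q + M)\<close> is close to some \<open>\<tau> ^ p\<close>
  with \<open>p \<le> q\<close>, and cancelling the isometry \<open>\<tau> ^ p\<close> leaves an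
  exponent of at least \<open>M\<close>.\<close>

lemma approximable_one: "approximable (\<lambda>i\<in>{..<length ls}. 1)"
  unfolding approximable_def
proof (intro allI impI)
  fix \<delta> :: real and M :: nat assume "\<delta> > 0"
  then obtain q where q: "\<And>m. \<exists>p\<le>q. \<forall>i<length ls. cmod (ls ! i ^ m - ls ! i ^ p) < \<delta>"
    using orbit_cover by blast
  obtain p where p: "p \<le> q" "\<And>i. i < length ls \<Longrightarrow> cmod (ls ! i ^ (q + M) - ls ! i ^ p) < \<delta>"
    using q by blast
  have "cmod (ls ! i ^ (q + M - p) - 1) < \<delta>" if i: "i < length ls" for i
  proof -
    have "ls ! i ^ (q + M) = ls ! i ^ p * ls ! i ^ (q + M - p)"
      using p(1) by (simp add: power_add[symmetric])
    then show ?thesis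
      using p(2)[OF i] cmod_pow_diff[OF i, of p "ls ! i ^ (q + M - p)" 1] by simp
  qed
  then show "\<exists>m\<ge>M. \<forall>i<length ls. cmod (ls ! i ^ m - (\<lambda>i\<in>{..<length ls}. 1) i) < \<delta>"
    using p(1) by (intro exI[of _ "q + M - p"]) auto
qed

lemma approximable_mult:
  assumes "approximable x" "approximable y" "x \<in> torus_set (length ls)"
  shows "approximable (\<lambda>i\<in>{..<length ls}. x i * y i)"
  unfolding approximable_def
proof (intro allI impI)
  fix \<delta> :: real and M :: nat assume d: "\<delta> > 0"
  obtain m where m: "m \<ge> M" "\<And>i. i < length ls \<Longrightarrow> cmod (ls ! i ^ m - x i) < \<delta> / 2"
    using approximableD[OF assms(1), of "\<delta> / 2" M] d by auto
  obtain k where k: "\<And>i. i < length ls \<Longrightarrow> cmod (ls ! i ^ k - y i) < \<delta> / 2"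
    using approximableD[OF assms(2), of "\<delta> / 2" 0] d by auto
  have "cmod (ls ! i ^ (k + m) - x i * y i) < \<delta>" if i: "i < length ls" for i
  proof -
    have "ls ! i ^ (k + m) - x i * y i = (ls ! i ^ k * ls ! i ^ m - ls ! i ^ k * x i) + x i * (ls ! i ^ k - y i)"
      by (simp add: power_add algebra_simps)
    moreover have "cmod (x i) = 1" using assms(3) i by (rule torus_setD)
    ultimately show ?thesis
      using m(2)[OF i] k[OF i] cmod_pow_diff[OF i, of k "ls ! i ^ m" "x i"]
        norm_triangle_ineq[of "ls ! i ^ k * ls ! i ^ m - ls ! i ^ k * x i" "x i * (ls ! i ^ k - y i)"]
      by (simp add: norm_mult)
  qed
  then show "\<exists>m\<ge>M. \<forall>i<length ls. cmod (ls ! i ^ m - (\<lambda>i\<in>{..<length ls}. x i * y i) i) < \<delta>"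
    using m(1) by (intro exI[of _ "k + m"]) auto
qed

text \<open>A return to the identity at time \<open>Suc k\<close> is a visit to the vicinity of the
  inverse of \<tau> at time \<open>k\<close>; recurrence thus supplies the negative powers.\<close>

lemma approximable_inv_tau: "approximable (\<lambda>i\<in>{..<length ls}. inverse (tau ls i))"
  unfolding approximable_def
proof (intro allI impI)
  fix \<delta> :: real and M :: nat assume d: "\<delta> > 0"
  obtain m where m: "m \<ge> Suc M" "\<And>i. i < length ls \<Longrightarrow> cmod (ls ! i ^ m - 1) < \<delta>"
    using approximableD[OF approximable_one, of \<delta> "Suc M"] d by auto
  then obtain k where k: "m = Suc k" "k \<ge> M" by (cases m) auto
  have "cmod (ls ! i ^ k - inverse (ls ! i)) < \<delta>" if i: "i < length ls" for i
  proof -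
    have "ls ! i \<noteq> 0" using unimodular[OF i] by auto
    then show ?thesis
      using m(2)[OF i] k cmod_pow_diff[OF i, of 1 "ls ! i ^ k" "inverse (ls ! i)"] by simp
  qed
  then show "\<exists>m\<ge>M. \<forall>i<length ls. cmod (ls ! i ^ m - (\<lambda>i\<in>{..<length ls}. inverse (tau ls i)) i) < \<delta>"
    using k(2) by (intro exI[of _ k]) (auto simp: tau_def)
qed

lemma approximable_tau: "approximable (tau ls)"
  unfolding approximable_def
proof (intro allI impI)
  fix \<delta> :: real and M :: nat assume d: "\<delta> > 0"
  obtain m where m: "m \<ge> M" "\<And>i. i < length ls \<Longrightarrow> cmod (ls ! i ^ m - 1) < \<delta>"
    using approximableD[OF approximable_one, of \<delta> M] d by auto
  have "cmod (ls ! i ^ Suc m - ls ! i) < \<delta>" if i: "i < length ls" for i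
    using m(2)[OF i] cmod_pow_diff[OF i, of 1 "ls ! i ^ m" 1] by simp
  then show "\<exists>m\<ge>M. \<forall>i<length ls. cmod (ls ! i ^ m - tau ls i) < \<delta>"
    using m(1) by (intro exI[of _ "Suc m"]) (auto simp: tau_def)
qed

lemma generate_approximable:
  assumes "x \<in> generate (torus (length ls)) {tau ls}"
  shows "x \<in> torus_set (length ls) \<and> approximable x"
  using assms
proof (induction rule: generate.induct)
  case one
  have "(\<lambda>i\<in>{..<length ls}. 1) \<in> torus_set (length ls)"
    by (simp add: torus_set_iff restrict_extensional)
  then show ?case using approximable_one by (simp only: torus_simps)
next
  case (incl h)
  then show ?case using approximable_tau tau_in_torus by simp
next
  case (inv h)
  then show ?case
    using approximable_inv_tau inv_torus[OF tau_in_torus] inverse_tau_in_torus by (metis singletonD)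
next
  case (eng h1 h2)
  then have "(\<lambda>i\<in>{..<length ls}. h1 i * h2 i) \<in> torus_set (length ls)"
    using torus_setD[of h1 "length ls"] torus_setD[of h2 "length ls"] by (simp add: norm_mult)
  then show ?case
    using approximable_mult[of h1 h2] eng.IH unfolding torus_simps by blast
qed

lemma approximable_sequence:
  assumes "l \<in> torus_set (length ls)" "approximable l"
  obtains s :: "nat \<Rightarrow> nat" where "\<And>k. 0 < s k" "filterlim s at_top sequentially"
    "limitin (torus_topology (length ls)) (\<lambda>k. tau ls [^]\<^bsub>torus (length ls)\<^esub> s k) l sequentially"
proof -
  have "\<exists>m\<ge>Suc k. \<forall>i<length ls. cmod (ls ! i ^ m - l i) < 1 / real (Suc k)" for k
    using assms(2) unfolding approximable_def by simp
  then obtain s where s: "\<And>k. s k \<ge> Suc k" "\<And>k i. i < length ls \<Longrightarrow> cmod (ls ! i ^ s k - l i) < 1 / real (Suc k)"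
    by metis
  have "filterlim s at_top sequentially"
    unfolding filterlim_at_top eventually_sequentially using s(1) by (meson Suc_leD order_trans)
  moreover have "limitin (torus_topology (length ls)) (\<lambda>k. orbit (s k)) l sequentially"
    unfolding torus_topology_def limitin_componentwise
  proof (intro conjI ballI)
    show "l \<in> extensional {..<length ls}" using assms(1) by (simp add: torus_set_iff)
    show "\<forall>\<^sub>F k in sequentially. orbit (s k) \<in> topspace (product_topology (\<lambda>_. top_of_set (sphere 0 1)) {..<length ls})"
      using orbit_in_torus by (simp add: torus_set_def)
    fix i assume i: "i \<in> {..<length ls}"
    have "(\<lambda>k. ls ! i ^ s k - l i) \<longlonglongrightarrow> 0"
      by (rule Lim_null_comparison[OF _ LIMSEQ_inverse_real_of_nat])
        (use s(2) i in \<open>auto simp: inverse_eq_divide intro!: always_eventually less_imp_le\<close>)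
    then have "(\<lambda>k. ls ! i ^ s k) \<longlonglongrightarrow> l i" by (simp add: LIM_zero_iff)
    then show "limitin (top_of_set (sphere 0 1)) (\<lambda>k. orbit (s k) i) (l i) sequentially"
      using i torus_setD[OF assms(1)] unimodular by (simp add: limitin_subtopology norm_power)
  qed
  ultimately show ?thesis
    using that[of s] less_le_trans[OF zero_less_Suc s(1)] by (simp add: tau_pow)
qed

text \<open>Left to right, approximability is a closed condition that holds on the generated group;
  right to left, the approximating sequence consists of powers of \<open>tau ls\<close>.\<close>

lemma Lambda_iff: "l \<in> Lambda ls \<longleftrightarrow> l \<in> torus_set (length ls) \<and> approximable l"
proof
  assume l: "l \<in> Lambda ls"
  then have lt: "l \<in> torus_set (length ls)"
    using closure_of_subset_topspace[of "torus_topology (length ls)"] unfolding Lambda_def topspace_torus by blast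
  moreover have "approximable l"
    unfolding approximable_def
  proof (intro allI impI)
    fix \<delta> :: real and M :: nat assume d: "\<delta> > 0"
    have "l \<in> torus_ball (length ls) l (\<delta> / 2)" using lt d by (simp add: torus_ball_def)
    then obtain y where y: "y \<in> generate (torus (length ls)) {tau ls}" "y \<in> torus_ball (length ls) l (\<delta> / 2)"
      using l openin_torus_ball[of "length ls" l "\<delta> / 2"] unfolding Lambda_def in_closure_of by blast
    obtain m where m: "m \<ge> M" "\<And>i. i < length ls \<Longrightarrow> cmod (ls ! i ^ m - y i) < \<delta> / 2"
      using approximableD[of y "\<delta> / 2" M] generate_approximable[OF y(1)] d by auto
    have "cmod (ls ! i ^ m - l i) < \<delta>" if i: "i < length ls" for i
    proof -
      have "cmod (y i - l i) < \<delta> / 2" using y(2) i by (simp add: torus_ball_def)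
      then show ?thesis
        using m(2)[OF i] norm_triangle_ineq[of "ls ! i ^ m - y i" "y i - l i"] by simp
    qed
    then show "\<exists>m\<ge>M. \<forall>i<length ls. cmod (ls ! i ^ m - l i) < \<delta>" using m(1) by blast
  qed
  ultimately show "l \<in> torus_set (length ls) \<and> approximable l" by blast
next
  assume l: "l \<in> torus_set (length ls) \<and> approximable l"
  obtain s :: "nat \<Rightarrow> nat" where s:
    "limitin (torus_topology (length ls)) (\<lambda>k. tau ls [^]\<^bsub>torus (length ls)\<^esub> s k) l sequentially"
    using approximable_sequence[OF conjunct1[OF l] conjunct2[OF l]] by metis
  have pow: "tau ls [^]\<^bsub>torus (length ls)\<^esub> k \<in> generate (torus (length ls)) {tau ls}" for k :: nat
    by (induction k) (auto intro: generate.intros)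
  show "l \<in> Lambda ls"
    unfolding Lambda_def in_closure_of
  proof (intro conjI allI impI)
    show "l \<in> topspace (torus_topology (length ls))" using l by (simp add: topspace_torus)
    fix U assume "l \<in> U \<and> openin (torus_topology (length ls)) U"
    then have "\<forall>\<^sub>F k in sequentially. tau ls [^]\<^bsub>torus (length ls)\<^esub> s k \<in> U"
      using s by (simp add: limitin_def)
    then obtain k where "tau ls [^]\<^bsub>torus (length ls)\<^esub> s k \<in> U"
      by (auto simp: eventually_sequentially)
    then show "\<exists>y. y \<in> generate (torus (length ls)) {tau ls} \<and> y \<in> U" using pow by blast
  qed
qed

lemma Lambda_subset_torus: "Lambda ls \<subseteq> torus_set (length ls)"
  using Lambda_iff by blast

lemma Lambda_mult:
  assumes "x \<in> Lambda ls" "y \<in> Lambda ls"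
  shows "x \<otimes>\<^bsub>torus (length ls)\<^esub> y \<in> Lambda ls"
proof -
  have "(\<lambda>i\<in>{..<length ls}. x i * y i) \<in> torus_set (length ls)"
    using assms torus_setD[of x "length ls"] torus_setD[of y "length ls"] by (simp add: Lambda_iff norm_mult)
  then show ?thesis
    using assms approximable_mult[of x y] unfolding Lambda_iff torus_simps by blast
qed

lemma orbit_in_Lambda: "orbit m \<in> Lambda ls"
proof (induction m)
  case 0
  have "orbit 0 = (\<lambda>i\<in>{..<length ls}. 1)" by (simp add: orbit_def)
  then show ?case using approximable_one orbit_in_torus[of 0] Lambda_iff by metis
next
  case (Suc m)
  have "orbit (Suc m) = tau ls \<otimes>\<^bsub>torus (length ls)\<^esub> orbit m"
    by (auto simp: torus_simps orbit_def tau_def fun_eq_iff)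
  then show ?case
    using Lambda_mult Suc approximable_tau tau_in_torus by (metis Lambda_iff)
qed

text \<open>Serves Haar invariance: the preimage of a set under translation by
  \<open>orbit m\<close> is its image under translation by this inverse.\<close>

lemma inv_orbit_in_Lambda: "(\<lambda>i\<in>{..<length ls}. inverse (ls ! i) ^ m) \<in> Lambda ls"
proof (induction m)
  case 0
  then show ?case using orbit_in_Lambda[of 0] by (simp only: orbit_def power_0)
next
  case (Suc m)
  have "(\<lambda>i\<in>{..<length ls}. inverse (ls ! i) ^ Suc m)
      = (\<lambda>i\<in>{..<length ls}. inverse (tau ls i)) \<otimes>\<^bsub>torus (length ls)\<^esub> (\<lambda>i\<in>{..<length ls}. inverse (ls ! i) ^ m)"
    by (auto simp: torus_simps tau_def fun_eq_iff)
  moreover have "(\<lambda>i\<in>{..<length ls}. inverse (tau ls i)) \<in> Lambda ls"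
    using approximable_inv_tau inverse_tau_in_torus Lambda_iff by blast
  ultimately show ?case using Lambda_mult Suc by metis
qed

text \<open>Fix \<open>r \<ge> q\<close> with \<open>\<tau> ^ r\<close> near \<open>l\<close>. At
  any time \<open>m\<close> the power \<open>\<tau> ^ m\<close> is near some
  \<open>\<tau> ^ p\<close> with \<open>p \<le> q\<close>, so after a further wait of
  \<open>r - p\<close> the orbit is near \<open>\<tau> ^ r\<close>; the wait never exceeds
  \<open>r\<close>.\<close>

lemma orbit_syndetic:
  assumes "l \<in> Lambda ls" "\<delta> > 0"
  obtains q where "\<And>m. \<exists>j\<le>q. \<forall>i<length ls. cmod (ls ! i ^ (m + j) - l i) < \<delta>"
proof -
  obtain q where q: "\<And>m. \<exists>p\<le>q. \<forall>i<length ls. cmod (ls ! i ^ m - ls ! i ^ p) < \<delta> / 2"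
    using orbit_cover[of "\<delta> / 2"] assms(2) by auto
  obtain r where r: "r \<ge> q" "\<And>i. i < length ls \<Longrightarrow> cmod (ls ! i ^ r - l i) < \<delta> / 2"
    using approximableD[of l "\<delta> / 2" q] assms by (auto simp: Lambda_iff)
  have "\<exists>j\<le>r. \<forall>i<length ls. cmod (ls ! i ^ (m + j) - l i) < \<delta>" for m
  proof -
    obtain p where p: "p \<le> q" "\<And>i. i < length ls \<Longrightarrow> cmod (ls ! i ^ m - ls ! i ^ p) < \<delta> / 2"
      using q by blast
    have "cmod (ls ! i ^ (m + (r - p)) - l i) < \<delta>" if i: "i < length ls" for i
    proof -
      have "ls ! i ^ r = ls ! i ^ (r - p) * ls ! i ^ p"
        using p(1) r(1) by (simp add: power_add[symmetric])
      moreover have "ls ! i ^ (m + (r - p)) = ls ! i ^ (r - p) * ls ! i ^ m"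
        by (simp add: power_add)
      ultimately show ?thesis
        using p(2)[OF i] r(2)[OF i] cmod_pow_diff[OF i, of "r - p" "ls ! i ^ m" "ls ! i ^ p"]
          norm_triangle_ineq[of "ls ! i ^ (m + (r - p)) - ls ! i ^ r" "ls ! i ^ r - l i"] by simp
    qed
    then show ?thesis by (intro exI[of _ "r - p"]) simp
  qed
  then show ?thesis using that by blast
qed

section \<open>Haar integrals as time averages\<close>

text \<open>Gives measurability for Haar measure, whose sigma-algebra is generated by the relatively
  open sets.\<close>

lemma lipschitz_preimage_open:
  assumes "lipschitz_on_torus (length ls) K f" "open S"
  shows "openin (subtopology (torus_topology (length ls)) (Lambda ls)) (f -` S \<inter> Lambda ls)"
proof (subst openin_subopen, intro ballI)
  fix x assume x: "x \<in> f -` S \<inter> Lambda ls"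
  have K: "K > 0" using assms by (simp add: lipschitz_on_torus_def)
  obtain e where e: "e > 0" "ball (f x) e \<subseteq> S"
    using x openE[OF assms(2), of "f x"] by blast
  define \<delta> where "\<delta> = e / (2 * K)"
  have d: "\<delta> > 0" using e K by (simp add: \<delta>_def)
  have "Lambda ls \<inter> torus_ball (length ls) x \<delta> \<subseteq> f -` S \<inter> Lambda ls"
  proof
    fix y assume y: "y \<in> Lambda ls \<inter> torus_ball (length ls) x \<delta>"
    have "cmod (f y - f x) \<le> K * \<delta>"
      by (rule lipschitz_on_torusD[OF assms(1)])
        (use x y Lambda_subset_torus in \<open>auto simp: torus_ball_def\<close>)
    then have "cmod (f y - f x) < e" using K e by (simp add: \<delta>_def)
    then have "f y \<in> S" using e(2) by (auto simp: dist_norm norm_minus_commute)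
    then show "y \<in> f -` S \<inter> Lambda ls" using y by simp
  qed
  moreover have "x \<in> torus_ball (length ls) x \<delta>"
    using x d Lambda_subset_torus by (auto simp: torus_ball_def)
  ultimately show "\<exists>T. openin (subtopology (torus_topology (length ls)) (Lambda ls)) T \<and> x \<in> T \<and> T \<subseteq> f -` S \<inter> Lambda ls"
    using x openin_subtopology_Int2[OF openin_torus_ball, of "length ls" "Lambda ls" x \<delta>]
    by (intro exI[of _ "Lambda ls \<inter> torus_ball (length ls) x \<delta>"] conjI IntI) simp_all
qed

lemma continuous_map_orbit_mult:
  "continuous_map (torus_topology (length ls)) (torus_topology (length ls))
     (\<lambda>y. orbit j \<otimes>\<^bsub>torus (length ls)\<^esub> y)"
  unfolding torus_simps
  apply (subst (2) torus_topology_def)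
  unfolding continuous_map_componentwise
proof (intro conjI ballI)
  fix i assume i: "i \<in> {..<length ls}"
  have "continuous_map (torus_topology (length ls)) (top_of_set (sphere 0 1)) (\<lambda>y. y i)"
    unfolding torus_topology_def using i by (rule continuous_map_product_projection)
  then have "continuous_map (torus_topology (length ls)) euclidean (\<lambda>y. y i)"
    by (rule continuous_map_into_fulltopology)
  then have "continuous_map (torus_topology (length ls)) euclidean ((*) (ls ! i ^ j) \<circ> (\<lambda>y. y i))"
    by (rule continuous_map_compose) (simp only: continuous_map_iff_continuous2, intro continuous_intros)
  moreover have "cmod (ls ! i ^ j * y i) = 1" if "y \<in> topspace (torus_topology (length ls))" for y
    using that i unimodular torus_setD[of y "length ls" i] by (simp add: topspace_torus norm_mult norm_power)
  ultimately show "continuous_map (torus_topology (length ls)) (top_of_set (sphere 0 1))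
      (\<lambda>y. (\<lambda>i\<in>{..<length ls}. orbit j i * y i) i)"
    using i by (auto simp: continuous_map_in_subtopology o_def)
qed auto

text \<open>\<open>normalized_haar\<close> states invariance for images of sets, while integrals
  need the push-forward, that is, preimages; translation by the inverse converts one into the
  other.\<close>

lemma haar_translation:
  assumes "normalized_haar ls \<mu>"
  shows "(\<lambda>y. orbit j \<otimes>\<^bsub>torus (length ls)\<^esub> y) \<in> measurable \<mu> \<mu>"
    and "distr \<mu> \<mu> (\<lambda>y. orbit j \<otimes>\<^bsub>torus (length ls)\<^esub> y) = \<mu>"
proof -
  let ?X = "subtopology (torus_topology (length ls)) (Lambda ls)"
  let ?t = "\<lambda>y. orbit j \<otimes>\<^bsub>torus (length ls)\<^esub> y"
  let ?z = "\<lambda>i\<in>{..<length ls}. inverse (ls ! i) ^ j"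
  have space: "space \<mu> = Lambda ls" using assms by (simp add: normalized_haar_def)
  have pow: "{U. openin ?X U} \<subseteq> Pow (Lambda ls)"
    using openin_subset by fastforce
  have sets: "sets \<mu> = sigma_sets (Lambda ls) {U. openin ?X U}"
    using assms pow by (simp add: normalized_haar_def sets_measure_of)
  have maps: "?t \<in> Lambda ls \<rightarrow> Lambda ls" using Lambda_mult orbit_in_Lambda by blast
  have cont: "continuous_map ?X ?X ?t"
    using continuous_map_orbit_mult maps
    by (auto simp: continuous_map_in_subtopology intro: continuous_map_from_subtopology)
  show meas: "?t \<in> measurable \<mu> \<mu>"
  proof (rule measurable_sigma_sets[OF sets pow])
    show "?t \<in> space \<mu> \<rightarrow> Lambda ls" using maps space by simp
    fix U assume "U \<in> {U. openin ?X U}"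
    then have "openin ?X {x \<in> topspace ?X. ?t x \<in> U}"
      using openin_continuous_map_preimage[OF cont] by simp
    moreover have "{x \<in> topspace ?X. ?t x \<in> U} = ?t -` U \<inter> space \<mu>"
      using Lambda_subset_torus by (auto simp: space topspace_torus)
    ultimately show "?t -` U \<inter> space \<mu> \<in> sets \<mu>" unfolding sets by auto
  qed
  have tz: "?t (?z \<otimes>\<^bsub>torus (length ls)\<^esub> y) = y" "?z \<otimes>\<^bsub>torus (length ls)\<^esub> ?t y = y"
    if "y \<in> Lambda ls" for y
  proof -
    have "y \<in> extensional {..<length ls}" using that by (simp add: Lambda_iff torus_set_iff)
    moreover have "ls ! i \<noteq> 0" if "i < length ls" for i using unimodular[OF that] by auto
    ultimately show "?t (?z \<otimes>\<^bsub>torus (length ls)\<^esub> y) = y" "?z \<otimes>\<^bsub>torus (length ls)\<^esub> ?t y = y"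
      by (auto simp: torus_simps fun_eq_iff extensional_def power_inverse)
  qed
  have zL: "?z \<in> Lambda ls" by (rule inv_orbit_in_Lambda)
  show "distr \<mu> \<mu> ?t = \<mu>"
  proof (rule measure_eqI)
    fix E assume "E \<in> sets (distr \<mu> \<mu> ?t)"
    then have E: "E \<in> sets \<mu>" by simp
    then have EL: "E \<subseteq> Lambda ls" using sets.sets_into_space space by blast
    have "?t -` E \<inter> space \<mu> = (\<lambda>y. ?z \<otimes>\<^bsub>torus (length ls)\<^esub> y) ` E"
    proof (rule equalityI; rule subsetI)
      fix y assume "y \<in> ?t -` E \<inter> space \<mu>"
      then show "y \<in> (\<lambda>y. ?z \<otimes>\<^bsub>torus (length ls)\<^esub> y) ` E"
        using tz(2)[of y] space by (metis IntD1 IntD2 image_eqI vimageD)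
    next
      fix y assume "y \<in> (\<lambda>y. ?z \<otimes>\<^bsub>torus (length ls)\<^esub> y) ` E"
      then obtain x where x: "x \<in> E" "y = ?z \<otimes>\<^bsub>torus (length ls)\<^esub> x" by blast
      then have "?t y = x" "y \<in> Lambda ls" using tz(1)[of x] EL Lambda_mult[OF zL] by auto
      then show "y \<in> ?t -` E \<inter> space \<mu>" using x(1) space by (metis IntI vimageI)
    qed
    then show "emeasure (distr \<mu> \<mu> ?t) E = emeasure \<mu> E"
      using assms E meas zL by (simp add: emeasure_distr normalized_haar_def)
  qed simp
qed

text \<open>Averaging \<open>f\<close> over its translates by \<open>\<tau> ^ 1\<close> up to
  \<open>\<tau> ^ N\<close> leaves the integral unchanged, but makes the integrand uniformly close
  to the constant \<open>c\<close>.\<close>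

lemma haar_integral_eq_mean:
  assumes haar: "normalized_haar ls \<mu>"
    and lip: "lipschitz_on_torus (length ls) K f"
    and mean: "\<And>\<epsilon>. \<epsilon> > 0 \<Longrightarrow> \<exists>N0>0. \<forall>N\<ge>N0. \<forall>m. cmod (window_mean (\<lambda>m. f (orbit m)) N m - c) \<le> \<epsilon>"
  shows "integral\<^sup>L \<mu> f = c"
proof -
  let ?t = "\<lambda>j y. orbit j \<otimes>\<^bsub>torus (length ls)\<^esub> y"
  let ?X = "subtopology (torus_topology (length ls)) (Lambda ls)"
  have space: "space \<mu> = Lambda ls" using haar by (simp add: normalized_haar_def)
  interpret prob_space \<mu> using haar by (simp add: normalized_haar_def)
  have K: "K > 0" using lip by (simp add: lipschitz_on_torus_def)
  have pow: "{U. openin ?X U} \<subseteq> Pow (Lambda ls)"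
    using openin_subset by fastforce
  have "f -` S \<inter> Lambda ls \<in> sets \<mu>" if "open S" for S
    using lipschitz_preimage_open[OF lip that] haar pow by (auto simp: normalized_haar_def sets_measure_of)
  then have fm: "f \<in> borel_measurable \<mu>" by (intro borel_measurableI) (simp add: space)
  have bound: "cmod (f x) \<le> cmod (f (orbit 0)) + K * 3" if "x \<in> Lambda ls" for x
  proof -
    \<comment> \<open>Points of the circle are at distance at most 2; the radius 3 makes the
      inequality strict.\<close>
    have "cmod (f x - f (orbit 0)) \<le> K * 3"
    proof (rule lipschitz_on_torusD[OF lip])
      fix i assume i: "i < length ls"
      have "cmod (x i - orbit 0 i) \<le> cmod (x i) + cmod (orbit 0 i)" by (rule norm_triangle_ineq4)
      then show "cmod (x i - orbit 0 i) < 3"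
        using i that torus_setD[of x "length ls" i] by (simp add: Lambda_iff)
    qed (use that Lambda_iff in auto)
    then show ?thesis using norm_triangle_ineq[of "f x - f (orbit 0)" "f (orbit 0)"] by simp
  qed
  have int: "integrable \<mu> f"
    by (rule integrable_const_bound[of _ "cmod (f (orbit 0)) + K * 3"])
      (use bound fm in \<open>auto simp: space\<close>)
  note t = haar_translation[OF haar]
  have int_t: "integrable \<mu> (\<lambda>y. f (?t j y))" for j
    using integrable_distr[OF t(1)[of j], of f] int t(2)[of j] by simp
  have eq_t: "(\<integral>y. f (?t j y) \<partial>\<mu>) = integral\<^sup>L \<mu> f" for j
    using integral_distr[OF t(1)[of j] fm] t(2)[of j] by simp
  define A where "A = (\<lambda>N y. window_mean (\<lambda>j. f (?t j y)) N 0)"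
  \<comment> \<open>The translates of \<open>y\<close> are shadowed by the orbit window that starts
    at an \<open>m\<close> with \<open>\<tau> ^ m\<close> near \<open>y\<close>: one
    \<open>\<epsilon>\<close> pays for the shadowing, one for the distance of that window mean from
    \<open>c\<close>.\<close>
  have close: "cmod (A N y - c) \<le> 2 * \<epsilon>"
    if e: "\<epsilon> > 0" and N: "N > 0" "\<And>m. cmod (window_mean (\<lambda>m. f (orbit m)) N m - c) \<le> \<epsilon>"
      and y: "y \<in> Lambda ls" for N \<epsilon> y
  proof -
    obtain m where m: "\<And>i. i < length ls \<Longrightarrow> cmod (ls ! i ^ m - y i) < \<epsilon> / K"
      using approximableD[of y "\<epsilon> / K" 0] y e K by (auto simp: Lambda_iff)
    have "cmod (window_mean (\<lambda>j. f (?t j y)) N 0 - window_mean (\<lambda>m. f (orbit m)) N m) \<le> \<epsilon>"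
    proof (rule window_mean_diff_le[OF _ N(1)])
      fix j
      have "cmod (f (?t j y) - f (orbit (m + j))) \<le> K * (\<epsilon> / K)"
      proof (rule lipschitz_on_torusD[OF lip])
        show "?t j y \<in> torus_set (length ls)"
          using Lambda_mult[OF orbit_in_Lambda y] Lambda_iff by blast
        fix i assume i: "i < length ls"
        then show "cmod (?t j y i - orbit (m + j) i) < \<epsilon> / K"
          using m[OF i] cmod_pow_diff[OF i, of j "y i" "ls ! i ^ m"]
          by (simp add: torus_simps power_add mult.commute norm_minus_commute)
      qed simp
      then show "cmod (f (?t (0 + j) y) - f (orbit (m + j))) \<le> \<epsilon>" using K by simp
    qed
    then show ?thesis
      using N(2)[of m] norm_triangle_ineq[of "A N y - window_mean (\<lambda>m. f (orbit m)) N m" "window_mean (\<lambda>m. f (orbit m)) N m - c"]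
      by (simp add: A_def)
  qed
  have "cmod (integral\<^sup>L \<mu> f - c) \<le> 2 * \<epsilon>" if e: "\<epsilon> > 0" for \<epsilon>
  proof -
    obtain N where N: "N > 0" "\<And>m. cmod (window_mean (\<lambda>m. f (orbit m)) N m - c) \<le> \<epsilon>"
      using mean[OF e] by blast
    have "integral\<^sup>L \<mu> (A N) = (\<Sum>j=1..N. \<integral>y. f (?t j y) \<partial>\<mu>) / of_nat N"
      using int_t by (simp add: A_def window_mean_def Bochner_Integration.integral_sum)
    then have AN: "integral\<^sup>L \<mu> (A N) = integral\<^sup>L \<mu> f" using N(1) by (simp add: eq_t)
    have iA: "integrable \<mu> (A N)"
      unfolding A_def window_mean_def using int_t by (intro integrable_divide Bochner_Integration.integrable_sum) simp
    have "integral\<^sup>L \<mu> f - c = (\<integral>y. A N y - c \<partial>\<mu>)"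
      using iA by (simp add: AN Bochner_Integration.integral_diff prob_space)
    also have "cmod \<dots> \<le> (\<integral>y. cmod (A N y - c) \<partial>\<mu>)" by (rule integral_norm_bound)
    also have "\<dots> \<le> 2 * \<epsilon>"
      using iA close[OF e N] by (intro integral_le_const) (auto simp: space intro!: AE_I2)
    finally show ?thesis .
  qed
  from this[of "e / 2" for e] have "cmod (integral\<^sup>L \<mu> f - c) \<le> e" if "e > 0" for e
    using that by simp
  then have "cmod (integral\<^sup>L \<mu> f - c) \<le> 0" by (rule field_le_epsilon[of _ 0, simplified])
  then show ?thesis by simp
qed

end

section \<open>The operator norm and normalization\<close>

lemma mult_entry:
  fixes A B :: "'a::comm_semiring_0 mat"
  assumes "A \<in> carrier_mat N N" "B \<in> carrier_mat N N" "i < N" "j < N"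
  shows "(A * B) $$ (i, j) = (\<Sum>k<N. A $$ (i, k) * B $$ (k, j))"
  using assms by (simp add: scalar_prod_def lessThan_atLeast0)

lemma mult_vec_entry:
  fixes A :: "'a::comm_semiring_0 mat"
  assumes "A \<in> carrier_mat N N" "v \<in> carrier_vec N" "i < N"
  shows "vec_index (A *\<^sub>v v) i = (\<Sum>k<N. A $$ (i, k) * vec_index v k)"
  using assms by (simp add: scalar_prod_def lessThan_atLeast0)

lemma triple_mult_entry:
  fixes A B C :: "'a::comm_semiring_0 mat"
  assumes "A \<in> carrier_mat N N" "B \<in> carrier_mat N N" "C \<in> carrier_mat N N" "i < N" "j < N"
  shows "(A * B * C) $$ (i, j) = (\<Sum>p<N. \<Sum>q<N. A $$ (i, p) * B $$ (p, q) * C $$ (q, j))"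
proof -
  have "(A * B * C) $$ (i, j) = (\<Sum>q<N. (\<Sum>p<N. A $$ (i, p) * B $$ (p, q)) * C $$ (q, j))"
    using assms by (subst mult_entry[of _ N]) (auto intro!: sum.cong simp: mult_entry[of A N B] simp del: index_mult_mat(1))
  also have "\<dots> = (\<Sum>p<N. \<Sum>q<N. A $$ (i, p) * B $$ (p, q) * C $$ (q, j))"
    unfolding sum_distrib_right by (rule sum.swap)
  finally show ?thesis .
qed

text \<open>Comparison norm: \<open>op_norm\<close> lies between the modulus of each entry and this
  sum, so entrywise limits control operator norms.\<close>

definition entry_sum :: "nat \<Rightarrow> complex mat \<Rightarrow> real" where
  "entry_sum N A = (\<Sum>i<N. \<Sum>j<N. cmod (A $$ (i, j)))"

lemma entry_sum_nonneg: "0 \<le> entry_sum N A"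
  unfolding entry_sum_def by (intro sum_nonneg) auto

lemma entry_le_entry_sum:
  assumes "i < N" "j < N"
  shows "cmod (A $$ (i, j)) \<le> entry_sum N A"
proof -
  have "cmod (A $$ (i, j)) \<le> (\<Sum>j<N. cmod (A $$ (i, j)))"
    using assms by (intro member_le_sum) auto
  also have "\<dots> \<le> entry_sum N A"
    unfolding entry_sum_def using assms
    by (intro member_le_sum[of i "{..<N}" "\<lambda>i. \<Sum>j<N. cmod (A $$ (i, j))"]) (auto intro: sum_nonneg)
  finally show ?thesis .
qed

lemma euclid_norm_mult_le:
  assumes "A \<in> carrier_mat N N" "v \<in> carrier_vec N" "euclid_norm v = 1"
  shows "euclid_norm (A *\<^sub>v v) \<le> entry_sum N A"
proof -
  have v: "cmod (vec_index v k) \<le> 1" if "k < N" for k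
  proof -
    have "cmod (vec_index v k) \<le> L2_set (\<lambda>i. cmod (vec_index v i)) {..<N}"
      using that by (intro member_le_L2_set) auto
    then show ?thesis using assms(2,3) by (simp add: euclid_norm_def)
  qed
  have dim: "dim_vec (A *\<^sub>v v) = N" using assms(1) by simp
  have "euclid_norm (A *\<^sub>v v) \<le> (\<Sum>i<N. cmod (vec_index (A *\<^sub>v v) i))"
    unfolding euclid_norm_def dim by (rule L2_set_le_sum) (rule norm_ge_zero)
  also have "\<dots> \<le> entry_sum N A"
    unfolding entry_sum_def
  proof (rule sum_mono)
    fix i assume "i \<in> {..<N}"
    then have "vec_index (A *\<^sub>v v) i = (\<Sum>k<N. A $$ (i, k) * vec_index v k)"
      using mult_vec_entry[OF assms(1,2)] by simp
    also have "cmod \<dots> \<le> (\<Sum>k<N. cmod (A $$ (i, k)))"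
      using v by (intro sum_norm_le) (simp add: norm_mult mult_left_le)
    finally show "cmod (vec_index (A *\<^sub>v v) i) \<le> (\<Sum>k<N. cmod (A $$ (i, k)))" .
  qed
  finally show ?thesis .
qed

lemma unit_vec_euclid_norm:
  assumes "j < N"
  shows "euclid_norm (unit_vec N j) = 1"
proof -
  have "euclid_norm (unit_vec N j) = L2_set (\<lambda>i. if i = j then 1 else 0) {..<N}"
    unfolding euclid_norm_def by (intro L2_set_cong) (auto simp: unit_vec_def)
  also have "\<dots> = 1"
    using assms by (simp add: L2_set_def if_distrib[of "\<lambda>x. x\<^sup>2"] cong: if_cong)
  finally show ?thesis .
qed

lemma op_norm_bdd:
  assumes "A \<in> carrier_mat N N"
  shows "bdd_above {euclid_norm (A *\<^sub>v v) | v. v \<in> carrier_vec (dim_col A) \<and> euclid_norm v = 1}"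
  using euclid_norm_mult_le[OF assms] assms
  by (intro bdd_aboveI[of _ "entry_sum N A"]) auto

lemma euclid_norm_le_op_norm:
  assumes "A \<in> carrier_mat N N" "v \<in> carrier_vec N" "euclid_norm v = 1"
  shows "euclid_norm (A *\<^sub>v v) \<le> op_norm A"
  unfolding op_norm_def using assms by (intro cSup_upper op_norm_bdd[OF assms(1)]) auto

lemma op_norm_least:
  assumes "A \<in> carrier_mat N N" "N > 0"
    "\<And>v. v \<in> carrier_vec N \<Longrightarrow> euclid_norm v = 1 \<Longrightarrow> euclid_norm (A *\<^sub>v v) \<le> B"
  shows "op_norm A \<le> B"
  unfolding op_norm_def
proof (rule cSup_least)
  show "{euclid_norm (A *\<^sub>v v) | v. v \<in> carrier_vec (dim_col A) \<and> euclid_norm v = 1} \<noteq> {}"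
    using unit_vec_euclid_norm[of 0 N] assms(1,2) by (auto intro!: exI[of _ "unit_vec N 0"])
qed (use assms in auto)

lemma op_norm_le_entry_sum:
  assumes "A \<in> carrier_mat N N" "N > 0"
  shows "op_norm A \<le> entry_sum N A"
  using op_norm_least[OF assms] euclid_norm_mult_le[OF assms(1)] by blast

lemma entry_le_op_norm:
  assumes "A \<in> carrier_mat N N" "i < N" "j < N"
  shows "cmod (A $$ (i, j)) \<le> op_norm A"
proof -
  have "vec_index (A *\<^sub>v unit_vec N j) i = A $$ (i, j)"
    using assms by simp
  then have "cmod (A $$ (i, j)) \<le> euclid_norm (A *\<^sub>v unit_vec N j)"
    unfolding euclid_norm_def using assms
      member_le_L2_set[of "{..<N}" i "\<lambda>k. cmod (vec_index (A *\<^sub>v unit_vec N j) k)"]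
    by (simp del: index_mult_mat_vec)
  also have "\<dots> \<le> op_norm A"
    using assms unit_vec_euclid_norm by (intro euclid_norm_le_op_norm) auto
  finally show ?thesis .
qed

lemma op_norm_nonneg:
  assumes "A \<in> carrier_mat N N" "N > 0"
  shows "0 \<le> op_norm A"
  using entry_le_op_norm[OF assms(1,2,2)] norm_ge_zero order_trans by blast

lemma op_norm_smult:
  assumes "A \<in> carrier_mat N N" "N > 0" "c > 0"
  shows "op_norm (complex_of_real c \<cdot>\<^sub>m A) = c * op_norm A"
proof -
  have norm: "euclid_norm ((complex_of_real r \<cdot>\<^sub>m B) *\<^sub>v v) = r * euclid_norm (B *\<^sub>v v)"
    if "B \<in> carrier_mat N N" "v \<in> carrier_vec N" "r > 0" for B v r
  proof -
    have "euclid_norm ((complex_of_real r \<cdot>\<^sub>m B) *\<^sub>v v) = L2_set (\<lambda>i. r * cmod (vec_index (B *\<^sub>v v) i)) {..<N}"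
      unfolding euclid_norm_def
      using that by (intro L2_set_cong) (auto simp: norm_mult)
    also have "\<dots> = r * euclid_norm (B *\<^sub>v v)"
      using that by (simp add: euclid_norm_def L2_set_right_distrib)
    finally show ?thesis .
  qed
  have le: "op_norm (complex_of_real r \<cdot>\<^sub>m B) \<le> r * op_norm B"
    if "B \<in> carrier_mat N N" "r > 0" for B r
    using that assms(2) by (intro op_norm_least[of _ N]) (auto simp: norm euclid_norm_le_op_norm)
  have "c * op_norm A \<le> op_norm (complex_of_real c \<cdot>\<^sub>m A)"
  proof -
    have "complex_of_real (1 / c) \<cdot>\<^sub>m (complex_of_real c \<cdot>\<^sub>m A) = A"
      using assms by (intro eq_matI) auto
    then have "op_norm A \<le> (1 / c) * op_norm (complex_of_real c \<cdot>\<^sub>m A)"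
      using le[of "complex_of_real c \<cdot>\<^sub>m A" "1 / c"] assms by simp
    then show ?thesis using assms(3) by (simp add: field_simps)
  qed
  then show ?thesis using le[OF assms(1,3)] by simp
qed

lemma op_norm_diff:
  assumes "A \<in> carrier_mat N N" "B \<in> carrier_mat N N" "N > 0"
  shows "\<bar>op_norm A - op_norm B\<bar> \<le> entry_sum N (A - B)"
proof -
  have le: "op_norm A \<le> op_norm B + entry_sum N (A - B)"
    if A: "A \<in> carrier_mat N N" and B: "B \<in> carrier_mat N N" for A B
  proof (rule op_norm_least[OF A assms(3)])
    fix v assume v: "v \<in> carrier_vec N" "euclid_norm v = 1"
    have AB: "A - B \<in> carrier_mat N N" using A B by (metis minus_carrier_mat)
    have "euclid_norm (A *\<^sub>v v) \<le> L2_set (\<lambda>i. cmod (vec_index (B *\<^sub>v v) i) + cmod (vec_index ((A - B) *\<^sub>v v) i)) {..<N}"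
      unfolding euclid_norm_def
    proof (rule order.trans[OF eq_refl L2_set_mono])
      show "L2_set (\<lambda>i. cmod (vec_index (A *\<^sub>v v) i)) {..<dim_vec (A *\<^sub>v v)}
          = L2_set (\<lambda>i. cmod (vec_index (A *\<^sub>v v) i)) {..<N}" using A by simp
      fix i assume i: "i \<in> {..<N}"
      have "vec_index (A *\<^sub>v v) i = vec_index (B *\<^sub>v v) i + vec_index ((A - B) *\<^sub>v v) i"
        using i A B v(1) AB
        by (simp add: mult_vec_entry[of _ N] sum.distrib[symmetric] left_diff_distrib del: index_mult_mat_vec)
      then show "cmod (vec_index (A *\<^sub>v v) i) \<le> cmod (vec_index (B *\<^sub>v v) i) + cmod (vec_index ((A - B) *\<^sub>v v) i)"
        by (simp add: norm_triangle_ineq del: index_mult_mat_vec)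
    qed auto
    also have "\<dots> \<le> L2_set (\<lambda>i. cmod (vec_index (B *\<^sub>v v) i)) {..<N} + L2_set (\<lambda>i. cmod (vec_index ((A - B) *\<^sub>v v) i)) {..<N}"
      by (rule L2_set_triangle_ineq)
    also have "\<dots> = euclid_norm (B *\<^sub>v v) + euclid_norm ((A - B) *\<^sub>v v)"
      using B AB by (simp add: euclid_norm_def)
    also have "\<dots> \<le> op_norm B + entry_sum N (A - B)"
      by (intro add_mono euclid_norm_le_op_norm[OF B v] euclid_norm_mult_le[OF AB v])
    finally show "euclid_norm (A *\<^sub>v v) \<le> op_norm B + entry_sum N (A - B)" .
  qed
  have "entry_sum N (A - B) = entry_sum N (B - A)"
    unfolding entry_sum_def using assms by (intro sum.cong refl) (simp add: norm_minus_commute)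
  then show ?thesis using le[OF assms(1,2)] le[OF assms(2,1)] by linarith
qed

text \<open>For \<open>op_norm A = 0\<close> the convention 1 / 0 = 0 makes this the zero
  matrix.\<close>

definition normalize_mat :: "complex mat \<Rightarrow> complex mat" where
  "normalize_mat A = complex_of_real (1 / op_norm A) \<cdot>\<^sub>m A"

lemma normalize_mat_carrier [simp]: "A \<in> carrier_mat N M \<Longrightarrow> normalize_mat A \<in> carrier_mat N M"
  by (simp add: normalize_mat_def)

lemma normalize_mat_entry:
  "A \<in> carrier_mat N N \<Longrightarrow> i < N \<Longrightarrow> j < N \<Longrightarrow> normalize_mat A $$ (i, j) = A $$ (i, j) / complex_of_real (op_norm A)"
  by (simp add: normalize_mat_def)

lemma normalize_mat_smult:
  assumes "A \<in> carrier_mat N N" "N > 0" "c > 0"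
  shows "normalize_mat (complex_of_real c \<cdot>\<^sub>m A) = normalize_mat A"
  using assms by (intro eq_matI) (auto simp: normalize_mat_def op_norm_smult)

text \<open>With entries a, b and norms s, t, the difference a/s - b/t splits into (a - b)/s and b
  (1/s - 1/t), and in the second part the bound \<open>cmod b \<le> t\<close> cancels
  \<open>t\<close>. The estimate thus divides by \<open>op_norm A\<close> alone, for which the limit
  matrices provide a lower bound.\<close>

lemma normalize_mat_diff:
  assumes A: "A \<in> carrier_mat N N" and B: "B \<in> carrier_mat N N" and "i < N" "j < N" "op_norm A > 0"
  shows "cmod (normalize_mat A $$ (i, j) - normalize_mat B $$ (i, j)) \<le> 2 * entry_sum N (A - B) / op_norm A"
proof -
  define a b s t where "a = A $$ (i, j)" and "b = B $$ (i, j)" and "s = op_norm A" and "t = op_norm B"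
  define D where "D = entry_sum N (A - B)"
  have s: "s > 0" and N: "N > 0" using assms by (auto simp: s_def)
  have t: "t \<ge> 0" using op_norm_nonneg[OF B N] by (simp add: t_def)
  have b: "cmod b \<le> t" using entry_le_op_norm[OF B] assms by (simp add: b_def t_def)
  have ab: "cmod (a - b) \<le> D"
    using entry_le_entry_sum[of i N j "A - B"] assms by (simp add: a_def b_def D_def)
  have st: "\<bar>s - t\<bar> \<le> D" using op_norm_diff[OF A B N] by (simp add: s_def t_def D_def)
  have "cmod (b / complex_of_real s - b / complex_of_real t) \<le> D / s"
  proof (cases "t = 0")
    \<comment> \<open>Here \<open>b = 0\<close> as well, so both quotients vanish.\<close>
    case True
    then show ?thesis using b st s by simp
  next
    case False
    then have "b / complex_of_real s - b / complex_of_real t = b * complex_of_real (t - s) / complex_of_real (s * t)"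
      using s by (simp add: field_simps)
    then have "cmod (b / complex_of_real s - b / complex_of_real t) = cmod b * \<bar>t - s\<bar> / (s * t)"
      using s t by (simp add: norm_mult norm_divide del: of_real_diff of_real_mult)
    also have "\<dots> \<le> t * D / (s * t)"
      using b st s t by (intro divide_right_mono mult_mono) auto
    finally show ?thesis using False by simp
  qed
  moreover have "cmod (a / complex_of_real s - b / complex_of_real s) \<le> D / s"
    using ab s by (simp add: diff_divide_distrib[symmetric] norm_divide divide_right_mono)
  ultimately have "cmod (a / complex_of_real s - b / complex_of_real t) \<le> D / s + D / s"
    using norm_triangle_ineq[of "a / complex_of_real s - b / complex_of_real s" "b / complex_of_real s - b / complex_of_real t"]
    by simp
  then show ?thesis
    using assms by (simp add: normalize_mat_entry[of _ N] a_def b_def s_def t_def D_def)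
qed

section \<open>Asymptotics of the powers of a matrix\<close>

text \<open>Taking the \<open>e\<close>-th root of \<open>r\<close> reduces the claim to exponent
  1.\<close>

lemma power_times_geometric_null:
  fixes r :: real
  assumes "0 \<le> r" "r < 1"
  shows "(\<lambda>m. real m ^ e * r ^ m) \<longlonglongrightarrow> 0"
proof (cases "e = 0")
  case True
  then show ?thesis using LIMSEQ_realpow_zero[OF assms] by simp
next
  case False
  define \<rho> where "\<rho> = root e r"
  have rho: "0 \<le> \<rho>" "\<rho> < 1" "\<rho> ^ e = r"
    using assms False by (simp_all add: \<rho>_def)
  have "(\<lambda>m. real m * \<rho> ^ m) \<longlonglongrightarrow> 0"
    using powser_times_n_limit_0[of \<rho>] rho by simp
  then have "(\<lambda>m. (real m * \<rho> ^ m) ^ e) \<longlonglongrightarrow> 0 ^ e"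
    by (rule tendsto_power)
  moreover have "(real m * \<rho> ^ m) ^ e = real m ^ e * r ^ m" for m
    using rho(3) by (metis power_mult power_mult_distrib mult.commute)
  ultimately show ?thesis using False by (simp add: power_0_left)
qed

lemma choose_times_power_null:
  fixes a :: complex
  assumes "cmod a < 1"
  shows "(\<lambda>m. of_nat (m choose e) * a ^ (m - e)) \<longlonglongrightarrow> 0"
proof (rule LIMSEQ_offset[of _ e])
  show "(\<lambda>m. of_nat ((m + e) choose e) * a ^ (m + e - e)) \<longlonglongrightarrow> 0"
  proof (cases "a = 0")
    case True
    then show ?thesis
      by (intro tendsto_eventually) (auto simp: eventually_sequentially intro!: exI[of _ 1])
  next
    case False
    have "(\<lambda>m. real (m + e) ^ e * cmod a ^ (m + e) / cmod a ^ e) \<longlonglongrightarrow> 0 / cmod a ^ e"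
      using LIMSEQ_ignore_initial_segment[OF power_times_geometric_null[of "cmod a" e], of e] assms False
      by (intro tendsto_divide) auto
    then have lim: "(\<lambda>m. real (m + e) ^ e * cmod a ^ m) \<longlonglongrightarrow> 0"
      using False by (simp add: power_add)
    show ?thesis
    proof (rule Lim_null_comparison[OF always_eventually lim], rule allI)
      fix m
      have "real ((m + e) choose e) \<le> real (m + e) ^ e"
        using binomial_le_pow[of e "m + e"] by (metis le_add2 of_nat_le_iff of_nat_power)
      then show "norm (of_nat ((m + e) choose e) * a ^ (m + e - e)) \<le> real (m + e) ^ e * cmod a ^ m"
        by (simp add: norm_mult norm_power mult_right_mono)
    qed
  qed
qed

text \<open>Neighbouring binomials \<open>m choose k\<close> and \<open>m choose Suc k\<close> have
  the ratio (k + 1) / (m - k); the general quotient is a product of such null ratios.\<close>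

lemma choose_ratio_null:
  assumes "e < k"
  shows "(\<lambda>m. real (m choose e) / real (m choose k)) \<longlonglongrightarrow> 0"
  using assms
proof (induction k)
  case (Suc k)
  have step: "(\<lambda>m. real (m choose k) / real (m choose Suc k)) \<longlonglongrightarrow> 0"
  proof (rule LIMSEQ_offset[of _ "Suc k"])
    have "real ((m + Suc k) choose k) / real ((m + Suc k) choose Suc k) = real (Suc k) / real (Suc m)" for m
    proof -
      have "Suc k * ((m + Suc k) choose Suc k) = (m + Suc k - k) * ((m + Suc k) choose k)"
        by (metis binomial_absorption binomial_absorb_comp)
      then have "real (Suc k) * real ((m + Suc k) choose Suc k) = real (Suc m) * real ((m + Suc k) choose k)"
        by (metis Suc_diff_le add_Suc_right diff_add_inverse2 le_add2 of_nat_mult)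
      moreover have "real ((m + Suc k) choose Suc k) > 0" by (simp del: binomial_Suc_Suc)
      ultimately show ?thesis by (simp add: field_simps del: binomial_Suc_Suc of_nat_Suc)
    qed
    moreover have "(\<lambda>m. real (Suc k) / real (Suc m)) \<longlonglongrightarrow> 0"
      using tendsto_mult[OF tendsto_const[of "real (Suc k)"] LIMSEQ_inverse_real_of_nat]
      by (simp add: divide_inverse)
    ultimately show "(\<lambda>m. real ((m + Suc k) choose k) / real ((m + Suc k) choose Suc k)) \<longlonglongrightarrow> 0" by simp
  qed
  show ?case
  proof (cases "e = k")
    case True
    then show ?thesis using step by simp
  next
    case False
    then have "(\<lambda>m. real (m choose e) / real (m choose k)) \<longlonglongrightarrow> 0" using Suc by simp
    from tendsto_mult[OF this step]
    have lim: "(\<lambda>m. real (m choose e) / real (m choose k) * (real (m choose k) / real (m choose Suc k))) \<longlonglongrightarrow> 0"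
      by (simp only: mult_zero_left)
    \<comment> \<open>From \<open>m \<ge> k\<close> on the factor \<open>m choose k\<close> is
      nonzero and cancels.\<close>
    show ?thesis
      by (rule Lim_transform_eventually[OF lim eventually_sequentiallyI[of k]]) simp
  qed
qed simp

text \<open>The coefficient of \<open>b ^ m\<close> in the asymptotics of the entry \<open>(i, j)\<close> of the power of a Jordan block
  of size \<open>s\<close>, divided by \<open>m choose (K - 1)\<close>: only the corner of a block of maximal size survives.\<close>

definition corner_coeff :: "nat \<Rightarrow> nat \<Rightarrow> complex \<Rightarrow> nat \<Rightarrow> nat \<Rightarrow> complex \<Rightarrow> complex" where
  "corner_coeff K s a i j b = (if s = K \<and> i = 0 \<and> j = K - 1 \<and> b = a then inverse a ^ (K - 1) else 0)"

text \<open>On superdiagonal \<open>e\<close> the entry is (m choose e) a^(m - e). It decays for |a|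
  < 1; for |a| = 1 the binomial \<open>m choose (K - 1)\<close> dominates it unless
  \<open>e = K - 1\<close>, which happens only in the corner of a block of size \<open>K\<close>.
  There a^(m - K + 1) = a^m (1/a)^(K - 1) is the source of \<open>corner_coeff\<close>.\<close>

lemma jordan_block_asymptotics:
  assumes "i < s" "j < s" "cmod a \<le> 1" "cmod a = 1 \<Longrightarrow> s \<le> K"
    and "distinct ls" "cmod a = 1 \<Longrightarrow> s = K \<Longrightarrow> a \<in> set ls" "\<And>b. b \<in> set ls \<Longrightarrow> cmod b = 1"
  shows "(\<lambda>m. (jordan_block s a ^\<^sub>m m) $$ (i, j) / of_nat (m choose (K - 1))
    - (\<Sum>t<length ls. ls ! t ^ m * corner_coeff K s a i j (ls ! t))) \<longlonglongrightarrow> 0"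
proof -
  define k where "k = K - 1"
  define e where "e = j - i"
  have entry: "(jordan_block s a ^\<^sub>m m) $$ (i, j)
      = (if i \<le> j then of_nat (m choose e) * a ^ (m - e) else 0)" for m
    using assms(1,2) by (auto simp: jordan_block_pow e_def)
  show ?thesis
  proof (cases "cmod a = 1 \<and> s = K \<and> i = 0 \<and> j = K - 1")
    case True
    then obtain t0 where t0: "t0 < length ls" "ls ! t0 = a"
      using assms(6) by (auto simp: in_set_conv_nth)
    have a0: "a \<noteq> 0" using True by auto
    have "(\<Sum>t<length ls. ls ! t ^ m * corner_coeff K s a i j (ls ! t)) = a ^ m * inverse a ^ k" for m
    proof -
      have "(\<Sum>t<length ls. ls ! t ^ m * corner_coeff K s a i j (ls ! t))
          = (\<Sum>t<length ls. if t = t0 then a ^ m * inverse a ^ k else 0)"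
        using True t0 assms(5) by (intro sum.cong) (auto simp: corner_coeff_def k_def nth_eq_iff_index_eq)
      then show ?thesis using t0 by simp
    qed
    moreover have "(jordan_block s a ^\<^sub>m m) $$ (i, j) / of_nat (m choose (K - 1)) = a ^ m * inverse a ^ k" if "m \<ge> k" for m
    proof -
      have "a ^ m = a ^ (m - k) * a ^ k" using that by (simp add: power_add[symmetric])
      then show ?thesis
        unfolding entry using True that a0 by (simp add: e_def k_def power_inverse)
    qed
    ultimately show ?thesis
      by (intro tendsto_eventually eventually_sequentiallyI[of k]) simp
  next
    case False
    have "corner_coeff K s a i j (ls ! t) = 0" if "t < length ls" for t
      using False assms(7)[of "ls ! t"] that by (auto simp: corner_coeff_def)
    then have zero: "(\<Sum>t<length ls. ls ! t ^ m * corner_coeff K s a i j (ls ! t)) = 0" for m by simp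
    have "(\<lambda>m. of_nat (m choose e) * a ^ (m - e) / of_nat (m choose k)) \<longlonglongrightarrow> 0" if ij: "i \<le> j"
    proof (cases "cmod a = 1")
      case True
      \<comment> \<open>Equality would force \<open>s = K\<close>, \<open>i = 0\<close> and
        \<open>j = K - 1\<close>, the case already settled.\<close>
      have "e < k"
        using False True assms(1,2,4) ij by (auto simp: e_def k_def)
      from choose_ratio_null[OF this] show ?thesis
        by (rule Lim_null_comparison[rotated]) (auto simp: norm_mult norm_divide norm_power True)
    next
      case False
      then have "(\<lambda>m. of_nat (m choose e) * a ^ (m - e)) \<longlonglongrightarrow> 0"
        using assms(3) by (intro choose_times_power_null) simp
      then have "(\<lambda>m. cmod (of_nat (m choose e) * a ^ (m - e))) \<longlonglongrightarrow> 0"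
        by (rule tendsto_norm_zero)
      then show ?thesis
      proof (rule Lim_null_comparison[rotated], intro eventually_sequentiallyI[of k])
        fix m assume "m \<ge> k"
        then have "real (m choose k) \<ge> 1" by (simp add: Suc_le_eq)
        then show "norm (of_nat (m choose e) * a ^ (m - e) / of_nat (m choose k)) \<le> cmod (of_nat (m choose e) * a ^ (m - e))"
          by (simp add: norm_divide divide_le_eq mult_left_le mult_le_cancel_left1)
      qed
    qed
    then show ?thesis
      unfolding zero entry k_def[symmetric] by (cases "i \<le> j") simp_all
  qed
qed

section \<open>Families of block-diagonal matrices with common block sizes\<close>

lemma diag_block_family_dim:
  assumes "\<And>x m. x \<in> set xs \<Longrightarrow> f x m \<in> carrier_mat (d x) (d x)"
  shows "diag_block_mat (map (\<lambda>x. f x m) xs) \<in> carrier_mat (sum_list (map d xs)) (sum_list (map d xs))"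
  using assms
proof (induction xs)
  case (Cons x xs)
  then have "f x m \<in> carrier_mat (d x) (d x)"
    "diag_block_mat (map (\<lambda>x. f x m) xs) \<in> carrier_mat (sum_list (map d xs)) (sum_list (map d xs))" by auto
  then show ?case by (auto simp: Let_def)
qed auto

text \<open>The block and the position in it are chosen before \<open>m\<close>: as the sizes
  \<open>d x\<close> do not depend on \<open>m\<close>, a position of the large matrix follows one
  block entry through the whole family, and limits can be taken blockwise.\<close>

lemma diag_block_family_entry:
  assumes "\<And>x m. x \<in> set xs \<Longrightarrow> f x m \<in> carrier_mat (d x) (d x)"
    and "p < sum_list (map d xs)" "q < sum_list (map d xs)"
  shows "(\<forall>m. diag_block_mat (map (\<lambda>x. f x m) xs) $$ (p, q) = 0) \<or>
    (\<exists>x\<in>set xs. \<exists>i<d x. \<exists>j<d x. \<forall>m. diag_block_mat (map (\<lambda>x. f x m) xs) $$ (p, q) = f x m $$ (i, j))"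
  using assms
proof (induction xs arbitrary: p q)
  case (Cons x xs)
  have fx: "dim_row (f x m) = d x" "dim_col (f x m) = d x" for m
    using Cons.prems(1)[of x m] by auto
  have dm: "dim_row (diag_block_mat (map (\<lambda>x. f x m) xs)) = sum_list (map d xs)"
    "dim_col (diag_block_mat (map (\<lambda>x. f x m) xs)) = sum_list (map d xs)" for m
    using diag_block_family_dim[of xs f d m] Cons.prems(1) by auto
  have entry: "diag_block_mat (map (\<lambda>x. f x m) (x # xs)) $$ (p, q) =
      (if p < d x then if q < d x then f x m $$ (p, q) else 0
       else if q < d x then 0 else diag_block_mat (map (\<lambda>x. f x m) xs) $$ (p - d x, q - d x))" for m
    using Cons.prems(2,3) by (simp add: Let_def fx dm)
  show ?case
  proof (cases "p < d x")
    case True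
    then show ?thesis unfolding entry by (cases "q < d x") auto
  next
    case p: False
    show ?thesis
    proof (cases "q < d x")
      case True
      then show ?thesis unfolding entry using p by auto
    next
      case False
      have "p - d x < sum_list (map d xs)" "q - d x < sum_list (map d xs)"
        using Cons.prems(2,3) p False by auto
      from Cons.IH[OF Cons.prems(1) this] show ?thesis
        unfolding entry using p False by auto
    qed
  qed
qed simp

lemma diag_block_family_entry_exists:
  assumes "\<And>x m. x \<in> set xs \<Longrightarrow> f x m \<in> carrier_mat (d x) (d x)"
    and "x \<in> set xs" "i < d x" "j < d x"
  shows "\<exists>p<sum_list (map d xs). \<exists>q<sum_list (map d xs).
    \<forall>m. diag_block_mat (map (\<lambda>x. f x m) xs) $$ (p, q) = f x m $$ (i, j)"
  using assms
proof (induction xs)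
  case (Cons y xs)
  have fy: "dim_row (f y m) = d y" "dim_col (f y m) = d y" for m
    using Cons.prems(1)[of y m] by auto
  have dm: "dim_row (diag_block_mat (map (\<lambda>x. f x m) xs)) = sum_list (map d xs)"
    "dim_col (diag_block_mat (map (\<lambda>x. f x m) xs)) = sum_list (map d xs)" for m
    using diag_block_family_dim[of xs f d m] Cons.prems(1) by auto
  show ?case
  proof (cases "x = y")
    case True
    then show ?thesis
      using Cons.prems(3,4) by (intro exI[of _ i] exI[of _ j] conjI) (auto simp: Let_def fy dm)
  next
    case False
    then obtain p q where "p < sum_list (map d xs)" "q < sum_list (map d xs)"
      "\<And>m. diag_block_mat (map (\<lambda>x. f x m) xs) $$ (p, q) = f x m $$ (i, j)"
      using Cons by auto
    then show ?thesis
      by (intro exI[of _ "p + d y"] exI[of _ "q + d y"] conjI) (auto simp: Let_def fy dm)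
  qed
qed simp

section \<open>Jordan form, maximal spectrum and asymptotics of powers\<close>

lemma spectrum_jordan_nf:
  fixes T :: "complex mat"
  assumes "T \<in> carrier_mat N N" "jordan_nf T n_as"
  shows "spectrum T = snd ` set n_as"
proof -
  have "poly (\<Prod>(n, a)\<leftarrow>xs. [:- a, 1:] ^ n) z = 0 \<longleftrightarrow> z \<in> snd ` set xs"
    if "0 \<notin> fst ` set xs" for xs :: "(nat \<times> complex) list" and z
    using that by (induction xs) auto
  then show ?thesis
    using assms(2) jordan_nf_char_poly[OF assms(2)] spectrum_root_char_poly[OF assms(1)]
    by (auto simp: jordan_nf_def)
qed

lemma degeneracy_index_jordan_nf:
  assumes "jordan_nf T n_as"
  shows "degeneracy_index T z = Max {k. (k, z) \<in> set n_as}"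
  unfolding degeneracy_index_def using jordan_nf_unique[OF assms] assms by metis

text \<open>The spectral radius is attained, so some block has its eigenvalue on the unit circle;
  \<open>K\<close> is the largest size of such a block and is the degeneracy index of every element
  of the maximal spectrum.\<close>

lemma maximal_spectrum_jordan_nf:
  assumes T: "T \<in> carrier_mat N N" "N > 0" "spectral_radius T = 1" and jnf: "jordan_nf T n_as"
  obtains K where "K > 0" "maximal_spectrum T = {a. (K, a) \<in> set n_as \<and> cmod a = 1}"
    "maximal_spectrum T \<noteq> {}" "\<And>s a. (s, a) \<in> set n_as \<Longrightarrow> cmod a = 1 \<Longrightarrow> s \<le> K"
    "\<And>s a. (s, a) \<in> set n_as \<Longrightarrow> cmod a \<le> 1"
proof -
  note spec = spectrum_jordan_nf[OF T(1) jnf]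
  note deg = degeneracy_index_jordan_nf[OF jnf]
  define S where "S = {s. \<exists>a. (s, a) \<in> set n_as \<and> cmod a = 1}"
  define K where "K = Max S"
  have "S \<subseteq> fst ` set n_as" by (force simp: S_def)
  then have finS: "finite S" by (rule finite_subset) simp
  have "1 \<in> cmod ` spectrum T" using spectral_radius_mem_max(1)[OF T(1,2)] T(3) by simp
  then have Sne: "S \<noteq> {}" unfolding spec S_def by force
  have KS: "K \<in> S" unfolding K_def using finS Sne by simp
  have K: "s \<le> K" if "(s, a) \<in> set n_as" "cmod a = 1" for s a
    unfolding K_def using finS that by (intro Max_ge) (auto simp: S_def)
  have finz: "finite {k. (k, z) \<in> set n_as}" for z
  proof -
    have "{k. (k, z) \<in> set n_as} \<subseteq> fst ` set n_as" by force
    then show ?thesis by (rule finite_subset) simp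
  qed
  have degK: "degeneracy_index T z = K" if "(K, z) \<in> set n_as" "cmod z = 1" for z
    unfolding deg using that K finz by (intro Max_eqI) auto
  have degle: "degeneracy_index T z \<in> {k. (k, z) \<in> set n_as}" if "z \<in> spectrum T" for z
    unfolding deg using that finz by (intro Max_in) (auto simp: spec)
  obtain z0 where z0: "(K, z0) \<in> set n_as" "cmod z0 = 1" using KS by (auto simp: S_def)
  have ms: "maximal_spectrum T = {a. (K, a) \<in> set n_as \<and> cmod a = 1}"
  proof (rule equalityI; rule subsetI)
    fix z assume z: "z \<in> maximal_spectrum T"
    have "z0 \<in> spectrum T" unfolding spec using z0 by force
    then have "K \<le> degeneracy_index T z"
      using z z0 degK[OF z0] by (auto simp: maximal_spectrum_def T(3))
    moreover have "(degeneracy_index T z, z) \<in> set n_as" "cmod z = 1"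
      using z degle by (auto simp: maximal_spectrum_def T(3))
    ultimately show "z \<in> {a. (K, a) \<in> set n_as \<and> cmod a = 1}"
      using K[of "degeneracy_index T z" z] by simp
  next
    fix z assume z: "z \<in> {a. (K, a) \<in> set n_as \<and> cmod a = 1}"
    have "degeneracy_index T w \<le> K" if "w \<in> spectrum T" "cmod w = 1" for w
      using degle[OF that(1)] K that(2) by blast
    moreover have "z \<in> spectrum T" unfolding spec using z by force
    ultimately show "z \<in> maximal_spectrum T"
      using z degK[of z] by (auto simp: maximal_spectrum_def T(3))
  qed
  show ?thesis
  proof (rule that[of K])
    show "K > 0" using jnf z0 by (force simp: jordan_nf_def)
    show "maximal_spectrum T \<noteq> {}" using z0 by (auto simp: ms)
    show "cmod a \<le> 1" if "(s, a) \<in> set n_as" for s a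
      using spectral_radius_mem_max(2)[OF T(1,2), of "cmod a"] that T(3) by (force simp: spec)
  qed (use ms K in auto)
qed


lemma maximal_spectrum_unimodular:
  assumes "T \<in> carrier_mat N N" "N > 0" "spectral_radius T = 1" "set ls = maximal_spectrum T"
  shows "unimodular_list ls"
  using assms by unfold_locales (auto simp: maximal_spectrum_def dest!: nth_mem)

text \<open>The limit is taken blockwise and conjugated by \<open>S\<close> and \<open>R\<close>.
  For the lower bound the conjugation is undone: at the corner \<open>(p0, q0)\<close> of a block of
  size \<open>K\<close> only the index \<open>t0\<close> of its eigenvalue contributes, with modulus
  1, which is impossible if all entries of the sum are small.\<close>

lemma power_asymptotics:
  fixes T :: "complex mat"
  assumes T: "T \<in> carrier_mat N N" "N > 0" "spectral_radius T = 1"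
    and ls: "distinct ls" "set ls = maximal_spectrum T"
  obtains k P c where "c > 0"
    "\<And>u v. u < N \<Longrightarrow> v < N \<Longrightarrow>
      (\<lambda>m. (T ^\<^sub>m m) $$ (u, v) / of_nat (m choose k) - (\<Sum>t<length ls. ls ! t ^ m * P t u v)) \<longlonglongrightarrow> 0"
    "\<And>x. x \<in> torus_set (length ls) \<Longrightarrow> \<exists>u<N. \<exists>v<N. c \<le> cmod (\<Sum>t<length ls. x t * P t u v)"
proof -
  interpret unimodular_list ls using maximal_spectrum_unimodular[OF T ls(2)] .
  obtain as where "char_poly T = (\<Prod>a\<leftarrow>as. [:- a, 1:])" using char_poly_factorized[OF T(1)] by blast
  then obtain n_as where jnf: "jordan_nf T n_as" using jordan_nf_exists[OF T(1)] by blast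
  obtain K where K: "K > 0" "maximal_spectrum T = {a. (K, a) \<in> set n_as \<and> cmod a = 1}"
    "maximal_spectrum T \<noteq> {}" "\<And>s a. (s, a) \<in> set n_as \<Longrightarrow> cmod a = 1 \<Longrightarrow> s \<le> K"
    "\<And>s a. (s, a) \<in> set n_as \<Longrightarrow> cmod a \<le> 1"
    by (rule maximal_spectrum_jordan_nf[OF T jnf]) (rule that)
  obtain S R where wit: "similar_mat_wit T (jordan_matrix n_as) S R"
    using jnf unfolding jordan_nf_def similar_mat_def by blast
  note SR = similar_mat_witD2[OF T(1) wit]
  have N: "sum_list (map fst n_as) = N" using SR(5) by (metis carrier_matD(1) jordan_matrix_dim(1))
  text \<open>One family of block-diagonal matrices holds both the powers (left summand) and the
    coefficients of their asymptotics (right summand), so that both have the same block positions.\<close>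
  define f :: "nat \<times> complex \<Rightarrow> nat + nat \<Rightarrow> complex mat" where
    "f = (\<lambda>(s, a) y. case y of Inl m \<Rightarrow> jordan_block s a ^\<^sub>m m
       | Inr t \<Rightarrow> Matrix.mat s s (\<lambda>(i, j). corner_coeff K s a i j (ls ! t)))"
  define D where "D = (\<lambda>y. diag_block_mat (map (\<lambda>x. f x y) n_as))"
  have f_car: "f x y \<in> carrier_mat (fst x) (fst x)" for x y
    by (cases x; cases y) (auto simp: f_def)
  have D_car: "D y \<in> carrier_mat N N" for y
    using diag_block_family_dim[of n_as f fst y] f_car N by (simp add: D_def)
  have DInl: "D (Inl m) = jordan_matrix n_as ^\<^sub>m m" for m
    by (simp add: D_def f_def jordan_matrix_pow case_prod_unfold)
  define Q where "Q = (\<lambda>t p q. D (Inr t) $$ (p, q))"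
  have limQ: "(\<lambda>m. D (Inl m) $$ (p, q) / of_nat (m choose (K - 1)) - (\<Sum>t<length ls. ls ! t ^ m * Q t p q)) \<longlonglongrightarrow> 0"
    if pq: "p < N" "q < N" for p q
    using diag_block_family_entry[of n_as f fst p q, OF f_car, unfolded N, OF pq]
  proof
    assume "\<forall>y. diag_block_mat (map (\<lambda>x. f x y) n_as) $$ (p, q) = 0"
    then show ?thesis by (simp add: Q_def D_def)
  next
    assume "\<exists>x\<in>set n_as. \<exists>i<fst x. \<exists>j<fst x. \<forall>y. diag_block_mat (map (\<lambda>x. f x y) n_as) $$ (p, q) = f x y $$ (i, j)"
    then obtain s a i j where x: "(s, a) \<in> set n_as" "i < s" "j < s"
      "\<And>y. D y $$ (p, q) = f (s, a) y $$ (i, j)" by (fastforce simp: D_def)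
    have "(\<lambda>m. (jordan_block s a ^\<^sub>m m) $$ (i, j) / of_nat (m choose (K - 1))
        - (\<Sum>t<length ls. ls ! t ^ m * corner_coeff K s a i j (ls ! t))) \<longlonglongrightarrow> 0"
      using x K ls unimodular by (intro jordan_block_asymptotics) (auto simp: in_set_conv_nth)
    then show ?thesis using x(2,3) by (simp add: Q_def x(4) f_def)
  qed
  define P where "P = (\<lambda>t u v. \<Sum>p<N. \<Sum>q<N. S $$ (u, p) * Q t p q * R $$ (q, v))"
  have lim: "(\<lambda>m. (T ^\<^sub>m m) $$ (u, v) / of_nat (m choose (K - 1)) - (\<Sum>t<length ls. ls ! t ^ m * P t u v)) \<longlonglongrightarrow> 0"
    if uv: "u < N" "v < N" for u v
  proof -
    have "(T ^\<^sub>m m) $$ (u, v) / of_nat (m choose (K - 1)) - (\<Sum>t<length ls. ls ! t ^ m * P t u v)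
        = (\<Sum>p<N. \<Sum>q<N. S $$ (u, p) * (D (Inl m) $$ (p, q) / of_nat (m choose (K - 1)) - (\<Sum>t<length ls. ls ! t ^ m * Q t p q)) * R $$ (q, v))" for m
    proof -
      have "(T ^\<^sub>m m) $$ (u, v) = (\<Sum>p<N. \<Sum>q<N. S $$ (u, p) * D (Inl m) $$ (p, q) * R $$ (q, v))"
        unfolding similar_mat_wit_pow_id[OF wit] DInl[symmetric]
        using SR D_car uv by (intro triple_mult_entry) auto
      moreover have "(\<Sum>t<length ls. ls ! t ^ m * P t u v)
          = (\<Sum>p<N. \<Sum>q<N. S $$ (u, p) * (\<Sum>t<length ls. ls ! t ^ m * Q t p q) * R $$ (q, v))"
      proof -
        have "(\<Sum>t<length ls. ls ! t ^ m * P t u v)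
          = (\<Sum>t<length ls. \<Sum>p<N. \<Sum>q<N. S $$ (u, p) * (ls ! t ^ m * Q t p q) * R $$ (q, v))"
          unfolding P_def sum_distrib_left by (intro sum.cong refl) (simp only: ac_simps)
        also have "\<dots> = (\<Sum>p<N. \<Sum>t<length ls. \<Sum>q<N. S $$ (u, p) * (ls ! t ^ m * Q t p q) * R $$ (q, v))"
          by (rule sum.swap)
        also have "\<dots> = (\<Sum>p<N. \<Sum>q<N. \<Sum>t<length ls. S $$ (u, p) * (ls ! t ^ m * Q t p q) * R $$ (q, v))"
          by (intro sum.cong refl sum.swap)
        finally show ?thesis by (simp add: sum_distrib_left sum_distrib_right)
      qed
      ultimately show ?thesis
        by (simp add: sum_divide_distrib sum_subtractf right_diff_distrib left_diff_distrib)
    qed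
    moreover have "(\<lambda>m. \<Sum>p<N. \<Sum>q<N. S $$ (u, p) * (D (Inl m) $$ (p, q) / of_nat (m choose (K - 1)) - (\<Sum>t<length ls. ls ! t ^ m * Q t p q)) * R $$ (q, v)) \<longlonglongrightarrow> 0"
      by (intro tendsto_null_sum tendsto_mult_left_zero tendsto_mult_right_zero limQ) auto
    ultimately show ?thesis by simp
  qed
  obtain a where a: "(K, a) \<in> set n_as" "cmod a = 1" using K(2,3) by blast
  then obtain t0 where t0: "t0 < length ls" "ls ! t0 = a"
    using K(2) ls(2) by (metis (mono_tags, lifting) in_set_conv_nth mem_Collect_eq)
  obtain p0 q0 where pq0: "p0 < N" "q0 < N" "\<And>y. D y $$ (p0, q0) = f (K, a) y $$ (0, K - 1)"
    using diag_block_family_entry_exists[of n_as f fst "(K, a)" 0 "K - 1", OF f_car a(1)] K(1) N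
    by (auto simp: D_def)
  have Q0: "Q t p0 q0 = (if t = t0 then inverse a ^ (K - 1) else 0)" if "t < length ls" for t
    using that t0 K(1) ls(1) by (auto simp: Q_def pq0 f_def corner_coeff_def nth_eq_iff_index_eq)
  \<comment> \<open>Bounds the effect of undoing the similarity on the entry
    \<open>(p0, q0)\<close>: entries of modulus at most \<open>1 / (W + 1)\<close> would produce
    there at most \<open>W / (W + 1) < 1\<close>.\<close>
  define W where "W = (\<Sum>u<N. \<Sum>v<N. cmod (R $$ (p0, u)) * cmod (S $$ (v, q0)))"
  have W: "W \<ge> 0" unfolding W_def by (intro sum_nonneg) auto
  have lower: "\<exists>u<N. \<exists>v<N. 1 / (W + 1) \<le> cmod (\<Sum>t<length ls. x t * P t u v)"
    if x: "x \<in> torus_set (length ls)" for x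
  proof (rule ccontr)
    assume "\<not> (\<exists>u<N. \<exists>v<N. 1 / (W + 1) \<le> cmod (\<Sum>t<length ls. x t * P t u v))"
    then have small: "cmod (\<Sum>t<length ls. x t * P t u v) \<le> 1 / (W + 1)" if "u < N" "v < N" for u v
      using that by (metis less_eq_real_def linorder_not_le)
    \<comment> \<open>Undoes the similarity, as \<open>R * S\<close> is the identity.\<close>
    have conj: "(\<Sum>u<N. \<Sum>v<N. R $$ (p0, u) * P t u v * S $$ (v, q0)) = Q t p0 q0" for t
    proof -
      define M where "M = S * D (Inr t) * R"
      have M: "M \<in> carrier_mat N N" using SR D_car unfolding M_def by auto
      have "R * M * S = (R * S) * D (Inr t) * (R * S)"
        using SR(6,7) D_car[of "Inr t"] unfolding M_def by (simp add: assoc_mult_mat[of _ N N _ N _ N])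
      then have "R * M * S = D (Inr t)" using SR(2) D_car[of "Inr t"] by simp
      then have "Q t p0 q0 = (\<Sum>u<N. \<Sum>v<N. R $$ (p0, u) * M $$ (u, v) * S $$ (v, q0))"
        using triple_mult_entry[OF SR(7) M SR(6) pq0(1,2)] by (simp add: Q_def)
      also have "\<dots> = (\<Sum>u<N. \<Sum>v<N. R $$ (p0, u) * P t u v * S $$ (v, q0))"
        unfolding M_def P_def Q_def using SR D_car
        by (intro sum.cong refl arg_cong2[of _ _ _ _ "(*)"] triple_mult_entry) auto
      finally show ?thesis by simp
    qed
    have "x t0 * inverse a ^ (K - 1) = (\<Sum>t<length ls. x t * Q t p0 q0)"
    proof -
      have "(\<Sum>t<length ls. x t * Q t p0 q0) = (\<Sum>t<length ls. if t = t0 then x t0 * inverse a ^ (K - 1) else 0)"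
        using Q0 by (intro sum.cong) auto
      then show ?thesis using t0 by simp
    qed
    also have "\<dots> = (\<Sum>t<length ls. \<Sum>u<N. \<Sum>v<N. R $$ (p0, u) * (x t * P t u v) * S $$ (v, q0))"
      unfolding conj[symmetric] sum_distrib_left by (intro sum.cong refl) (simp only: ac_simps)
    also have "\<dots> = (\<Sum>u<N. \<Sum>t<length ls. \<Sum>v<N. R $$ (p0, u) * (x t * P t u v) * S $$ (v, q0))"
      by (rule sum.swap)
    also have "\<dots> = (\<Sum>u<N. \<Sum>v<N. \<Sum>t<length ls. R $$ (p0, u) * (x t * P t u v) * S $$ (v, q0))"
      by (intro sum.cong refl sum.swap)
    also have "\<dots> = (\<Sum>u<N. \<Sum>v<N. R $$ (p0, u) * (\<Sum>t<length ls. x t * P t u v) * S $$ (v, q0))"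
      by (simp add: sum_distrib_left sum_distrib_right)
    also have "cmod \<dots> \<le> (\<Sum>u<N. \<Sum>v<N. cmod (R $$ (p0, u)) * cmod (S $$ (v, q0)) * (1 / (W + 1)))"
    proof (intro sum_norm_le)
      fix u v assume "u \<in> {..<N}" "v \<in> {..<N}"
      then have "cmod (R $$ (p0, u)) * cmod (\<Sum>t<length ls. x t * P t u v) * cmod (S $$ (v, q0))
          \<le> cmod (R $$ (p0, u)) * (1 / (W + 1)) * cmod (S $$ (v, q0))"
        using small by (intro mult_right_mono mult_left_mono) auto
      then show "cmod (R $$ (p0, u) * (\<Sum>t<length ls. x t * P t u v) * S $$ (v, q0))
          \<le> cmod (R $$ (p0, u)) * cmod (S $$ (v, q0)) * (1 / (W + 1))"
        by (simp add: norm_mult mult.commute mult.left_commute)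
    qed
    also have "\<dots> = W * (1 / (W + 1))" by (simp only: W_def sum_distrib_right)
    also have "\<dots> < 1" using W by (simp add: field_simps)
    finally show False
      using torus_setD[OF x t0(1)] a(2) by (simp add: norm_mult norm_power norm_inverse)
  qed
  show ?thesis by (rule that[OF _ lim lower]) (use W in auto)
qed

section \<open>The Choi form, spans and ideals\<close>

lemma sum_lessThan_mult:
  fixes f :: "nat \<Rightarrow> 'a::comm_monoid_add"
  shows "(\<Sum>r<m * n. f r) = (\<Sum>p<m. \<Sum>q<n. f (p * n + q))"
proof (induction m)
  case (Suc m)
  have "(\<Sum>r<Suc m * n. f r) = (\<Sum>r<m * n. f r) + (\<Sum>r=m * n..<m * n + n. f r)"
    by (simp add: lessThan_atLeast0 sum.atLeastLessThan_concat add.commute)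
  also have "(\<Sum>r=m * n..<m * n + n. f r) = (\<Sum>q<n. f (m * n + q))"
    using sum.shift_bounds_nat_ivl[of f 0 "m * n" n] by (simp add: lessThan_atLeast0 add.commute)
  finally show ?case using Suc by simp
qed simp

abbreviation index_pairs :: "nat \<Rightarrow> (nat \<times> nat) set" where
  "index_pairs n \<equiv> {..<n} \<times> {..<n}"

text \<open>The Choi reshuffling: it turns \<open>cnj A \<otimes> A\<close> into the rank-one kernel \<open>cnj (A a) A b\<close>.\<close>

definition choi :: "nat \<Rightarrow> complex mat \<Rightarrow> nat \<times> nat \<Rightarrow> nat \<times> nat \<Rightarrow> complex" where
  "choi n M a b = M $$ (fst a * n + fst b, snd a * n + snd b)"

definition choi_form :: "nat \<Rightarrow> complex mat \<Rightarrow> (nat \<times> nat \<Rightarrow> complex) \<Rightarrow> complex" where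
  "choi_form n M v = (\<Sum>a\<in>index_pairs n. \<Sum>b\<in>index_pairs n. cnj (v a) * v b * choi n M a b)"

text \<open>The general linear functional on matrices, without conjugation, so that it fits
  \<open>double_annihilator\<close>; the Choi form of a Kraus sum is the sum of its squared moduli
  on the Kraus matrices.\<close>

definition pairing :: "nat \<Rightarrow> (nat \<times> nat \<Rightarrow> complex) \<Rightarrow> complex mat \<Rightarrow> complex" where
  "pairing n v A = (\<Sum>a\<in>index_pairs n. v a * A $$ a)"

lemma pair_index_less: "i < n \<Longrightarrow> k < n \<Longrightarrow> i * n + k < n * (n::nat)"
proof -
  assume "i < n" "k < n"
  then have "i * n + k < Suc i * n" "Suc i * n \<le> n * n"
    by (simp, intro mult_le_mono) auto
  then show ?thesis by linarith
qed

lemma mat_eq_choi: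
  assumes "M \<in> carrier_mat (n * n) (n * n)" "M' \<in> carrier_mat (n * n) (n * n)"
    and "\<And>a b. a \<in> index_pairs n \<Longrightarrow> b \<in> index_pairs n \<Longrightarrow> choi n M a b = choi n M' a b"
  shows "M = M'"
proof (rule eq_matI)
  fix r s assume "r < dim_row M'" "s < dim_col M'"
  then have rs: "r < n * n" "s < n * n" using assms by auto
  then have n: "n > 0" by (cases n) auto
  have "r div n < n" "s div n < n" using rs by (simp_all add: less_mult_imp_div_less)
  then have "choi n M (r div n, s div n) (r mod n, s mod n) = choi n M' (r div n, s div n) (r mod n, s mod n)"
    using n by (intro assms(3)) auto
  then show "M $$ (r, s) = M' $$ (r, s)" by (simp add: choi_def)
qed (use assms in auto)

lemma kraus_sum_carrier [simp]: "kraus_sum n d X \<in> carrier_mat (n * n) (n * n)"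
  by (simp add: kraus_sum_def mat_sum_def)

lemma choi_kraus_sum:
  assumes "\<And>h. h < d \<Longrightarrow> X h \<in> carrier_mat n n" "a \<in> index_pairs n" "b \<in> index_pairs n"
  shows "choi n (kraus_sum n d X) a b = (\<Sum>h<d. cnj (X h $$ a) * X h $$ b)"
proof -
  obtain i j k l where ab: "a = (i, j)" "b = (k, l)" by (cases a; cases b) auto
  then have lt: "i < n" "j < n" "k < n" "l < n" using assms by auto
  have "kronecker (mat_conj (X h)) (X h) $$ (i * n + k, j * n + l) = cnj (X h $$ (i, j)) * X h $$ (k, l)"
    if "h < d" for h
    using assms(1)[OF that] lt pair_index_less[of i n k] pair_index_less[of j n l]
    by (simp add: kronecker_def mat_conj_def)
  then show ?thesis
    using lt pair_index_less[of i n k] pair_index_less[of j n l]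
    by (simp add: ab choi_def kraus_sum_def mat_sum_def)
qed

lemma choi_form_kraus_sum:
  assumes "\<And>h. h < d \<Longrightarrow> X h \<in> carrier_mat n n"
  shows "choi_form n (kraus_sum n d X) v = complex_of_real (\<Sum>h<d. (cmod (pairing n v (X h)))\<^sup>2)"
proof -
  have "choi_form n (kraus_sum n d X) v
      = (\<Sum>a\<in>index_pairs n. \<Sum>b\<in>index_pairs n. \<Sum>h<d. (cnj (v a) * cnj (X h $$ a)) * (v b * X h $$ b))"
    unfolding choi_form_def
    by (intro sum.cong refl) (simp only: choi_kraus_sum[OF assms] sum_distrib_left ac_simps)
  also have "\<dots> = (\<Sum>a\<in>index_pairs n. \<Sum>h<d. \<Sum>b\<in>index_pairs n. (cnj (v a) * cnj (X h $$ a)) * (v b * X h $$ b))"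
    by (intro sum.cong refl sum.swap)
  also have "\<dots> = (\<Sum>h<d. \<Sum>a\<in>index_pairs n. \<Sum>b\<in>index_pairs n. (cnj (v a) * cnj (X h $$ a)) * (v b * X h $$ b))"
    by (rule sum.swap)
  also have "\<dots> = (\<Sum>h<d. cnj (pairing n v (X h)) * pairing n v (X h))"
    by (simp add: pairing_def sum_product)
  also have "\<dots> = (\<Sum>h<d. complex_of_real ((cmod (pairing n v (X h)))\<^sup>2))"
    by (intro sum.cong refl) (simp only: complex_norm_square mult.commute)
  finally show ?thesis by simp
qed

text \<open>The number of terms is the number of index pairs, whatever the rank of the kernel; this
  is what makes \<open>a\<close> independent of \<lambda>.\<close>

lemma kraus_decomposition:
  assumes M: "M \<in> carrier_mat (n * n) (n * n)"
    and psd: "\<And>v. \<exists>r\<ge>0. choi_form n M v = complex_of_real r"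
  obtains B where "\<And>h. h < n * n \<Longrightarrow> B h \<in> carrier_mat n n" "M = kraus_sum n (n * n) B"
proof -
  have psd_on: "psd_on (index_pairs n) (choi n M)"
    unfolding psd_on_def
  proof
    fix v
    \<comment> \<open>\<open>psd_on\<close> conjugates the second argument and
      \<open>choi_form\<close> the first, hence the conjugated test vector.\<close>
    show "\<exists>r\<ge>0. (\<Sum>a\<in>index_pairs n. \<Sum>b\<in>index_pairs n. v a * cnj (v b) * choi n M a b) = complex_of_real r"
      using psd[of "\<lambda>a. cnj (v a)"] by (simp add: choi_form_def)
  qed
  have fin: "finite (index_pairs n)" by simp
  from psd_on_decomposition[OF fin psd_on]
  obtain w where w0: "\<forall>a\<in>index_pairs n. \<forall>b\<in>index_pairs n.
      choi n M a b = (\<Sum>h<card (index_pairs n). cnj (w h a) * w h b)" ..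
  have w: "choi n M a b = (\<Sum>h<n * n. cnj (w h a) * w h b)"
    if "a \<in> index_pairs n" "b \<in> index_pairs n" for a b
    using bspec[OF bspec[OF w0 that(1)] that(2)] unfolding card_cartesian_product card_lessThan .
  define B where "B = (\<lambda>h. Matrix.mat n n (w h))"
  have B: "\<And>h. B h \<in> carrier_mat n n" by (simp add: B_def)
  have "M = kraus_sum n (n * n) B"
  proof (rule mat_eq_choi[OF M])
    fix a b assume ab: "a \<in> index_pairs n" "b \<in> index_pairs n"
    then show "choi n M a b = choi n (kraus_sum n (n * n) B) a b"
      using w[OF ab] by (subst choi_kraus_sum) (auto simp: B_def)
  qed simp
  with B show ?thesis by (rule that)
qed

text \<open>The mixed-product rule of the Kronecker product, as conjugation is multiplicative; the
  pair of summation indices \<open>(g, h)\<close> is coded as \<open>g * b + h\<close>.\<close>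

lemma kraus_sum_mult:
  assumes A: "\<And>h. h < a \<Longrightarrow> A h \<in> carrier_mat n n" and B: "\<And>h. h < b \<Longrightarrow> B h \<in> carrier_mat n n"
  shows "kraus_sum n a A * kraus_sum n b B = kraus_sum n (a * b) (\<lambda>h. A (h div b) * B (h mod b))"
proof (rule mat_eq_choi)
  show "kraus_sum n a A * kraus_sum n b B \<in> carrier_mat (n * n) (n * n)"
    by (rule mult_carrier_mat) (rule kraus_sum_carrier)+
  fix x y assume xy: "x \<in> index_pairs n" "y \<in> index_pairs n"
  obtain i j k l where ij: "x = (i, j)" "y = (k, l)" by (cases x; cases y) auto
  have lt: "i < n" "j < n" "k < n" "l < n" using xy ij by auto
  have "choi n (kraus_sum n a A * kraus_sum n b B) x y
      = (\<Sum>p<n. \<Sum>q<n. choi n (kraus_sum n a A) (i, p) (k, q) * choi n (kraus_sum n b B) (p, j) (q, l))"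
    using mult_entry[OF kraus_sum_carrier kraus_sum_carrier, of "i * n + k" n "j * n + l" a A b B]
      pair_index_less[of i n k] pair_index_less[of j n l] lt
    by (simp add: ij choi_def sum_lessThan_mult)
  also have "\<dots> = (\<Sum>p<n. \<Sum>q<n. (\<Sum>g<a. cnj (A g $$ (i, p)) * A g $$ (k, q)) * (\<Sum>h<b. cnj (B h $$ (p, j)) * B h $$ (q, l)))"
    using A B lt by (intro sum.cong refl arg_cong2[of _ _ _ _ "(*)"] choi_kraus_sum) auto
  also have "\<dots> = (\<Sum>p<n. \<Sum>q<n. \<Sum>g<a. \<Sum>h<b. (cnj (A g $$ (i, p)) * cnj (B h $$ (p, j))) * (A g $$ (k, q) * B h $$ (q, l)))"
    unfolding sum_product by (intro sum.cong refl) (simp only: ac_simps)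
  also have "\<dots> = (\<Sum>g<a. \<Sum>h<b. \<Sum>p<n. \<Sum>q<n. (cnj (A g $$ (i, p)) * cnj (B h $$ (p, j))) * (A g $$ (k, q) * B h $$ (q, l)))"
  proof -
    have swap4: "(\<Sum>p<n. \<Sum>q<n. \<Sum>g<a. \<Sum>h<b. f p q g h) = (\<Sum>g<a. \<Sum>h<b. \<Sum>p<n. \<Sum>q<n. f p q g h)"
      for f :: "nat \<Rightarrow> nat \<Rightarrow> nat \<Rightarrow> nat \<Rightarrow> complex"
    proof -
      have "(\<Sum>p<n. \<Sum>q<n. \<Sum>g<a. \<Sum>h<b. f p q g h) = (\<Sum>p<n. \<Sum>g<a. \<Sum>q<n. \<Sum>h<b. f p q g h)"
        by (intro sum.cong refl sum.swap)
      also have "\<dots> = (\<Sum>g<a. \<Sum>p<n. \<Sum>q<n. \<Sum>h<b. f p q g h)" by (rule sum.swap)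
      also have "\<dots> = (\<Sum>g<a. \<Sum>p<n. \<Sum>h<b. \<Sum>q<n. f p q g h)"
        by (intro sum.cong refl sum.swap)
      also have "\<dots> = (\<Sum>g<a. \<Sum>h<b. \<Sum>p<n. \<Sum>q<n. f p q g h)"
        by (intro sum.cong refl sum.swap)
      finally show ?thesis .
    qed
    show ?thesis by (rule swap4)
  qed
  also have "\<dots> = (\<Sum>g<a. \<Sum>h<b. cnj ((A g * B h) $$ (i, j)) * (A g * B h) $$ (k, l))"
    using A B lt by (intro sum.cong refl) (simp add: mult_entry[of _ n] sum_product del: index_mult_mat(1))
  also have "\<dots> = (\<Sum>r<a * b. cnj ((A (r div b) * B (r mod b)) $$ x) * (A (r div b) * B (r mod b)) $$ y)"
    unfolding sum_lessThan_mult by (intro sum.cong refl) (auto simp: ij)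
  also have "\<dots> = choi n (kraus_sum n (a * b) (\<lambda>h. A (h div b) * B (h mod b))) x y"
  proof (rule choi_kraus_sum[OF _ xy, symmetric])
    fix h assume h: "h < a * b"
    then have "h mod b < b" "h div b < a" by (cases b; simp add: less_mult_imp_div_less)+
    then show "A (h div b) * B (h mod b) \<in> carrier_mat n n" using A B by (meson mult_carrier_mat)
  qed
  finally show "choi n (kraus_sum n a A * kraus_sum n b B) x y
      = choi n (kraus_sum n (a * b) (\<lambda>h. A (h div b) * B (h mod b))) x y" .
qed simp

lemma kraus_sum_one: "1\<^sub>m (n * n) = kraus_sum n 1 (\<lambda>_. 1\<^sub>m n)"
proof (rule mat_eq_choi)
  fix a b assume ab: "a \<in> index_pairs n" "b \<in> index_pairs n"
  obtain i j k l where ij: "a = (i, j)" "b = (k, l)" by (cases a; cases b) auto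
  have lt: "i < n" "j < n" "k < n" "l < n" using ab ij by auto
  have "i * n + k = j * n + l \<longleftrightarrow> i = j \<and> k = l"
  proof
    assume eq: "i * n + k = j * n + l"
    have "(i * n + k) div n = i" "(i * n + k) mod n = k" "(j * n + l) div n = j" "(j * n + l) mod n = l"
      using lt by simp_all
    then show "i = j \<and> k = l" using eq by metis
  qed simp
  then show "choi n (1\<^sub>m (n * n)) a b = choi n (kraus_sum n 1 (\<lambda>_. 1\<^sub>m n)) a b"
    using lt pair_index_less[of i n k] pair_index_less[of j n l] ab
    by (subst choi_kraus_sum) (auto simp: ij choi_def)
qed auto

section \<open>Spans, annihilators and ideals\<close>

lemma mat_sum_carrier [simp]: "mat_sum n F I \<in> carrier_mat n n"
  by (simp add: mat_sum_def)

lemma mat_sum_closed: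
  assumes "0\<^sub>m n n \<in> J" "\<And>A B. A \<in> J \<Longrightarrow> B \<in> J \<Longrightarrow> A + B \<in> J" "\<And>c A. A \<in> J \<Longrightarrow> c \<cdot>\<^sub>m A \<in> J"
    and "\<And>k. k < (b::nat) \<Longrightarrow> F k \<in> J" "J \<subseteq> carrier_mat n n"
  shows "mat_sum n (\<lambda>k. c k \<cdot>\<^sub>m F k) {..<b} \<in> J"
  using assms(4)
proof (induction b)
  case 0
  have "mat_sum n (\<lambda>k. c k \<cdot>\<^sub>m F k) {..<0} = 0\<^sub>m n n" by (intro eq_matI) (auto simp: mat_sum_def)
  then show ?case using assms(1) by simp
next
  case (Suc b)
  have Fb: "F b \<in> carrier_mat n n" using Suc.prems[of b] assms(5) by auto
  have "mat_sum n (\<lambda>k. c k \<cdot>\<^sub>m F k) {..<Suc b} = mat_sum n (\<lambda>k. c k \<cdot>\<^sub>m F k) {..<b} + c b \<cdot>\<^sub>m F b"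
    using Fb by (intro eq_matI) (auto simp: mat_sum_def)
  then show ?case using Suc assms(2,3) by simp
qed

lemma gen_algebra_carrier:
  assumes "A \<in> gen_algebra n S" "S \<subseteq> carrier_mat n n"
  shows "A \<in> carrier_mat n n"
  using assms by induction auto

text \<open>\<open>double_annihilator\<close> for matrices viewed as functions on index pairs; the
  \<open>S\<close> of the proof collects all functions that agree there with a member of
  \<open>J\<close>.\<close>

lemma annihilator_mem:
  assumes J: "0\<^sub>m n n \<in> J" "\<And>A B. A \<in> J \<Longrightarrow> B \<in> J \<Longrightarrow> A + B \<in> J" "\<And>c A. A \<in> J \<Longrightarrow> c \<cdot>\<^sub>m A \<in> J"
    "J \<subseteq> carrier_mat n n"
    and C: "C \<in> carrier_mat n n"
    and ann: "\<And>v. (\<And>A. A \<in> J \<Longrightarrow> pairing n v A = 0) \<Longrightarrow> pairing n v C = 0"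
  shows "C \<in> J"
proof -
  define S where "S = {f. \<exists>A\<in>J. \<forall>a\<in>index_pairs n. f a = A $$ a}"
  have "\<exists>f\<in>S. \<forall>a\<in>index_pairs n. f a = C $$ a"
  proof (rule double_annihilator)
    show "(\<lambda>_. 0) \<in> S" unfolding S_def using J(1) by (auto intro!: bexI[of _ "0\<^sub>m n n"])
  next
    fix f g assume "f \<in> S" "g \<in> S"
    then obtain A B where AB: "A \<in> J" "B \<in> J" "\<forall>a\<in>index_pairs n. f a = A $$ a" "\<forall>a\<in>index_pairs n. g a = B $$ a"
      unfolding S_def by blast
    then have "A \<in> carrier_mat n n" "B \<in> carrier_mat n n" using J(4) by auto
    then show "(\<lambda>a. f a + g a) \<in> S" unfolding S_def using AB J(2)[OF AB(1,2)]
      by (auto intro!: bexI[of _ "A + B"])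
  next
    fix c f assume "f \<in> S"
    then obtain A where A: "A \<in> J" "\<forall>a\<in>index_pairs n. f a = A $$ a" unfolding S_def by blast
    then have "A \<in> carrier_mat n n" using J(4) by auto
    then show "(\<lambda>a. c * f a) \<in> S" unfolding S_def using A J(3)[OF A(1)]
      by (auto intro!: bexI[of _ "c \<cdot>\<^sub>m A"])
  next
    fix v assume v: "\<And>f. f \<in> S \<Longrightarrow> (\<Sum>a\<in>index_pairs n. v a * f a) = 0"
    have "pairing n v A = 0" if "A \<in> J" for A
      unfolding pairing_def by (rule v) (use that in \<open>auto simp: S_def\<close>)
    then show "(\<Sum>a\<in>index_pairs n. v a * C $$ a) = 0"
      using ann[of v] by (simp add: pairing_def)
  qed simp
  then obtain A where A: "A \<in> J" "\<forall>a\<in>index_pairs n. C $$ a = A $$ a" unfolding S_def by auto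
  then have "C = A" using J(4) C by (intro eq_matI) auto
  then show ?thesis using A(1) by simp
qed

lemma mat_span_entry:
  assumes "\<And>k. k < b \<Longrightarrow> B k \<in> carrier_mat n n" "i < n" "j < n"
  shows "mat_sum n (\<lambda>k. c k \<cdot>\<^sub>m B k) {..<b} $$ (i, j) = (\<Sum>k<b. c k * B k $$ (i, j))"
proof -
  have "mat_sum n (\<lambda>k. c k \<cdot>\<^sub>m B k) {..<b} $$ (i, j) = (\<Sum>k<b. (c k \<cdot>\<^sub>m B k) $$ (i, j))"
    using assms(2,3) by (simp add: mat_sum_def)
  also have "\<dots> = (\<Sum>k<b. c k * B k $$ (i, j))"
    using assms by (intro sum.cong refl index_smult_mat(1)) (auto dest!: assms(1))
  finally show ?thesis .
qed

lemma mat_span_carrier: "mat_span n b B \<subseteq> carrier_mat n n"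
  by (auto simp: mat_span_def)

lemma mat_span_subspace:
  assumes B: "\<And>k. k < b \<Longrightarrow> B k \<in> carrier_mat n n"
  shows "0\<^sub>m n n \<in> mat_span n b B"
    and "\<And>A A'. A \<in> mat_span n b B \<Longrightarrow> A' \<in> mat_span n b B \<Longrightarrow> A + A' \<in> mat_span n b B"
    and "\<And>c A. A \<in> mat_span n b B \<Longrightarrow> c \<cdot>\<^sub>m A \<in> mat_span n b B"
proof -
  define L where "L = (\<lambda>c. mat_sum n (\<lambda>k. c k \<cdot>\<^sub>m B k) {..<b})"
  have span: "mat_span n b B = range L" by (auto simp: mat_span_def L_def)
  have L: "L c \<in> carrier_mat n n" for c by (simp add: L_def)
  have entry: "L c $$ (i, j) = (\<Sum>k<b. c k * B k $$ (i, j))" if "i < n" "j < n" for c i j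
    unfolding L_def using mat_span_entry[of b B n, OF B that] .
  have "L (\<lambda>_. 0) = 0\<^sub>m n n" using L by (intro eq_matI) (auto simp: entry)
  then show "0\<^sub>m n n \<in> mat_span n b B" by (metis span rangeI)
  have "L c + L c' = L (\<lambda>k. c k + c' k)" for c c'
    using L[of c] L[of c'] L[of "\<lambda>k. c k + c' k"]
    by (intro eq_matI) (auto simp: entry sum.distrib distrib_right)
  then show "A + A' \<in> mat_span n b B" if "A \<in> mat_span n b B" "A' \<in> mat_span n b B" for A A'
    using that by (auto simp: span)
  have "t \<cdot>\<^sub>m L c = L (\<lambda>k. t * c k)" for c t
    using L[of c] L[of "\<lambda>k. t * c k"]
    by (intro eq_matI) (auto simp: entry sum_distrib_left mult.assoc)
  then show "t \<cdot>\<^sub>m A \<in> mat_span n b B" if "A \<in> mat_span n b B" for A t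
    using that by (auto simp: span)
qed

lemma mat_span_generator:
  assumes B: "\<And>k. k < b \<Longrightarrow> B k \<in> carrier_mat n n" and k: "k < b"
  shows "B k \<in> mat_span n b B"
proof -
  define c :: "nat \<Rightarrow> complex" where "c = (\<lambda>h. if h = k then 1 else 0)"
  have "B k = mat_sum n (\<lambda>h. c h \<cdot>\<^sub>m B h) {..<b}"
  proof (rule eq_matI)
    fix i j assume "i < dim_row (mat_sum n (\<lambda>h. c h \<cdot>\<^sub>m B h) {..<b})" "j < dim_col (mat_sum n (\<lambda>h. c h \<cdot>\<^sub>m B h) {..<b})"
    then have ij: "i < n" "j < n" by (auto simp: mat_sum_def)
    have "(\<Sum>h<b. c h * B h $$ (i, j)) = (\<Sum>h<b. if h = k then B k $$ (i, j) else 0)"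
      by (intro sum.cong) (auto simp: c_def)
    then show "B k $$ (i, j) = mat_sum n (\<lambda>h. c h \<cdot>\<^sub>m B h) {..<b} $$ (i, j)"
      using k mat_span_entry[of b B n, OF B ij] by simp
  qed (use B[OF k] in \<open>auto simp: mat_sum_def\<close>)
  then show ?thesis unfolding mat_span_def by blast
qed

lemma mat_span_annihilator:
  assumes B: "\<And>k. k < b \<Longrightarrow> B k \<in> carrier_mat n n" and C: "C \<in> carrier_mat n n"
    and ann: "\<And>v. (\<And>k. k < b \<Longrightarrow> pairing n v (B k) = 0) \<Longrightarrow> pairing n v C = 0"
  shows "C \<in> mat_span n b B"
  by (rule annihilator_mem[OF mat_span_subspace[of b B n, OF B] mat_span_carrier C])
    (use ann mat_span_generator[of b B n, OF B] in auto)

lemma gen_algebra_annihilator: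
  assumes S: "S \<subseteq> carrier_mat n n" and C: "C \<in> carrier_mat n n"
    and ann: "\<And>v. (\<And>A. A \<in> gen_algebra n S \<Longrightarrow> pairing n v A = 0) \<Longrightarrow> pairing n v C = 0"
  shows "C \<in> gen_algebra n S"
  by (rule annihilator_mem[OF gen_algebra.zero gen_algebra.add gen_algebra.smult _ C])
    (use gen_algebra_carrier[OF _ S] ann in auto)

lemma mult_mat_span_element:
  assumes B: "\<And>k. k < b \<Longrightarrow> B k \<in> carrier_mat n n" and C: "C \<in> carrier_mat n n"
  shows "C * mat_sum n (\<lambda>k. c k \<cdot>\<^sub>m B k) {..<b} = mat_sum n (\<lambda>k. c k \<cdot>\<^sub>m (C * B k)) {..<b}" (is "_ = ?R")
    and "mat_sum n (\<lambda>k. c k \<cdot>\<^sub>m B k) {..<b} * C = mat_sum n (\<lambda>k. c k \<cdot>\<^sub>m (B k * C)) {..<b}" (is "_ = ?R'")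
proof -
  let ?A = "mat_sum n (\<lambda>k. c k \<cdot>\<^sub>m B k) {..<b}"
  have CB: "C * B k \<in> carrier_mat n n" "B k * C \<in> carrier_mat n n" if "k < b" for k
    using B[OF that] C by auto
  show "C * ?A = ?R"
  proof (rule eq_matI)
    fix i j assume "i < dim_row ?R" "j < dim_col ?R"
    then have ij: "i < n" "j < n" by (auto simp: mat_sum_def)
    have "(C * ?A) $$ (i, j) = (\<Sum>l<n. C $$ (i, l) * (\<Sum>k<b. c k * B k $$ (l, j)))"
      using ij C by (simp add: mult_entry[of _ n] mat_span_entry[of b B n, OF B] del: index_mult_mat(1))
    also have "\<dots> = (\<Sum>k<b. c k * (\<Sum>l<n. C $$ (i, l) * B k $$ (l, j)))"
      unfolding sum_distrib_left by (subst sum.swap) (simp only: ac_simps)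
    also have "\<dots> = (\<Sum>k<b. c k * (C * B k) $$ (i, j))"
      using B C ij by (intro sum.cong refl) (simp add: mult_entry[of _ n] del: index_mult_mat(1))
    finally show "(C * ?A) $$ (i, j) = ?R $$ (i, j)" using mat_span_entry[of b "\<lambda>k. C * B k" n, OF CB(1) ij] by simp
  qed (use C in \<open>auto simp: mat_sum_def\<close>)
  show "?A * C = ?R'"
  proof (rule eq_matI)
    fix i j assume "i < dim_row ?R'" "j < dim_col ?R'"
    then have ij: "i < n" "j < n" by (auto simp: mat_sum_def)
    have "(?A * C) $$ (i, j) = (\<Sum>l<n. (\<Sum>k<b. c k * B k $$ (i, l)) * C $$ (l, j))"
      using ij C by (simp add: mult_entry[of _ n] mat_span_entry[of b B n, OF B] del: index_mult_mat(1))
    also have "\<dots> = (\<Sum>k<b. c k * (\<Sum>l<n. B k $$ (i, l) * C $$ (l, j)))"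
      unfolding sum_distrib_left sum_distrib_right by (subst sum.swap) (simp only: ac_simps)
    also have "\<dots> = (\<Sum>k<b. c k * (B k * C) $$ (i, j))"
      using B C ij by (intro sum.cong refl) (simp add: mult_entry[of _ n] del: index_mult_mat(1))
    finally show "(?A * C) $$ (i, j) = ?R' $$ (i, j)" using mat_span_entry[of b "\<lambda>k. B k * C" n, OF CB(2) ij] by simp
  qed (use C in \<open>auto simp: mat_sum_def\<close>)
qed

text \<open>Induction over the generated algebra with \<open>A\<close> arbitrary: for a product
  \<open>C * D\<close> the hypothesis is applied to \<open>A\<close> and then to
  \<open>D * A\<close> or \<open>A * C\<close>, which are again in the span.\<close>

lemma mat_span_two_sided_ideal:
  assumes S: "S \<subseteq> carrier_mat n n" and B: "\<And>k. k < b \<Longrightarrow> B k \<in> gen_algebra n S"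
    and mult: "\<And>C k. C \<in> S \<Longrightarrow> k < b \<Longrightarrow> C * B k \<in> mat_span n b B \<and> B k * C \<in> mat_span n b B"
  shows "two_sided_ideal n (mat_span n b B) (gen_algebra n S)"
proof -
  let ?J = "mat_span n b B"
  have Bc: "B k \<in> carrier_mat n n" if "k < b" for k
    using gen_algebra_carrier[OF B[OF that] S] .
  have Ac: "gen_algebra n S \<subseteq> carrier_mat n n" using gen_algebra_carrier[OF _ S] by blast
  note J = mat_span_subspace[of b B n, OF Bc]
  have Jc: "A \<in> carrier_mat n n" if "A \<in> ?J" for A using that mat_span_carrier by blast
  have sub: "?J \<subseteq> gen_algebra n S"
  proof
    fix A assume "A \<in> ?J"
    then obtain c where "A = mat_sum n (\<lambda>k. c k \<cdot>\<^sub>m B k) {..<b}" unfolding mat_span_def by blast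
    then show "A \<in> gen_algebra n S"
      using mat_sum_closed[of n "gen_algebra n S" b B c] gen_algebra.intros B Ac by metis
  qed
  have ideal: "C * A \<in> ?J \<and> A * C \<in> ?J" if "C \<in> gen_algebra n S" "A \<in> ?J" for C A
    using that
  proof (induction arbitrary: A)
    case (gen C)
    obtain c where c: "A = mat_sum n (\<lambda>k. c k \<cdot>\<^sub>m B k) {..<b}" using gen.prems unfolding mat_span_def by blast
    have C: "C \<in> carrier_mat n n" using gen.hyps S by blast
    have "mat_sum n (\<lambda>k. c k \<cdot>\<^sub>m (C * B k)) {..<b} \<in> ?J"
      by (rule mat_sum_closed[OF J _ mat_span_carrier]) (use mult gen.hyps in auto)
    moreover have "mat_sum n (\<lambda>k. c k \<cdot>\<^sub>m (B k * C)) {..<b} \<in> ?J"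
      by (rule mat_sum_closed[OF J _ mat_span_carrier]) (use mult gen.hyps in auto)
    ultimately show ?case unfolding c using mult_mat_span_element[of b B n C c] Bc C by metis
  next
    case zero
    then show ?case using J(1) Jc[OF zero] by simp
  next
    case (add C D)
    have cd: "C \<in> carrier_mat n n" "D \<in> carrier_mat n n" using add.hyps Ac by auto
    have A: "A \<in> carrier_mat n n" using Jc add.prems .
    show ?case
      unfolding add_mult_distrib_mat[OF cd A] mult_add_distrib_mat[OF A cd]
      using add.IH[OF add.prems] J(2) by blast
  next
    case (smult C t)
    have C: "C \<in> carrier_mat n n" using smult.hyps Ac by auto
    have A: "A \<in> carrier_mat n n" using Jc smult.prems .
    show ?case
      unfolding mult_smult_assoc_mat[OF C A] mult_smult_distrib[OF A C]
      using smult.IH[OF smult.prems] J(3) by blast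
  next
    case (mult C D)
    have cd: "C \<in> carrier_mat n n" "D \<in> carrier_mat n n" using mult.hyps Ac by auto
    have A: "A \<in> carrier_mat n n" using Jc mult.prems .
    show ?case
      unfolding assoc_mult_mat[OF cd A] assoc_mult_mat[OF A cd, symmetric]
      using mult.IH mult.prems by blast
  qed
  show ?thesis unfolding two_sided_ideal_def using sub J ideal by blast
qed

section \<open>The Choi form under sums, limits and powers\<close>

lemma choi_form_smult:
  assumes "M \<in> carrier_mat (n * n) (n * n)"
  shows "choi_form n (c \<cdot>\<^sub>m M) v = c * choi_form n M v"
proof -
  have "choi n (c \<cdot>\<^sub>m M) a b = c * choi n M a b" if "a \<in> index_pairs n" "b \<in> index_pairs n" for a b
    using that assms pair_index_less[of "fst a" n "fst b"] pair_index_less[of "snd a" n "snd b"]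
    by (auto simp: choi_def)
  then show ?thesis
    unfolding choi_form_def sum_distrib_left by (intro sum.cong refl) (simp add: ac_simps)
qed

lemma choi_form_mat_sum:
  "choi_form n (mat_sum (n * n) F I) v = (\<Sum>m\<in>I. choi_form n (F m) v)"
proof -
  have "choi n (mat_sum (n * n) F I) a b = (\<Sum>m\<in>I. choi n (F m) a b)"
    if "a \<in> index_pairs n" "b \<in> index_pairs n" for a b
    using that pair_index_less[of "fst a" n "fst b"] pair_index_less[of "snd a" n "snd b"]
    by (auto simp: choi_def mat_sum_def)
  then have "choi_form n (mat_sum (n * n) F I) v
      = (\<Sum>a\<in>index_pairs n. \<Sum>b\<in>index_pairs n. \<Sum>m\<in>I. cnj (v a) * v b * choi n (F m) a b)"
    unfolding choi_form_def by (intro sum.cong refl) (simp add: sum_distrib_left)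
  also have "\<dots> = (\<Sum>a\<in>index_pairs n. \<Sum>m\<in>I. \<Sum>b\<in>index_pairs n. cnj (v a) * v b * choi n (F m) a b)"
    by (intro sum.cong refl sum.swap)
  also have "\<dots> = (\<Sum>m\<in>I. choi_form n (F m) v)"
    unfolding choi_form_def by (rule sum.swap)
  finally show ?thesis .
qed

lemma choi_form_tendsto:
  assumes "\<And>i j. i < n * n \<Longrightarrow> j < n * n \<Longrightarrow> ((\<lambda>m. F m $$ (i, j)) \<longlongrightarrow> M $$ (i, j)) G"
  shows "((\<lambda>m. choi_form n (F m) v) \<longlongrightarrow> choi_form n M v) G"
  unfolding choi_form_def choi_def
  by (intro tendsto_sum tendsto_mult tendsto_const assms pair_index_less) auto

text \<open>The power 0 is the identity, whose Kraus matrix may lie outside an algebra generated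
  without a unit; membership is therefore claimed for positive exponents only.\<close>

lemma power_kraus_sum:
  assumes X: "\<And>i. i < d \<Longrightarrow> X i \<in> carrier_mat n n"
  obtains r W where "\<And>h. h < r \<Longrightarrow> W h \<in> carrier_mat n n"
    "\<And>h. m > 0 \<Longrightarrow> h < r \<Longrightarrow> W h \<in> gen_algebra n (X ` {..<d})"
    "kraus_sum n d X ^\<^sub>m m = kraus_sum n r W"
proof -
  have XS: "X ` {..<d} \<subseteq> carrier_mat n n" using X by auto
  have "\<exists>r W. (\<forall>h<r. W h \<in> carrier_mat n n) \<and> (m > 0 \<longrightarrow> (\<forall>h<r. W h \<in> gen_algebra n (X ` {..<d}))) \<and>
    kraus_sum n d X ^\<^sub>m m = kraus_sum n r W"
  proof (induction m)
    case 0
    have "kraus_sum n d X ^\<^sub>m 0 = 1\<^sub>m (n * n)"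
      by (simp add: carrier_matD(1)[OF kraus_sum_carrier])
    then show ?case using kraus_sum_one[of n] by (metis one_carrier_mat less_irrefl)
  next
    case (Suc m)
    then obtain r W where W: "\<And>h. h < r \<Longrightarrow> W h \<in> carrier_mat n n"
      "\<And>h. m > 0 \<Longrightarrow> h < r \<Longrightarrow> W h \<in> gen_algebra n (X ` {..<d})"
      "kraus_sum n d X ^\<^sub>m m = kraus_sum n r W" by blast
    show ?case
    \<comment> \<open>The first power is treated apart, because a product with the identity matrix
      would not exhibit membership in the algebra.\<close>
    proof (cases "m = 0")
      case True
      then have "kraus_sum n d X ^\<^sub>m Suc m = kraus_sum n d X"
        using kraus_sum_carrier[of n d X] by (simp add: left_mult_one_mat[of _ "n * n" "n * n"])
      then show ?thesis using X by (auto intro!: exI[of _ d] exI[of _ X] gen_algebra.gen)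
    next
      case False
      have eq: "kraus_sum n d X ^\<^sub>m Suc m = kraus_sum n (r * d) (\<lambda>h. W (h div d) * X (h mod d))"
        using kraus_sum_mult[of r W n d X] W(1) X by (simp add: W(3))
      have "W (h div d) * X (h mod d) \<in> gen_algebra n (X ` {..<d})" if h: "h < r * d" for h
      proof -
        have "h mod d < d" "h div d < r" using h by (cases d; simp add: less_mult_imp_div_less)+
        then show ?thesis using W(2) False by (intro gen_algebra.mult[OF _ gen_algebra.gen]) auto
      qed
      then show ?thesis using eq gen_algebra_carrier[OF _ XS]
        by (intro exI[of _ "r * d"] exI[of _ "\<lambda>h. W (h div d) * X (h mod d)"]) auto
    qed
  qed
  then show ?thesis using that by blast
qed

section \<open>Limits of the normalized powers\<close>

lemma normalized_power_eq: "normalized_power T m = normalize_mat (T ^\<^sub>m m)"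
  by (simp add: normalized_power_def normalize_mat_def)

text \<open>\<open>F x\<close> is the normalization of \<open>L x\<close>, the sum of the matrices
  \<open>P t\<close> weighted by \<open>x t\<close>. Dividing the power by a binomial does not
  change its normalization, so the lower bound \<open>c\<close> for \<open>op_norm (L x)\<close>
  yields both the limit and the Lipschitz bound.\<close>

lemma limit_family:
  fixes T :: "complex mat"
  assumes T: "T \<in> carrier_mat N N" "N > 0" "spectral_radius T = 1"
    and ls: "distinct ls" "set ls = maximal_spectrum T"
  obtains F K where "\<And>x. F x \<in> carrier_mat N N"
    "\<And>u v. u < N \<Longrightarrow> v < N \<Longrightarrow> lipschitz_on_torus (length ls) K (\<lambda>x. F x $$ (u, v))"
    "\<And>u v. u < N \<Longrightarrow> v < N \<Longrightarrow>
       (\<lambda>m. normalized_power T m $$ (u, v) - F (unimodular_list.orbit ls m) $$ (u, v)) \<longlonglongrightarrow> 0"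
    "\<And>x. x \<in> torus_set (length ls) \<Longrightarrow> \<exists>u<N. \<exists>v<N. F x $$ (u, v) \<noteq> 0"
proof -
  interpret unimodular_list ls using maximal_spectrum_unimodular[OF T ls(2)] .
  obtain k P c where P: "c > 0"
    "\<And>u v. u < N \<Longrightarrow> v < N \<Longrightarrow>
      (\<lambda>m. (T ^\<^sub>m m) $$ (u, v) / of_nat (m choose k) - (\<Sum>t<length ls. ls ! t ^ m * P t u v)) \<longlonglongrightarrow> 0"
    "\<And>x. x \<in> torus_set (length ls) \<Longrightarrow> \<exists>u<N. \<exists>v<N. c \<le> cmod (\<Sum>t<length ls. x t * P t u v)"
    by (rule power_asymptotics[OF T ls]) (rule that)
  define L where "L = (\<lambda>x :: nat \<Rightarrow> complex. Matrix.mat N N (\<lambda>(u, v). \<Sum>t<length ls. x t * P t u v))"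
  define F where "F = (\<lambda>x. normalize_mat (L x))"
  have L: "L x \<in> carrier_mat N N" for x by (simp add: L_def)
  have Lentry: "L x $$ (u, v) = (\<Sum>t<length ls. x t * P t u v)" if "u < N" "v < N" for x u v
    using that by (simp add: L_def)
  have F: "F x \<in> carrier_mat N N" for x using L by (simp add: F_def)
  have Lc: "c \<le> op_norm (L x)" if "x \<in> torus_set (length ls)" for x
    using P(3)[OF that] entry_le_op_norm[OF L, of _ _ x] Lentry by (metis order_trans)
  \<comment> \<open>Without coordinates the Lipschitz condition would extend to negative
    \<open>\<delta>\<close>; but then the sum in the lower bound would be empty, against
    \<open>c > 0\<close>.\<close>
  have len: "length ls > 0"
  proof (rule ccontr)
    assume "\<not> length ls > 0"
    then show False using P(1) P(3)[OF orbit_in_torus[of 0]] by simp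
  qed
  define p where "p = (\<Sum>u<N. \<Sum>v<N. \<Sum>t<length ls. cmod (P t u v))"
  have p: "p \<ge> 0" unfolding p_def by (intro sum_nonneg) auto
  have Ldiff: "entry_sum N (L x - L y) \<le> p * \<delta>" if d: "\<And>i. i < length ls \<Longrightarrow> cmod (x i - y i) < \<delta>" for x y \<delta>
  proof -
    have "entry_sum N (L x - L y) \<le> (\<Sum>u<N. \<Sum>v<N. \<Sum>t<length ls. cmod (P t u v) * \<delta>)"
      unfolding entry_sum_def
    proof (intro sum_mono)
      fix u v assume uv: "u \<in> {..<N}" "v \<in> {..<N}"
      have "(L x - L y) $$ (u, v) = (\<Sum>t<length ls. (x t - y t) * P t u v)"
        using uv L[of x] L[of y] by (simp add: Lentry sum_subtractf left_diff_distrib)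
      also have "cmod \<dots> \<le> (\<Sum>t<length ls. cmod (P t u v) * \<delta>)"
      proof (rule sum_norm_le)
        fix t assume "t \<in> {..<length ls}"
        then have "cmod (x t - y t) * cmod (P t u v) \<le> \<delta> * cmod (P t u v)"
          using d[of t] by (intro mult_right_mono) auto
        then show "cmod ((x t - y t) * P t u v) \<le> cmod (P t u v) * \<delta>"
          by (simp add: norm_mult mult.commute)
      qed
      finally show "cmod ((L x - L y) $$ (u, v)) \<le> (\<Sum>t<length ls. cmod (P t u v) * \<delta>)" .
    qed
    also have "\<dots> = p * \<delta>" by (simp only: p_def sum_distrib_right)
    finally show ?thesis .
  qed
  \<comment> \<open>\<open>p\<close> is a Lipschitz constant for \<open>L\<close>, the factor
    \<open>2 / c\<close> comes from \<open>normalize_mat_diff\<close>, and the added 1 keeps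
    \<open>K\<close> positive.\<close>
  define K where "K = 2 * (p + 1) / c"
  have lip: "lipschitz_on_torus (length ls) K (\<lambda>x. F x $$ (u, v))" if uv: "u < N" "v < N" for u v
    unfolding lipschitz_on_torus_def
  proof (intro conjI ballI allI impI)
    show "K > 0" using p P(1) by (simp add: K_def)
    fix x y \<delta> assume x: "x \<in> torus_set (length ls)" and y: "y \<in> torus_set (length ls)"
      and d: "\<forall>i<length ls. cmod (x i - y i) < \<delta>"
    have d0: "\<delta> > 0" using d len norm_ge_zero le_less_trans by blast
    have pos: "op_norm (L x) > 0" using Lc[OF x] P(1) by simp
    have "cmod (F x $$ (u, v) - F y $$ (u, v)) \<le> 2 * entry_sum N (L x - L y) / op_norm (L x)"
      unfolding F_def by (rule normalize_mat_diff[OF L L uv pos])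
    also have "\<dots> \<le> 2 * ((p + 1) * \<delta>) / c"
    proof (rule frac_le)
      have "entry_sum N (L x - L y) \<le> p * \<delta>" using Ldiff d by blast
      then show "2 * entry_sum N (L x - L y) \<le> 2 * ((p + 1) * \<delta>)"
        using d0 by (simp add: distrib_right)
      show "0 \<le> 2 * ((p + 1) * \<delta>)" using p d0 by simp
    qed (use Lc[OF x] P(1) in auto)
    also have "\<dots> = K * \<delta>" by (simp add: K_def)
    finally show "cmod (F x $$ (u, v) - F y $$ (u, v)) \<le> K * \<delta>" .
  qed
  define Y where "Y = (\<lambda>m. complex_of_real (1 / real (m choose k)) \<cdot>\<^sub>m (T ^\<^sub>m m))"
  have Y: "Y m \<in> carrier_mat N N" for m using T(1) by (simp add: Y_def)
  have ent: "(\<lambda>m. entry_sum N (L (orbit m) - Y m)) \<longlonglongrightarrow> 0"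
    unfolding entry_sum_def
  proof (intro tendsto_null_sum)
    fix u v assume uv: "u \<in> {..<N}" "v \<in> {..<N}"
    have "(\<Sum>t<length ls. orbit m t * P t u v) = (\<Sum>t<length ls. ls ! t ^ m * P t u v)" for m
      by (intro sum.cong) auto
    then have "cmod ((L (orbit m) - Y m) $$ (u, v))
        = cmod ((T ^\<^sub>m m) $$ (u, v) / of_nat (m choose k) - (\<Sum>t<length ls. ls ! t ^ m * P t u v))" for m
      using uv L[of "orbit m"] T(1) by (simp add: Lentry Y_def norm_minus_commute)
    then show "(\<lambda>m. cmod ((L (orbit m) - Y m) $$ (u, v))) \<longlonglongrightarrow> 0"
      using tendsto_norm_zero[OF P(2)[of u v]] uv by simp
  qed
  have lim: "(\<lambda>m. normalized_power T m $$ (u, v) - F (orbit m) $$ (u, v)) \<longlonglongrightarrow> 0" if uv: "u < N" "v < N" for u v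
  proof (rule Lim_null_comparison)
    show "(\<lambda>m. 2 / c * entry_sum N (L (orbit m) - Y m)) \<longlonglongrightarrow> 0"
      by (rule tendsto_mult_right_zero[OF ent])
    show "\<forall>\<^sub>F m in sequentially. norm (normalized_power T m $$ (u, v) - F (orbit m) $$ (u, v))
        \<le> 2 / c * entry_sum N (L (orbit m) - Y m)"
    \<comment> \<open>For \<open>m < k\<close> the binomial is 0, and \<open>Y m\<close> is not a
      positive multiple of the power.\<close>
    proof (rule eventually_sequentiallyI[of k])
      fix m assume m: "m \<ge> k"
      have "normalize_mat (Y m) = normalized_power T m"
        unfolding Y_def normalized_power_eq using T m
        by (intro normalize_mat_smult[of _ N]) auto
      then have "cmod (F (orbit m) $$ (u, v) - normalized_power T m $$ (u, v))
          \<le> 2 * entry_sum N (L (orbit m) - Y m) / op_norm (L (orbit m))"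
        using normalize_mat_diff[OF L[of "orbit m"] Y[of m] uv] Lc[OF orbit_in_torus[of m]] P(1)
        by (simp add: F_def)
      also have "\<dots> \<le> 2 * entry_sum N (L (orbit m) - Y m) / c"
        using Lc[OF orbit_in_torus[of m]] P(1) entry_sum_nonneg by (intro divide_left_mono) auto
      finally show "norm (normalized_power T m $$ (u, v) - F (orbit m) $$ (u, v))
        \<le> 2 / c * entry_sum N (L (orbit m) - Y m)"
        by (simp add: norm_minus_commute)
    qed
  qed
  have nz: "\<exists>u<N. \<exists>v<N. F x $$ (u, v) \<noteq> 0" if x: "x \<in> torus_set (length ls)" for x
  proof -
    obtain u v where uv: "u < N" "v < N" "c \<le> cmod (L x $$ (u, v))"
      using P(3)[OF x] Lentry by auto
    have "L x $$ (u, v) \<noteq> 0" using uv(3) P(1) by auto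
    moreover have "op_norm (L x) \<noteq> 0" using Lc[OF x] P(1) by auto
    ultimately have "F x $$ (u, v) \<noteq> 0"
      using uv L by (simp add: F_def normalize_mat_entry[of _ N])
    then show ?thesis using uv by blast
  qed
  show ?thesis by (rule that[of F K]) (fact F lip lim nz)+
qed

section \<open>Identification of \<open>T_lim\<close> and \<open>T_hat\<close>\<close>

lemma mat_tendsto_unique:
  assumes "mat_tendsto M f L" "mat_tendsto M f L'"
  shows "L = L'"
proof (rule eq_matI)
  fix i j assume "i < dim_row L'" "j < dim_col L'"
  then have "i < M" "j < M" using assms by (auto simp: mat_tendsto_def)
  then show "L $$ (i, j) = L' $$ (i, j)"
    using assms unfolding mat_tendsto_def by (meson LIMSEQ_unique)
qed (use assms in \<open>auto simp: mat_tendsto_def\<close>)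

locale normalized_limit = unimodular_list +
  fixes T :: "complex mat" and N :: nat and F :: "(nat \<Rightarrow> complex) \<Rightarrow> complex mat" and K :: real
  assumes T: "T \<in> carrier_mat N N" "N > 0"
    and F: "\<And>x. F x \<in> carrier_mat N N"
    and F_lipschitz: "\<And>u v. u < N \<Longrightarrow> v < N \<Longrightarrow> lipschitz_on_torus (length ls) K (\<lambda>x. F x $$ (u, v))"
    and F_limit: "\<And>u v. u < N \<Longrightarrow> v < N \<Longrightarrow>
       (\<lambda>m. normalized_power T m $$ (u, v) - F (orbit m) $$ (u, v)) \<longlonglongrightarrow> 0"
begin

lemma K_pos: "K > 0"
  using F_lipschitz[OF T(2) T(2)] by (simp add: lipschitz_on_torus_def)

lemma normalized_power_carrier [simp]: "normalized_power T m \<in> carrier_mat N N"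
  using T(1) by (simp add: normalized_power_def)

lemma normalized_power_tendsto:
  assumes s: "filterlim s at_top sequentially"
    and lim: "limitin (torus_topology (length ls)) (\<lambda>k. tau ls [^]\<^bsub>torus (length ls)\<^esub> s k) l sequentially"
  shows "mat_tendsto N (\<lambda>k. normalized_power T (s k)) (F l)"
  unfolding mat_tendsto_def
proof (intro conjI allI impI F)
  fix u v assume uv: "u < N" "v < N"
  have l: "l \<in> torus_set (length ls)"
    using limitin_topspace[OF lim] by (simp add: topspace_torus)
  have "(\<lambda>k. F (orbit (s k)) $$ (u, v)) \<longlonglongrightarrow> F l $$ (u, v)"
  proof (rule metric_LIMSEQ_I)
    fix e :: real assume e: "e > 0"
    define \<delta> where "\<delta> = e / (2 * K)"
    have d: "\<delta> > 0" using e K_pos by (simp add: \<delta>_def)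
    have "l \<in> torus_ball (length ls) l \<delta>" using l d by (simp add: torus_ball_def)
    then have "\<forall>\<^sub>F k in sequentially. orbit (s k) \<in> torus_ball (length ls) l \<delta>"
      using lim openin_torus_ball unfolding limitin_def tau_pow by blast
    then obtain k0 where k0: "\<And>k. k \<ge> k0 \<Longrightarrow> orbit (s k) \<in> torus_ball (length ls) l \<delta>"
      unfolding eventually_sequentially by blast
    have "dist (F (orbit (s k)) $$ (u, v)) (F l $$ (u, v)) < e" if "k \<ge> k0" for k
    proof -
      have "cmod (F (orbit (s k)) $$ (u, v) - F l $$ (u, v)) \<le> K * \<delta>"
        using k0[OF that] l
        by (intro lipschitz_on_torusD[OF F_lipschitz[OF uv]]) (simp_all add: torus_ball_def)
      also have "\<dots> < e" using e K_pos by (simp add: \<delta>_def)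
      finally show ?thesis by (simp add: dist_norm)
    qed
    then show "\<exists>k0. \<forall>k\<ge>k0. dist (F (orbit (s k)) $$ (u, v)) (F l $$ (u, v)) < e" by blast
  qed
  from tendsto_add[OF filterlim_compose[OF F_limit[OF uv] s] this]
  show "(\<lambda>k. normalized_power T (s k) $$ (u, v)) \<longlonglongrightarrow> F l $$ (u, v)" by simp
qed

text \<open>Uniqueness of the described matrix needs an admissible sequence of exponents that leads
  to \<open>l\<close>; points of \<Lambda> have one by \<open>approximable_sequence\<close>.\<close>

lemma T_lim_eq:
  assumes l: "l \<in> Lambda ls"
  shows "T_lim T ls l = F l"
proof -
  have dim: "dim_row T = N" using T by simp
  have l': "l \<in> torus_set (length ls)" "approximable l" using l Lambda_iff by blast+
  obtain s :: "nat \<Rightarrow> nat" where s: "\<And>k. 0 < s k" "filterlim s at_top sequentially"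
    "limitin (torus_topology (length ls)) (\<lambda>k. tau ls [^]\<^bsub>torus (length ls)\<^esub> s k) l sequentially"
    by (rule approximable_sequence[OF l']) (rule that)
  show ?thesis
    unfolding T_lim_def dim
  proof (rule the_equality)
    show "F l \<in> carrier_mat N N \<and> (\<forall>s::nat \<Rightarrow> nat. (\<forall>k. 0 < s k) \<and> filterlim s at_top sequentially \<and>
        limitin (torus_topology (length ls)) (\<lambda>k. tau ls [^]\<^bsub>torus (length ls)\<^esub> s k) l sequentially
        \<longrightarrow> mat_tendsto N (\<lambda>k. normalized_power T (s k)) (F l))"
      using F normalized_power_tendsto by blast
    fix L assume "L \<in> carrier_mat N N \<and> (\<forall>s::nat \<Rightarrow> nat. (\<forall>k. 0 < s k) \<and> filterlim s at_top sequentially \<and>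
        limitin (torus_topology (length ls)) (\<lambda>k. tau ls [^]\<^bsub>torus (length ls)\<^esub> s k) l sequentially
        \<longrightarrow> mat_tendsto N (\<lambda>k. normalized_power T (s k)) L)"
    then have "mat_tendsto N (\<lambda>k. normalized_power T (s k)) L" using s by blast
    then show "L = F l" using mat_tendsto_unique normalized_power_tendsto[OF s(2,3)] by blast
  qed
qed

definition power_average :: "nat \<Rightarrow> complex mat" where
  "power_average k = complex_of_real (1 / real k) \<cdot>\<^sub>m mat_sum N (normalized_power T) {1..k}"

lemma power_average_entry:
  "u < N \<Longrightarrow> v < N \<Longrightarrow> power_average k $$ (u, v) = (\<Sum>m=1..k. normalized_power T m $$ (u, v)) / of_nat k"
  by (simp add: power_average_def mat_sum_def)

text \<open>A single matrix has to satisfy both clauses of \<open>T_hat\<close>. Its entries are the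
  means of the sequences \<open>F (orbit m)\<close>; the difference to the normalized powers has
  vanishing Cesaro means, and \<open>haar_integral_eq_mean\<close> recovers the same numbers from
  any Haar measure.\<close>

lemma T_hat_tendsto: "mat_tendsto N power_average (T_hat T ls)"
proof -
  have dim: "dim_row T = N" using T by simp
  have "\<exists>c. \<forall>\<epsilon>>0. \<exists>N0>0. \<forall>k\<ge>N0. \<forall>m. cmod (window_mean (\<lambda>m. F (orbit m) $$ (u, v)) k m - c) \<le> \<epsilon>"
    if uv: "u < N" "v < N" for u v
    using almost_periodic_mean[OF almost_periodic_orbit[OF F_lipschitz[OF uv]]] by metis
  then obtain c where c: "\<And>u v \<epsilon>. u < N \<Longrightarrow> v < N \<Longrightarrow> \<epsilon> > 0 \<Longrightarrow>
      \<exists>N0>0. \<forall>k\<ge>N0. \<forall>m. cmod (window_mean (\<lambda>m. F (orbit m) $$ (u, v)) k m - c u v) \<le> \<epsilon>"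
    by metis
  define M where "M = Matrix.mat N N (\<lambda>(u, v). c u v)"
  have lim: "mat_tendsto N power_average M"
    unfolding mat_tendsto_def
  proof (intro conjI allI impI)
    show "M \<in> carrier_mat N N" by (simp add: M_def)
    fix u v assume uv: "u < N" "v < N"
    have "(\<lambda>k. window_mean (\<lambda>m. F (orbit m) $$ (u, v)) k 0) \<longlonglongrightarrow> c u v"
    proof (rule metric_LIMSEQ_I)
      fix e :: real assume "e > 0"
      then obtain N0 where "\<And>k. k \<ge> N0 \<Longrightarrow> cmod (window_mean (\<lambda>m. F (orbit m) $$ (u, v)) k 0 - c u v) \<le> e / 2"
        using c[OF uv, of "e / 2"] by auto
      then show "\<exists>N0. \<forall>k\<ge>N0. dist (window_mean (\<lambda>m. F (orbit m) $$ (u, v)) k 0) (c u v) < e"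
        using \<open>e > 0\<close> by (intro exI[of _ N0]) (fastforce simp: dist_norm)
    qed
    from tendsto_add[OF cesaro_null[OF F_limit[OF uv]] this]
    have "(\<lambda>k. (\<Sum>m=1..k. normalized_power T m $$ (u, v)) / of_nat k) \<longlonglongrightarrow> c u v"
      by (simp add: window_mean_def sum_subtractf diff_divide_distrib)
    then show "(\<lambda>k. power_average k $$ (u, v)) \<longlonglongrightarrow> M $$ (u, v)"
      using uv by (simp add: power_average_entry M_def)
  qed
  have haar: "M = T_lim_integral T ls \<mu>" if \<mu>: "normalized_haar ls \<mu>" for \<mu>
  proof (rule eq_matI)
    fix u v assume "u < dim_row (T_lim_integral T ls \<mu>)" "v < dim_col (T_lim_integral T ls \<mu>)"
    then have uv: "u < N" "v < N" using dim by (auto simp: T_lim_integral_def)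
    have space: "space \<mu> = Lambda ls" using \<mu> by (simp add: normalized_haar_def)
    have "(\<integral>l. T_lim T ls l $$ (u, v) \<partial>\<mu>) = (\<integral>l. F l $$ (u, v) \<partial>\<mu>)"
      by (intro Bochner_Integration.integral_cong refl) (simp add: space T_lim_eq)
    also have "\<dots> = c u v"
      by (rule haar_integral_eq_mean[OF \<mu> F_lipschitz[OF uv]]) (rule c[OF uv])
    finally show "M $$ (u, v) = T_lim_integral T ls \<mu> $$ (u, v)"
      using uv by (simp add: M_def T_lim_integral_def dim)
  qed (auto simp: M_def T_lim_integral_def dim)
  have "T_hat T ls = M"
    unfolding T_hat_def dim power_average_def[symmetric]
  proof (rule the_equality)
    show "mat_tendsto N power_average M \<and> (\<forall>\<mu>. normalized_haar ls \<mu> \<longrightarrow> M = T_lim_integral T ls \<mu>)"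
      using lim haar by blast
  qed (use lim mat_tendsto_unique in blast)
  then show ?thesis using lim by simp
qed

end

section \<open>Kraus decompositions of the limits\<close>

lemma choi_form_diff_le:
  assumes "\<And>i j. i < n * n \<Longrightarrow> j < n * n \<Longrightarrow> cmod (M $$ (i, j) - M' $$ (i, j)) \<le> \<epsilon>"
  shows "cmod (choi_form n M v - choi_form n M' v)
    \<le> (\<Sum>a\<in>index_pairs n. \<Sum>b\<in>index_pairs n. cmod (v a) * cmod (v b)) * \<epsilon>"
proof -
  have "choi_form n M v - choi_form n M' v
      = (\<Sum>a\<in>index_pairs n. \<Sum>b\<in>index_pairs n. cnj (v a) * v b * (choi n M a b - choi n M' a b))"
    by (simp only: choi_form_def sum_subtractf right_diff_distrib)
  also have "cmod \<dots> \<le> (\<Sum>a\<in>index_pairs n. \<Sum>b\<in>index_pairs n. cmod (v a) * cmod (v b) * \<epsilon>)"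
  proof (intro sum_norm_le)
    fix a b assume ab: "a \<in> index_pairs n" "b \<in> index_pairs n"
    have "cmod (choi n M a b - choi n M' a b) \<le> \<epsilon>"
      unfolding choi_def using ab by (intro assms pair_index_less) auto
    then show "cmod (cnj (v a) * v b * (choi n M a b - choi n M' a b)) \<le> cmod (v a) * cmod (v b) * \<epsilon>"
      by (simp add: norm_mult mult_left_mono)
  qed
  also have "\<dots> = (\<Sum>a\<in>index_pairs n. \<Sum>b\<in>index_pairs n. cmod (v a) * cmod (v b)) * \<epsilon>"
    by (simp only: sum_distrib_right)
  finally show ?thesis .
qed

lemma choi_form_limit_nonneg:
  assumes lim: "mat_tendsto (n * n) F M"
    and nonneg: "\<And>k. \<exists>r\<ge>0. choi_form n (F k) v = complex_of_real r"
  shows "\<exists>r\<ge>0. choi_form n M v = complex_of_real r"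
proof -
  have conv: "(\<lambda>k. choi_form n (F k) v) \<longlonglongrightarrow> choi_form n M v"
    using lim by (intro choi_form_tendsto) (auto simp: mat_tendsto_def)
  have F: "Re (choi_form n (F k) v) \<ge> 0 \<and> Im (choi_form n (F k) v) = 0" for k
    using nonneg[of k] by auto
  have "Re (choi_form n M v) \<ge> 0"
    using tendsto_Re[OF conv] F by (intro LIMSEQ_le_const) auto
  moreover have "Im (choi_form n M v) = 0"
    using tendsto_Im[OF conv] F by (simp add: LIMSEQ_const_iff)
  ultimately show ?thesis
    by (intro exI[of _ "Re (choi_form n M v)"]) (simp add: complex_eq_iff)
qed

text \<open>The form is a sum of squared moduli, so its null vectors are the functionals that
  annihilate the span of the Kraus matrices: inclusions of spans become implications between zeros
  of forms.\<close>

lemma choi_form_kraus_sum_zero_iff: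
  assumes "\<And>h. h < r \<Longrightarrow> W h \<in> carrier_mat n n"
  shows "choi_form n (kraus_sum n r W) v = 0 \<longleftrightarrow> (\<forall>h<r. pairing n v (W h) = 0)"
proof -
  have "choi_form n (kraus_sum n r W) v = complex_of_real (\<Sum>h<r. (cmod (pairing n v (W h)))\<^sup>2)"
    by (rule choi_form_kraus_sum) (rule assms)
  then have "choi_form n (kraus_sum n r W) v = 0 \<longleftrightarrow> (\<Sum>h<r. (cmod (pairing n v (W h)))\<^sup>2) = 0"
    by (simp only: of_real_eq_0_iff)
  also have "\<dots> \<longleftrightarrow> (\<forall>h<r. pairing n v (W h) = 0)"
    by (subst sum_nonneg_eq_0_iff) auto
  finally show ?thesis .
qed

lemma pow_mat_commute_self:
  assumes "T \<in> carrier_mat N N"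
  shows "T * T ^\<^sub>m m = T ^\<^sub>m Suc m"
proof (induction m)
  case 0
  then show ?case using assms by simp
next
  case (Suc m)
  have "T * T ^\<^sub>m Suc m = (T * T ^\<^sub>m m) * T"
    using assms by (simp add: assoc_mult_mat[of _ N N _ N _ N])
  then show ?case using Suc by simp
qed

text \<open>Crude count: \<open>N * N\<close> entries, each a sum of \<open>N\<close> products. What
  matters is that the constant does not depend on \<open>A\<close>, so that it bounds the growth
  from one power to the next.\<close>

lemma op_norm_mult_bound:
  assumes A: "A \<in> carrier_mat N N" and T: "T \<in> carrier_mat N N" and N: "N > 0"
  shows "op_norm (A * T) \<le> (real N * real N * real N * entry_sum N T) * op_norm A"
proof -
  have AT: "A * T \<in> carrier_mat N N" using A T by simp
  have "op_norm (A * T) \<le> entry_sum N (A * T)" by (rule op_norm_le_entry_sum[OF AT N])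
  also have "\<dots> \<le> (\<Sum>i<N. \<Sum>j<N. \<Sum>k<N. op_norm A * entry_sum N T)"
    unfolding entry_sum_def[of N "A * T"]
  proof (intro sum_mono)
    fix i j assume ij: "i \<in> {..<N}" "j \<in> {..<N}"
    have "(A * T) $$ (i, j) = (\<Sum>k<N. A $$ (i, k) * T $$ (k, j))"
      using A T ij by (intro mult_entry) auto
    also have "cmod \<dots> \<le> (\<Sum>k<N. op_norm A * entry_sum N T)"
      using A ij op_norm_nonneg[OF A N]
      by (intro sum_norm_le) (auto simp: norm_mult intro!: mult_mono entry_le_op_norm entry_le_entry_sum)
    finally show "cmod ((A * T) $$ (i, j)) \<le> (\<Sum>k<N. op_norm A * entry_sum N T)" .
  qed
  also have "\<dots> = (real N * real N * real N * entry_sum N T) * op_norm A" by simp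
  finally show ?thesis .
qed

lemma mat_tendsto_mult:
  assumes "mat_tendsto N F M" "T \<in> carrier_mat N N" "\<And>k. F k \<in> carrier_mat N N"
  shows "mat_tendsto N (\<lambda>k. T * F k) (T * M)" "mat_tendsto N (\<lambda>k. F k * T) (M * T)"
proof -
  have M: "M \<in> carrier_mat N N" using assms(1) by (simp add: mat_tendsto_def)
  have lim: "(\<lambda>k. F k $$ (i, j)) \<longlonglongrightarrow> M $$ (i, j)" if "i < N" "j < N" for i j
    using assms(1) that by (simp add: mat_tendsto_def)
  show "mat_tendsto N (\<lambda>k. T * F k) (T * M)"
    unfolding mat_tendsto_def
    using assms(2,3) M
    by (auto simp: mult_entry[of _ N] simp del: index_mult_mat(1) intro!: tendsto_intros lim)
  show "mat_tendsto N (\<lambda>k. F k * T) (M * T)"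
    unfolding mat_tendsto_def
    using assms(2,3) M
    by (auto simp: mult_entry[of _ N] simp del: index_mult_mat(1) intro!: tendsto_intros lim)
qed

locale kraus_limit = normalized_limit ls T "n * n" F K
  for ls T n F K +
  fixes d :: nat and X :: "nat \<Rightarrow> complex mat"
  assumes X: "\<And>i. i < d \<Longrightarrow> X i \<in> carrier_mat n n"
    and T_kraus: "T = kraus_sum n d X"
    and F_nonzero: "\<And>x. x \<in> torus_set (length ls) \<Longrightarrow> \<exists>u<n * n. \<exists>v<n * n. F x $$ (u, v) \<noteq> 0"
begin

abbreviation generated :: "complex mat set" where
  "generated \<equiv> gen_algebra n (X ` {..<d})"

lemma X_carrier: "X ` {..<d} \<subseteq> carrier_mat n n"
  using X by auto

lemma choi_form_power: "\<exists>r\<ge>0. choi_form n (T ^\<^sub>m m) v = complex_of_real r"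
proof -
  obtain r W where W: "\<And>h. h < r \<Longrightarrow> W h \<in> carrier_mat n n" "kraus_sum n d X ^\<^sub>m m = kraus_sum n r W"
    "\<And>h. m > 0 \<Longrightarrow> h < r \<Longrightarrow> W h \<in> generated"
    by (rule power_kraus_sum[of d X n m]) (erule X, rule that, assumption+)
  show ?thesis
  proof (intro exI conjI)
    show "choi_form n (T ^\<^sub>m m) v = complex_of_real (\<Sum>h<r. (cmod (pairing n v (W h)))\<^sup>2)"
      unfolding T_kraus W(2) by (rule choi_form_kraus_sum) (rule W(1))
  qed (auto intro: sum_nonneg)
qed

lemma choi_form_power_zero:
  assumes "m > 0" "\<And>A. A \<in> generated \<Longrightarrow> pairing n v A = 0"
  shows "choi_form n (T ^\<^sub>m m) v = 0"
proof -
  obtain r W where W: "\<And>h. h < r \<Longrightarrow> W h \<in> carrier_mat n n"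
    "\<And>h. m > 0 \<Longrightarrow> h < r \<Longrightarrow> W h \<in> generated" "kraus_sum n d X ^\<^sub>m m = kraus_sum n r W"
    by (rule power_kraus_sum[of d X n m]) (erule X, rule that, assumption+)
  show ?thesis
    unfolding T_kraus W(3) using assms W(2) choi_form_kraus_sum_zero_iff[of r W n v, OF W(1)] by blast
qed

definition power_form :: "(nat \<times> nat \<Rightarrow> complex) \<Rightarrow> nat \<Rightarrow> real" where
  "power_form v m = Re (choi_form n (normalized_power T m) v)"

lemma T_power_carrier [simp]: "T ^\<^sub>m m \<in> carrier_mat (n * n) (n * n)"
  using T(1) by simp

lemma op_norm_power_nonneg: "op_norm (T ^\<^sub>m m) \<ge> 0"
  using op_norm_nonneg[OF T_power_carrier] T(2) by simp

lemma power_form_eq: "power_form v m = Re (choi_form n (T ^\<^sub>m m) v) / op_norm (T ^\<^sub>m m)"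
  unfolding power_form_def normalized_power_def choi_form_smult[OF T_power_carrier] by simp

lemma power_form_nonneg: "power_form v m \<ge> 0"
  unfolding power_form_eq using choi_form_power[of m v] op_norm_power_nonneg[of m] by auto

lemma choi_form_normalized_power: "choi_form n (normalized_power T m) v = complex_of_real (power_form v m)"
proof -
  have "Im (choi_form n (normalized_power T m) v) = 0"
    unfolding normalized_power_def choi_form_smult[OF T_power_carrier]
    using choi_form_power[of m v] by auto
  then show ?thesis by (simp add: power_form_def complex_eq_iff)
qed

lemma power_average_carrier: "power_average k \<in> carrier_mat (n * n) (n * n)"
  by (simp add: power_average_def)

lemma choi_form_power_average:
  "choi_form n (power_average k) v = complex_of_real ((\<Sum>m=1..k. power_form v m) / real k)"
  unfolding power_average_def choi_form_smult[OF mat_sum_carrier] choi_form_mat_sum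
  by (simp add: choi_form_normalized_power)

lemma choi_form_T_hat: "\<exists>r\<ge>0. choi_form n (T_hat T ls) v = complex_of_real r"
proof (rule choi_form_limit_nonneg[OF T_hat_tendsto])
  fix k
  show "\<exists>r\<ge>0. choi_form n (power_average k) v = complex_of_real r"
    unfolding choi_form_power_average
    by (intro exI[of _ "(\<Sum>m=1..k. power_form v m) / real k"] conjI refl divide_nonneg_nonneg
        sum_nonneg power_form_nonneg of_nat_0_le_iff)
qed

lemma power_form_mean:
  "(\<lambda>k. (\<Sum>m=1..k. power_form v m) / real k) \<longlonglongrightarrow> Re (choi_form n (T_hat T ls) v)"
proof -
  have "(\<lambda>k. choi_form n (power_average k) v) \<longlonglongrightarrow> choi_form n (T_hat T ls) v"
    using T_hat_tendsto by (intro choi_form_tendsto) (auto simp: mat_tendsto_def)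
  from tendsto_Re[OF this] show ?thesis unfolding choi_form_power_average by simp
qed

lemma choi_form_F:
  assumes l: "l \<in> Lambda ls"
  shows "\<exists>r\<ge>0. choi_form n (F l) v = complex_of_real r"
proof -
  have l': "l \<in> torus_set (length ls)" "approximable l" using l Lambda_iff by blast+
  obtain s :: "nat \<Rightarrow> nat" where s: "\<And>k. 0 < s k" "filterlim s at_top sequentially"
    "limitin (torus_topology (length ls)) (\<lambda>k. tau ls [^]\<^bsub>torus (length ls)\<^esub> s k) l sequentially"
    by (rule approximable_sequence[OF l']) (rule that)
  show ?thesis
    by (rule choi_form_limit_nonneg[OF normalized_power_tendsto[OF s(2,3)]])
      (use power_form_nonneg choi_form_normalized_power in blast)
qed

text \<open>The powers return close to each limit with bounded gaps.\<close>

lemma choi_form_F_zero: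
  assumes l: "l \<in> Lambda ls" and zero: "choi_form n (T_hat T ls) v = 0"
  shows "choi_form n (F l) v = 0"
proof -
  obtain \<eta> where eta: "\<eta> \<ge> 0" "choi_form n (F l) v = complex_of_real \<eta>"
    using choi_form_F[OF l] by blast
  have "\<eta> / 2 \<le> 0"
  proof (cases "\<eta> = 0")
    case False
    then have pos: "\<eta> > 0" using eta(1) by simp
    define V where "V = (\<Sum>a\<in>index_pairs n. \<Sum>b\<in>index_pairs n. cmod (v a) * cmod (v b))"
    have V: "V \<ge> 0" unfolding V_def by (intro sum_nonneg) auto
    \<comment> \<open>Passing from the normalized power to \<open>F\<close> on the orbit, and from
      there to \<open>F l\<close>, costs \<open>\<epsilon>\<close> per entry each time, so the form
      moves by at most \<open>V * (2 * \<epsilon>) \<le> \<eta> / 2\<close>.\<close>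
    define \<epsilon> where "\<epsilon> = \<eta> / (4 * (V + 1))"
    have e: "\<epsilon> > 0" using pos V by (simp add: \<epsilon>_def)
    have Ve: "V * (2 * \<epsilon>) \<le> \<eta> / 2"
    proof -
      have "V * (2 * \<epsilon>) \<le> (V + 1) * (2 * \<epsilon>)" using e by (intro mult_right_mono) auto
      also have "\<dots> = \<eta> / 2" using V by (simp only: \<epsilon>_def) (simp add: divide_simps)
      finally show ?thesis .
    qed
    obtain q where q: "\<And>m. \<exists>j\<le>q. \<forall>i<length ls. cmod (ls ! i ^ (m + j) - l i) < \<epsilon> / K"
      using orbit_syndetic[OF l, of "\<epsilon> / K"] e K_pos by auto
    \<comment> \<open>There are finitely many entries, so one threshold \<open>M\<close> serves them
      all.\<close>
    have "\<forall>\<^sub>F m in sequentially. \<forall>w\<in>{..<n * n} \<times> {..<n * n}.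
        cmod (normalized_power T m $$ w - F (orbit m) $$ w) < \<epsilon>"
    proof (rule eventually_ball_finite)
      show "\<forall>w\<in>{..<n * n} \<times> {..<n * n}. \<forall>\<^sub>F m in sequentially.
          cmod (normalized_power T m $$ w - F (orbit m) $$ w) < \<epsilon>"
        using tendstoD[OF F_limit e] by (auto simp: dist_norm)
    qed simp
    then obtain M where M: "\<And>m u w. m \<ge> M \<Longrightarrow> u < n * n \<Longrightarrow> w < n * n \<Longrightarrow>
        cmod (normalized_power T m $$ (u, w) - F (orbit m) $$ (u, w)) < \<epsilon>"
      unfolding eventually_sequentially by auto
    have hit: "\<exists>j\<le>q. power_form v (m + j) \<ge> \<eta> / 2" if m: "m \<ge> M" for m
    proof -
      obtain j where j: "j \<le> q" "\<And>i. i < length ls \<Longrightarrow> cmod (ls ! i ^ (m + j) - l i) < \<epsilon> / K"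
        using q by blast
      have "cmod (normalized_power T (m + j) $$ (u, w) - F l $$ (u, w)) \<le> 2 * \<epsilon>"
        if uw: "u < n * n" "w < n * n" for u w
      proof -
        have "cmod (F (orbit (m + j)) $$ (u, w) - F l $$ (u, w)) \<le> K * (\<epsilon> / K)"
          using j(2) l Lambda_subset_torus by (intro lipschitz_on_torusD[OF F_lipschitz[OF uw]]) auto
        then have "cmod (F (orbit (m + j)) $$ (u, w) - F l $$ (u, w)) \<le> \<epsilon>" using K_pos by simp
        then show ?thesis
          using M[of "m + j" u w] m uw
            norm_triangle_ineq[of "normalized_power T (m + j) $$ (u, w) - F (orbit (m + j)) $$ (u, w)"
              "F (orbit (m + j)) $$ (u, w) - F l $$ (u, w)"] by simp
      qed
      then have "cmod (choi_form n (normalized_power T (m + j)) v - choi_form n (F l) v) \<le> V * (2 * \<epsilon>)"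
        unfolding V_def by (rule choi_form_diff_le)
      then have "\<bar>power_form v (m + j) - \<eta>\<bar> \<le> \<eta> / 2"
        using Ve unfolding choi_form_normalized_power eta(2) of_real_diff[symmetric] norm_of_real by simp
      then show ?thesis using j(1) by (intro exI[of _ j]) linarith
    qed
    have "(\<lambda>k. (\<Sum>m=1..k. power_form v m) / real k) \<longlonglongrightarrow> 0"
      using power_form_mean[of v] zero by simp
    then show ?thesis
      by (rule cesaro_null_syndetic[OF power_form_nonneg _ hit])
  qed simp
  then show ?thesis using eta by simp
qed

lemma mult_normalized_power:
  "T * normalized_power T m = complex_of_real (1 / op_norm (T ^\<^sub>m m)) \<cdot>\<^sub>m (T ^\<^sub>m Suc m)"
  "normalized_power T m * T = complex_of_real (1 / op_norm (T ^\<^sub>m m)) \<cdot>\<^sub>m (T ^\<^sub>m Suc m)"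
  unfolding normalized_power_def
  using mult_smult_distrib[OF T(1) T_power_carrier] mult_smult_assoc_mat[OF T_power_carrier T(1)]
    pow_mat_commute_self[OF T(1)]
  by simp_all

lemma mult_power_average:
  "T * power_average k = complex_of_real (1 / real k) \<cdot>\<^sub>m mat_sum (n * n) (\<lambda>m. T * normalized_power T m) {1..k}"
  "power_average k * T = complex_of_real (1 / real k) \<cdot>\<^sub>m mat_sum (n * n) (\<lambda>m. normalized_power T m * T) {1..k}"
proof -
  let ?L = "complex_of_real (1 / real k) \<cdot>\<^sub>m mat_sum (n * n) (\<lambda>m. T * normalized_power T m) {1..k}"
  let ?R = "complex_of_real (1 / real k) \<cdot>\<^sub>m mat_sum (n * n) (\<lambda>m. normalized_power T m * T) {1..k}"
  show "T * power_average k = ?L"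
  proof (rule eq_matI)
    fix u w assume "u < dim_row ?L" "w < dim_col ?L"
    then have uw: "u < n * n" "w < n * n" by (auto simp: mat_sum_def)
    have "(T * power_average k) $$ (u, w) = (\<Sum>i<n * n. T $$ (u, i) * ((\<Sum>m=1..k. normalized_power T m $$ (i, w)) / of_nat k))"
      using mult_entry[OF T(1) power_average_carrier uw] uw by (simp add: power_average_entry)
    also have "\<dots> = (\<Sum>m=1..k. \<Sum>i<n * n. T $$ (u, i) * normalized_power T m $$ (i, w)) / of_nat k"
      by (subst sum.swap) (simp add: sum_divide_distrib sum_distrib_left)
    also have "\<dots> = (\<Sum>m=1..k. (T * normalized_power T m) $$ (u, w)) / of_nat k"
      using mult_entry[OF T(1) normalized_power_carrier uw] by simp
    finally show "(T * power_average k) $$ (u, w) = ?L $$ (u, w)"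
      using uw by (simp add: mat_sum_def)
  qed (use T power_average_carrier in \<open>auto simp: mat_sum_def power_average_def\<close>)
  show "power_average k * T = ?R"
  proof (rule eq_matI)
    fix u w assume "u < dim_row ?R" "w < dim_col ?R"
    then have uw: "u < n * n" "w < n * n" by (auto simp: mat_sum_def)
    have "(power_average k * T) $$ (u, w) = (\<Sum>i<n * n. ((\<Sum>m=1..k. normalized_power T m $$ (u, i)) / of_nat k) * T $$ (i, w))"
      using mult_entry[OF power_average_carrier T(1) uw] uw by (simp add: power_average_entry)
    also have "\<dots> = (\<Sum>m=1..k. \<Sum>i<n * n. normalized_power T m $$ (u, i) * T $$ (i, w)) / of_nat k"
      by (subst sum.swap) (simp add: sum_divide_distrib sum_distrib_right)
    also have "\<dots> = (\<Sum>m=1..k. (normalized_power T m * T) $$ (u, w)) / of_nat k"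
      using mult_entry[OF normalized_power_carrier T(1) uw] by simp
    finally show "(power_average k * T) $$ (u, w) = ?R $$ (u, w)"
      using uw by (simp add: mat_sum_def)
  qed (use T power_average_carrier in \<open>auto simp: mat_sum_def power_average_def\<close>)
qed

lemma T_hat_carrier: "T_hat T ls \<in> carrier_mat (n * n) (n * n)"
  using T_hat_tendsto by (simp add: mat_tendsto_def)

text \<open>Each normalized power commutes with \<open>T\<close>, hence so do the averages and their
  limit. It lets the bound for left multiplication serve right multiplication too.\<close>

lemma T_hat_commute: "T_hat T ls * T = T * T_hat T ls"
proof (rule mat_tendsto_unique)
  show "mat_tendsto (n * n) (\<lambda>k. T * power_average k) (T * T_hat T ls)"
    by (rule mat_tendsto_mult[OF T_hat_tendsto T(1) power_average_carrier])
  have "(\<lambda>k. T * power_average k) = (\<lambda>k. power_average k * T)"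
    unfolding mult_power_average mult_normalized_power ..
  then show "mat_tendsto (n * n) (\<lambda>k. T * power_average k) (T_hat T ls * T)"
    using mat_tendsto_mult(2)[OF T_hat_tendsto T(1) power_average_carrier] by simp
qed

text \<open>The norm of \<open>T ^ (m + 1)\<close> is at most \<open>c\<close> times that of \<open>T ^ m\<close>, so the form of \<open>T T_hat\<close> is
  dominated by \<open>c\<close> times that of \<open>T_hat\<close>.\<close>

lemma choi_form_mult_T_hat_zero:
  assumes zero: "choi_form n (T_hat T ls) v = 0"
  shows "choi_form n (T * T_hat T ls) v = 0"
proof -
  \<comment> \<open>The form of \<open>T * normalized_power T m\<close>: power \<open>Suc m\<close>,
    but divided by the norm of power \<open>m\<close>.\<close>
  define a where "a = (\<lambda>m. Re (choi_form n (T ^\<^sub>m Suc m) v) / op_norm (T ^\<^sub>m m))"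
  define c where "c = real (n * n) * real (n * n) * real (n * n) * entry_sum (n * n) T"
  have c: "c \<ge> 0" unfolding c_def by (intro mult_nonneg_nonneg entry_sum_nonneg) auto
  have p: "Re (choi_form n (T ^\<^sub>m m) v) \<ge> 0" for m using choi_form_power[of m v] by auto
  have a_nonneg: "0 \<le> a m" for m
    unfolding a_def using p op_norm_power_nonneg by (intro divide_nonneg_nonneg)
  have a_le: "a m \<le> c * power_form v (Suc m)" for m
  proof -
    define P s t where "P = Re (choi_form n (T ^\<^sub>m Suc m) v)" and "s = op_norm (T ^\<^sub>m m)"
      and "t = op_norm (T ^\<^sub>m Suc m)"
    have "t \<le> c * s"
      using op_norm_mult_bound[OF T_power_carrier[of m] T] by (simp add: t_def s_def c_def)
    \<comment> \<open>Division by 0 gives 0, so for \<open>t = 0\<close> the claimed upper bound is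
      0 and \<open>P\<close> itself has to vanish.\<close>
    moreover have "P = 0" if "t = 0"
    proof -
      have "(T ^\<^sub>m Suc m) $$ (i, j) = 0" if "i < n * n" "j < n * n" for i j
        using entry_le_op_norm[OF T_power_carrier that, of "Suc m"] \<open>t = 0\<close> by (simp add: t_def)
      then have "choi_form n (T ^\<^sub>m Suc m) v = 0"
        unfolding choi_form_def choi_def by (intro sum.neutral ballI) (auto simp: pair_index_less simp del: pow_mat.simps)
      then show ?thesis by (simp add: P_def)
    qed
    moreover have "P \<ge> 0" "s \<ge> 0" "t \<ge> 0"
      using p op_norm_power_nonneg by (auto simp: P_def s_def t_def simp del: pow_mat.simps)
    ultimately have "P / s \<le> c * (P / t)"
      using c by (cases "s = 0"; cases "t = 0") (auto simp: divide_simps mult_left_mono mult.commute mult.left_commute)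
    then show ?thesis by (simp add: a_def power_form_eq P_def s_def t_def del: pow_mat.simps)
  qed
  have "(\<lambda>k. (\<Sum>m=1..k. a m) / real k) \<longlonglongrightarrow> 0"
    by (rule cesaro_null_shift[of a c "power_form v", OF a_nonneg a_le power_form_nonneg c])
      (use power_form_mean[of v] zero in simp)
  moreover have "(\<lambda>k. choi_form n (T * power_average k) v) \<longlonglongrightarrow> choi_form n (T * T_hat T ls) v"
    using mat_tendsto_mult(1)[OF T_hat_tendsto T(1) power_average_carrier]
    by (intro choi_form_tendsto) (auto simp: mat_tendsto_def)
  moreover have "choi_form n (T * power_average k) v = complex_of_real ((\<Sum>m=1..k. a m) / real k)" for k
  proof -
    have "choi_form n (T ^\<^sub>m Suc m) v = complex_of_real (Re (choi_form n (T ^\<^sub>m Suc m) v))" for m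
      using choi_form_power[of "Suc m" v] by (auto simp del: pow_mat.simps)
    then have "choi_form n (T * normalized_power T m) v = complex_of_real (a m)" for m
      unfolding mult_normalized_power choi_form_smult[OF T_power_carrier] a_def
      by (metis mult.left_neutral of_real_mult times_divide_eq_left)
    then show ?thesis
      unfolding mult_power_average choi_form_smult[OF mat_sum_carrier] choi_form_mat_sum by simp
  qed
  ultimately have "(\<lambda>k. complex_of_real ((\<Sum>m=1..k. a m) / real k)) \<longlonglongrightarrow> choi_form n (T * T_hat T ls) v"
    "(\<lambda>k. complex_of_real ((\<Sum>m=1..k. a m) / real k)) \<longlonglongrightarrow> complex_of_real 0"
    by (simp_all only: tendsto_of_real)
  then show ?thesis using LIMSEQ_unique by fastforce
qed

lemma kraus_limit_decomposition:
  "\<exists>(a::nat) (A :: (nat \<Rightarrow> complex) \<Rightarrow> nat \<Rightarrow> complex mat).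
    (\<forall>l\<in>Lambda ls. (\<forall>j<a. A l j \<in> carrier_mat n n) \<and> T_lim T ls l = kraus_sum n a (A l)) \<and>
    (\<exists>(b::nat) (B :: nat \<Rightarrow> complex mat).
       (\<forall>k<b. B k \<in> carrier_mat n n) \<and>
       two_sided_ideal n (mat_span n b B) generated \<and>
       mat_span n b B \<noteq> {0\<^sub>m n n} \<and>
       T_hat T ls = kraus_sum n b B \<and>
       (\<forall>l\<in>Lambda ls. \<forall>j<a. A l j \<in> mat_span n b B))"
proof -
  \<comment> \<open>Used for both counts of matrices, \<open>a\<close> and \<open>b\<close>.\<close>
  define b where "b = n * n"
  have n: "n > 0" using T(2) by (cases n) auto
  then have b: "b > 0" by (simp add: b_def)
  obtain B where B: "\<And>h. h < b \<Longrightarrow> B h \<in> carrier_mat n n" "T_hat T ls = kraus_sum n b B"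
    by (rule kraus_decomposition[OF T_hat_carrier choi_form_T_hat, folded b_def]) (rule that)
  have "\<exists>A. (\<forall>h<b. A h \<in> carrier_mat n n) \<and> F l = kraus_sum n b A" if l: "l \<in> Lambda ls" for l
    unfolding b_def by (rule kraus_decomposition[OF F choi_form_F[OF l]]) blast
  then obtain A where A: "\<And>l h. l \<in> Lambda ls \<Longrightarrow> h < b \<Longrightarrow> A l h \<in> carrier_mat n n"
    "\<And>l. l \<in> Lambda ls \<Longrightarrow> F l = kraus_sum n b (A l)" by metis
  have hat_zero: "choi_form n (T_hat T ls) v = 0" if "\<And>k. k < b \<Longrightarrow> pairing n v (B k) = 0" for v
    unfolding B(2) using choi_form_kraus_sum_zero_iff[of b B n v, OF B(1)] that by blast
  have AB: "A l j \<in> mat_span n b B" if l: "l \<in> Lambda ls" and j: "j < b" for l j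
  proof (rule mat_span_annihilator[of b B n, OF B(1) A(1)[OF l j]])
    fix v assume "\<And>k. k < b \<Longrightarrow> pairing n v (B k) = 0"
    then have "choi_form n (F l) v = 0" using choi_form_F_zero[OF l] hat_zero by blast
    then show "pairing n v (A l j) = 0"
      unfolding A(2)[OF l] using choi_form_kraus_sum_zero_iff[of b "A l" n v, OF A(1)[OF l]] j by blast
  qed
  have B_gen: "B k \<in> generated" if k: "k < b" for k
  proof (rule gen_algebra_annihilator[OF X_carrier B(1)[OF k]])
    fix v assume v: "\<And>A. A \<in> generated \<Longrightarrow> pairing n v A = 0"
    \<comment> \<open>The averages start at \<open>m = 1\<close>, so only powers whose Kraus
      matrices lie in the algebra occur.\<close>
    have "(\<Sum>m=1..k. power_form v m) = 0" for k
      using choi_form_power_zero[OF _ v] by (intro sum.neutral) (simp add: power_form_eq)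
    then have "Re (choi_form n (T_hat T ls) v) = 0"
      using power_form_mean[of v] by (simp add: LIMSEQ_const_iff)
    then have "choi_form n (T_hat T ls) v = 0" using choi_form_T_hat[of v] by auto
    then show "pairing n v (B k) = 0"
      unfolding B(2) using choi_form_kraus_sum_zero_iff[of b B n v, OF B(1)] k by blast
  qed
  \<comment> \<open>\<open>T * T_hat\<close> is the Kraus sum of all products
    \<open>X i * B k\<close>; a null vector of its form kills each product separately, which
    extracts the single generator \<open>X i\<close> from \<open>T\<close>.\<close>
  have left: "X i * B k \<in> mat_span n b B" if i: "i < d" and k: "k < b" for i k
  proof (rule mat_span_annihilator[of b B n, OF B(1)])
    show "X i * B k \<in> carrier_mat n n" using X[OF i] B(1)[OF k] by simp
    fix v assume "\<And>k. k < b \<Longrightarrow> pairing n v (B k) = 0"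
    then have zero: "choi_form n (T * T_hat T ls) v = 0"
      using choi_form_mult_T_hat_zero hat_zero by blast
    have eq: "T * T_hat T ls = kraus_sum n (d * b) (\<lambda>h. X (h div b) * B (h mod b))"
      unfolding B(2) by (subst T_kraus) (use X B(1) in \<open>intro kraus_sum_mult\<close>)
    have car: "X (h div b) * B (h mod b) \<in> carrier_mat n n" if "h < d * b" for h
      using X[of "h div b"] B(1)[of "h mod b"] b that by (simp add: less_mult_imp_div_less)
    \<comment> \<open>The index that codes the pair \<open>(i, k)\<close> in
      \<open>kraus_sum_mult\<close>.\<close>
    have "i * b + k < Suc i * b" "Suc i * b \<le> d * b" using i k by (simp, intro mult_le_mono1) auto
    then have h: "i * b + k < d * b" by linarith
    have "\<forall>h<d * b. pairing n v (X (h div b) * B (h mod b)) = 0"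
      by (rule iffD1[OF choi_form_kraus_sum_zero_iff zero[unfolded eq]]) (rule car)
    then have "pairing n v (X ((i * b + k) div b) * B ((i * b + k) mod b)) = 0" using h by blast
    then show "pairing n v (X i * B k) = 0" using k by simp
  qed
  have right: "B k * X i \<in> mat_span n b B" if i: "i < d" and k: "k < b" for i k
  proof (rule mat_span_annihilator[of b B n, OF B(1)])
    show "B k * X i \<in> carrier_mat n n" using X[OF i] B(1)[OF k] by simp
    fix v assume "\<And>k. k < b \<Longrightarrow> pairing n v (B k) = 0"
    then have zero: "choi_form n (T_hat T ls * T) v = 0"
      unfolding T_hat_commute using choi_form_mult_T_hat_zero hat_zero by blast
    have eq: "T_hat T ls * T = kraus_sum n (b * d) (\<lambda>h. B (h div d) * X (h mod d))"
      unfolding B(2) by (subst T_kraus) (use X B(1) in \<open>intro kraus_sum_mult\<close>)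
    have car: "B (h div d) * X (h mod d) \<in> carrier_mat n n" if "h < b * d" for h
      using B(1)[of "h div d"] X[of "h mod d"] i that by (simp add: less_mult_imp_div_less)
    have "k * d + i < Suc k * d" "Suc k * d \<le> b * d" using i k by (simp, intro mult_le_mono1) auto
    then have h: "k * d + i < b * d" by linarith
    have "\<forall>h<b * d. pairing n v (B (h div d) * X (h mod d)) = 0"
      by (rule iffD1[OF choi_form_kraus_sum_zero_iff zero[unfolded eq]]) (rule car)
    then have "pairing n v (B ((k * d + i) div d) * X ((k * d + i) mod d)) = 0" using h by blast
    then show "pairing n v (B k * X i) = 0" using i by simp
  qed
  have ideal: "two_sided_ideal n (mat_span n b B) generated"
    by (rule mat_span_two_sided_ideal[OF X_carrier B_gen]) (use left right in auto)
  have nonzero: "mat_span n b B \<noteq> {0\<^sub>m n n}"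
  proof
    assume trivial: "mat_span n b B = {0\<^sub>m n n}"
    \<comment> \<open>The identity of \<Lambda> as sample point: a trivial span would make all its
      Kraus matrices zero, and with them \<open>F ?l\<close>.\<close>
    let ?l = "orbit 0"
    have l: "?l \<in> Lambda ls" by (rule orbit_in_Lambda)
    have "choi n (F ?l) a c = choi n (0\<^sub>m (n * n) (n * n)) a c"
      if ac: "a \<in> index_pairs n" "c \<in> index_pairs n" for a c
    proof -
      have "A ?l h $$ a = 0" if "h < b" for h
        using AB[OF l that] trivial ac by auto
      then have "choi n (F ?l) a c = 0"
        unfolding A(2)[OF l] using choi_kraus_sum[of b "A ?l" n a c, OF A(1)[OF l] ac] by simp
      then show ?thesis
        using ac pair_index_less[of "fst a" n "fst c"] pair_index_less[of "snd a" n "snd c"]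
        by (auto simp: choi_def)
    qed
    then have "F ?l = 0\<^sub>m (n * n) (n * n)" by (intro mat_eq_choi[OF F]) auto
    then show False using F_nonzero[OF orbit_in_torus[of 0]] by auto
  qed
  have "\<forall>l\<in>Lambda ls. (\<forall>j<b. A l j \<in> carrier_mat n n) \<and> T_lim T ls l = kraus_sum n b (A l)"
    using A T_lim_eq by simp
  moreover have "(\<forall>k<b. B k \<in> carrier_mat n n) \<and> two_sided_ideal n (mat_span n b B) generated \<and>
      mat_span n b B \<noteq> {0\<^sub>m n n} \<and> T_hat T ls = kraus_sum n b B \<and>
      (\<forall>l\<in>Lambda ls. \<forall>j<b. A l j \<in> mat_span n b B)"
    using B AB ideal nonzero by blast
  ultimately show ?thesis by blast
qed

end

theorem theorem1p3:
  fixes n d :: nat and X :: "nat \<Rightarrow> complex mat" and T :: "complex mat" and ls :: "complex list"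
  assumes "n > 0"
    and "\<And>i. i < d \<Longrightarrow> X i \<in> carrier_mat n n"
    and "outer_spectral_radius n d X = 1"
    and "T = kraus_sum n d X"
    and "distinct ls" and "set ls = maximal_spectrum T"
  shows "\<exists>(a::nat) (A :: (nat \<Rightarrow> complex) \<Rightarrow> nat \<Rightarrow> complex mat).
    (\<forall>l\<in>Lambda ls. (\<forall>j<a. A l j \<in> carrier_mat n n) \<and> T_lim T ls l = kraus_sum n a (A l)) \<and>
    (\<exists>(b::nat) (B :: nat \<Rightarrow> complex mat).
       (\<forall>k<b. B k \<in> carrier_mat n n) \<and>
       two_sided_ideal n (mat_span n b B) (gen_algebra n (X ` {..<d})) \<and>
       mat_span n b B \<noteq> {0\<^sub>m n n} \<and>
       T_hat T ls = kraus_sum n b B \<and>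
       (\<forall>l\<in>Lambda ls. \<forall>j<a. A l j \<in> mat_span n b B))"
proof -
  have T: "T \<in> carrier_mat (n * n) (n * n)" by (simp add: assms(4))
  have N: "n * n > 0" using assms(1) by simp
  have sr: "spectral_radius T = 1"
    using assms(3) unfolding outer_spectral_radius_def assms(4) by (simp only: real_sqrt_eq_1_iff)
  interpret unimodular_list ls by (rule maximal_spectrum_unimodular[OF T N sr assms(6)])
  obtain F K where F: "\<And>x. F x \<in> carrier_mat (n * n) (n * n)"
    "\<And>u v. u < n * n \<Longrightarrow> v < n * n \<Longrightarrow> lipschitz_on_torus (length ls) K (\<lambda>x. F x $$ (u, v))"
    "\<And>u v. u < n * n \<Longrightarrow> v < n * n \<Longrightarrow>
       (\<lambda>m. normalized_power T m $$ (u, v) - F (orbit m) $$ (u, v)) \<longlonglongrightarrow> 0"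
    "\<And>x. x \<in> torus_set (length ls) \<Longrightarrow> \<exists>u<n * n. \<exists>v<n * n. F x $$ (u, v) \<noteq> 0"
    by (rule limit_family[OF T N sr assms(5,6)]) (rule that)
  interpret kraus_limit ls T n F K d X
    by unfold_locales (fact T N F assms)+
  show ?thesis by (rule kraus_limit_decomposition)
qed

end
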